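(* There is an absolute constant $C>0$ such that the following holds in the bilinear saddle-point setting described in the context (assumptions (A1)–(A3), the ambient-smoothness condition, $\mathcal S\ne\varnothing$, and the fixed choice of $z^*$, $f'(x^* )$, $g'(y^* )$, $\xi$, $\zeta$). Assume $\min\{\delta_x,\delta_y\}>0$ and $$\beta_x\delta_y\le\tfrac14,\qquad\beta_y\delta_x\le\tfrac14,$$ and assume that the normal vectors satisfy $\zeta=0$ if $\beta_x>0$ and $\xi=0$ if $\beta_y>0$. Let $\Omega_{\mathrm{in}}>0$ be any number with $\Psi(z_{\mathrm{in}})\le\Omega_{\mathrm{in}}$, where $$\Psi(z):=\|z-z^*\|_{\mathbf P}^2+12\,\mathrm D_f(x,x^* )+12\,\mathrm D_g(y,y^* ).$$ Put $L_1=\kappa_x$, $L_2=\kappa_y$, $L_3=\kappa_{xy}$, $M_1=M_2=0$, $M_3=\sqrt{\kappa_{xy}}$ and $$R_1=\max\Big\{\tilde H_x^{\frac2{1+3\nu_x}}\Omega_{\mathrm{in}}^{\frac{\nu_x-1}{1+3\nu_x}},1\Big\},\quad R_2=\max\Big\{\tilde H_y^{\frac2{1+3\nu_y}}\Omega_{\mathrm{in}}^{\frac{\nu_y-1}{1+3\nu_y}},1\Big\},\quad R_3=\max\{\sqrt{\kappa_{xy}},1\}.$$ Let $\pi$ be a permutation of $\{1,2,3\}$ with $R_{\pi(1)}\le R_{\pi(2)}\le R_{\pi(3)}$. Then there are positive integers $T_1,T_2,T_3$ such that, with the oracle tolerances $$\delta_f=\begin{cases}\dfrac{\Omega_{\mathrm{in}}}{384\,\bar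 N_f},&\nu_x<1,\\0,&\nu_x=1,\end{cases}\qquad\delta_g=\begin{cases}\dfrac{\Omega_{\mathrm{in}}}{384\,\bar N_g},&\nu_y<1,\\0,&\nu_y=1,\end{cases}\qquad\bar N_f=\prod_{j\le\pi^{-1}(1)}T_j,\quad\bar N_g=\prod_{j\le\pi^{-1}(2)}T_j,$$ the Sliding Algorithm applied from $z_{\mathrm{in}}$ with $n=3$, with the pair $(p_{\pi(i)},Q_{\pi(i)})$ (and constants $L_{\pi(i)},M_{\pi(i)}$) at level $i$, produces an output $z_{\mathrm{out}}$ with $$\Psi(z_{\mathrm{out}})\le\tfrac34\,\Omega_{\mathrm{in}},$$ using $N_f\le CR_1$ evaluations of $f'$, $N_g\le CR_2$ evaluations of $g'$ and $N_B\le CR_3$ matrix–vector products with $\mathbf B$ or $\mathbf B^\top$.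
   Context: Problem. $\min_{x\in\mathcal X}\max_{y\in\mathcal Y}F(x,y)=f(x)+\langle y,\mathbf Bx\rangle-g(y)$, with $\mathcal X\subseteq\mathbb R^{d_x}$, $\mathcal Y\subseteq\mathbb R^{d_y}$ nonempty, closed, convex, $\mathcal Z=\mathcal X\times\mathcal Y$, $\mathbf B\in\mathbb R^{d_y\times d_x}$; $\mathcal S$ is its set of saddle points; $\|\cdot\|$ is Euclidean. $\partial f,\partial g$ are subdifferentials in the ambient spaces $\mathbb R^{d_x},\mathbb R^{d_y}$; $f'(x)\in\partial f(x)$ and $g'(y)\in\partial g(y)$ are arbitrary subgradients, and conditions on them hold for every choice. $\lambda_{\min},\lambda_{\max},\lambda_{\min}^+$ are the smallest, largest and smallest positive eigenvalue ($\lambda_{\min}^+(0)=0$). (A1) $f:\mathbb R^{d_x}\to\mathbb R$ is convex and finite; on $\mathcal X$ it is $\mu_x$-strongly convex, $\mu_x\ge0$ ($f(x')\ge f(x)+\langle f'(x),x'-x\rangle+\frac{\mu_x}2\|x'-x\|^2$ for $x,x'\in\mathcal X$), and $\|f'(x)-f'(x')\|\le H_x\|x-x'\|^{\nu_x}$ for $x,x'\in\mathcal X$, with $0\le\nu_x\le1$, $H_x>0$ (right side $H_x$ if $\nu_x=0$). (A2) $g:\mathbb R^{d_y}\to\mathbb R$ satisfies the same on $\mathcal Y$ with $\mu_y\ge0$, $0\le\nu_y\le1$, $H_y>0$. (A3) $L_{xy}>0$, $\mu_{xy},\mu_{yx}\ge0$, $L_{xy}>\max\{\mu_{xy},\mu_{yx}\}$,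 $L_{xy}^2\ge\lambda_{\max}(\mathbf B^\top\mathbf B)$. Let $\mathsf R_x$: $\partial f(x)\subseteq\operatorname{range}(\mathbf B^\top)$ for all $x\in\mathcal X$; $\mathsf R_y$: $\partial g(y)\subseteq\operatorname{range}(\mathbf B)$ for all $y\in\mathcal Y$. Either $\mu_{xy}^2\le\lambda_{\min}(\mathbf B^\top\mathbf B)$, or $\mathsf R_x$ is invoked, meaning that $\mathsf R_x$ holds, $\mathcal X+\ker\mathbf B=\mathcal X$ and $\mu_{xy}^2\le\lambda_{\min}^+(\mathbf B^\top\mathbf B)$. Either $\mu_{yx}^2\le\lambda_{\min}(\mathbf B\mathbf B^\top)$, or $\mathsf R_y$ is invoked, meaning that $\mathsf R_y$ holds, $\mathcal Y+\ker\mathbf B^\top=\mathcal Y$ and $\mu_{yx}^2\le\lambda_{\min}^+(\mathbf B\mathbf B^\top)$. If $\mu_{xy}>0$ and $\mu_{yx}>0$ then $\mu_{xy}=\mu_{yx}$. Ambient smoothness: if $\nu_x=1$, $f$ is differentiable on $\mathbb R^{d_x}$ with $H_x$-Lipschitz gradient there; if $\nu_y=1$, $g$ is differentiable on $\mathbb R^{d_y}$ with $H_y$-Lipschitz gradient there. Constants. For tolerances $\delta_f,\delta_g$ (positive if the corresponding exponent is $<1$): $L_x=\big[\frac{1-\nu_x}{2(1+\nu_x)\delta_f}\big]^{\frac{1-\nu_x}{1+\nu_x}}H_x^{\frac2{1+\nu_x}}$ if $\nu_x<1$, $L_x=H_x$ if $\nu_x=1$; $L_y$ likewise from $\delta_g,\nu_y,H_y$.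 $\beta_x=\mathbf 1_{\{\nu_y=1\}}/(4L_y)$, $\beta_y=\mathbf 1_{\{\nu_x=1\}}/(4L_x)$; $\delta_x=\mu_x+4\beta_x\mu_{xy}^2$, $\delta_y=\mu_y+4\beta_y\mu_{yx}^2$; $\kappa_x=L_x/\delta_x$, $\kappa_y=L_y/\delta_y$, $\kappa_{xy}=L_{xy}^2/(\delta_x\delta_y)$; $\tilde H_x=H_x\delta_x^{-(1+\nu_x)/2}$, $\tilde H_y=H_y\delta_y^{-(1+\nu_y)/2}$. $\mathbf P=\operatorname{diag}(\delta_x\mathbf I_{d_x},\delta_y\mathbf I_{d_y})$, $\|z\|_{\mathbf P}^2=\langle\mathbf Pz,z\rangle$. Decomposition, for $z_{\mathrm{in}}=(x_{\mathrm{in}},y_{\mathrm{in}})\in\mathcal Z$: $p_1(x,y)=f(x)$, $p_2(x,y)=g(y)$, $p_3(x,y)=\frac{\beta_x}2\|\mathbf Bx-g'(y_{\mathrm{in}})\|^2+\frac{\beta_y}2\|\mathbf B^\top y+f'(x_{\mathrm{in}})\|^2$; $Q_1=Q_2=0$, $Q_3(x,y)=(\mathbf B^\top y,-\mathbf Bx)$. $N_f,N_g$ count all evaluations of $f',g'$, including those in $p_3$. Reference point. $\mathcal S\neq\varnothing$ and $z^*=(x^*,y^* )\in\mathcal S$ is fixed with $x_{\mathrm{in}}-x^*\in\operatorname{range}(\mathbf B^\top)$ if $\mathsf R_x$ is invoked and $y_{\mathrm{in}}-y^*\in\operatorname{range}(\mathbf B)$ if $\mathsf R_y$ is invoked. Fixed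 are $f'(x^* )\in\partial f(x^* )$, $g'(y^* )\in\partial g(y^* )$ and normal vectors $\xi\in N_{\mathcal X}(x^* )$, $\zeta\in N_{\mathcal Y}(y^* )$ with $f'(x^* )+\mathbf B^\top y^*+\xi=0$, $g'(y^* )-\mathbf Bx^*+\zeta=0$. $\mathrm D_f(x,x^* )=f(x)-f(x^* )-\langle f'(x^* ),x-x^*\rangle$, $\mathrm D_g(y,y^* )=g(y)-g(y^* )-\langle g'(y^* ),y-y^*\rangle$. Sliding Algorithm (for $n$ pairs, written $(p_i,Q_i)$ for the pair at level $i$, with constants $L_i,M_i$). Oracle vectors $\tilde\nabla p_i$ are exact (sub)gradients; $T_1,\dots,T_n$ positive integers; $\alpha_0=1$, $\alpha_{t+1}=2/(1+\sqrt{1+4/\alpha_t^2})$; $\eta^k_{\mathbf t}=L_k\prod_{\ell=1}^k\alpha_{t_\ell}+M_k\prod_{\ell=1}^k\alpha_{t_\ell}/\alpha_{T_\ell-1}$ for $\mathbf t=(t_1,\dots,t_k)$, $0\le t_\ell\le T_\ell-1$. Set $z^k_{(0,\dots,0)}=z_{\mathrm{in}}$ for $k=1,\dots,n$; output $z_{\mathrm{out}}=\mathrm{Rec}(0,\varnothing)$, where $\mathrm{Rec}(k,\mathbf t)$, $\mathbf t=(t_1,\dots,t_k)$, is: (a) If $k=n$, return $\operatorname{argmin}_{z\in\mathcal Z}\sum_{i=1}^n\{\langle\tilde\nabla p_i(w^i_{(t_1,\dots,t_i)})+Q_i(z^i_{(t_1,\dots,t_i)}),z\rangle+\tfrac12\eta^i_{(t_1,\dots,t_i)}\|z-z^i_{(t_1,\dots,t_i)}\|_{\mathbf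 P}^2\}$. (b) If $k<n$, set $\bar z^{k+1}_{(\mathbf t,0)}=z^{k+1}_{(\mathbf t,0)}$. For $j=0,\dots,T_{k+1}-1$, with $\mathbf t'=(\mathbf t,j)$, $\mathbf t''=(\mathbf t,j+1)$: $\tilde z^{k+1}_{\mathbf t'}=\mathrm{Rec}(k+1,\mathbf t')$; $\bar z^{k+1}_{\mathbf t''}=\alpha_j\tilde z^{k+1}_{\mathbf t'}+(1-\alpha_j)\bar z^{k+1}_{\mathbf t'}$; $z^{k+1}_{\mathbf t''}=\operatorname{argmin}_{z\in\mathcal Z}\{\langle Q_{k+1}(\tilde z^{k+1}_{\mathbf t'})-Q_{k+1}(z^{k+1}_{\mathbf t'}),z\rangle+\tfrac12\eta^{k+1}_{\mathbf t'}\|z-\tilde z^{k+1}_{\mathbf t'}\|_{\mathbf P}^2\}$; for $\ell=k+2,\dots,n$, $z^\ell_{(\mathbf t'',0,\dots,0)}=z^\ell_{(\mathbf t',T_{k+2},0,\dots,0)}$ (zero-padded to length $\ell$). Return $\bar z^{k+1}_{(\mathbf t,T_{k+1})}$. Here $w^i_{(t_1,\dots,t_i)}=(a_1\circ\cdots\circ a_i)(z^i_{(t_1,\dots,t_i)})$, $a_\ell(z)=\alpha_{t_\ell}z+(1-\alpha_{t_\ell})\bar z^\ell_{(t_1,\dots,t_\ell)}$; $\tilde\nabla p_i(w^i_{\mathbf t})$ and $Q_i(z^i_{\mathbf t})$ are computed once per multi-index of length $i$. Projections onto $\mathcal Z$ are exact and not counted. *)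

theory Defs
  imports "HOL-Analysis.Analysis"
begin

section \<open>Euclidean spaces of variable dimension\<close>

text \<open>
  The constant of the theorem must not depend on the dimensions, so they have to be quantified
  inside the formula and cannot be index types. All spaces \<open>\<real>\<^sup>d\<close> are therefore realised as
  the coordinate subspaces \<open>Rn d\<close> of a single inner product space, the finitely supported real
  sequences with the inner product \<open>\<Sum>i. x\<^sub>i y\<^sub>i\<close>.
\<close>

typedef fvec = "{u :: nat \<Rightarrow> real. finite {i. u i \<noteq> 0}}"
  morphisms coord Fvec
  by (rule exI[of _ "\<lambda>_. 0"]) simp

lemma finite_coord: "finite {i. coord x i \<noteq> 0}"
  using coord[of x] by simp

lemma coord_Fvec: "finite {i. u i \<noteq> 0} \<Longrightarrow> coord (Fvec u) = u"
  by (simp add: Fvec_inverse)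

lemma fvec_eqI: "(\<And>i. coord x i = coord y i) \<Longrightarrow> x = y"
  by (metis coord_inject ext)

instantiation fvec :: real_vector
begin

definition "0 = Fvec (\<lambda>_. 0)"
definition "x + y = Fvec (\<lambda>i. coord x i + coord y i)"
definition "- x = Fvec (\<lambda>i. - coord x i)"
definition "x - y = Fvec (\<lambda>i. coord x i - coord y i)"
definition "r *\<^sub>R x = Fvec (\<lambda>i. r * coord x i)"

lemma coord_simps [simp]:
  "coord 0 i = 0"
  "coord (x + y) i = coord x i + coord y i"
  "coord (- x) i = - coord x i"
  "coord (x - y) i = coord x i - coord y i"
  "coord (r *\<^sub>R x) i = r * coord x i"
proof -
  have fin: "finite {i. coord x i \<noteq> 0 \<or> coord y i \<noteq> 0}"
    unfolding Collect_disj_eq by (intro finite_UnI finite_coord)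
  show "coord 0 i = 0" by (simp add: zero_fvec_def coord_Fvec)
  show "coord (x + y) i = coord x i + coord y i"
    unfolding plus_fvec_def by (subst coord_Fvec) (auto intro: finite_subset[OF _ fin])
  show "coord (- x) i = - coord x i"
    unfolding uminus_fvec_def by (subst coord_Fvec) (auto intro: finite_subset[OF _ fin])
  show "coord (x - y) i = coord x i - coord y i"
    unfolding minus_fvec_def by (subst coord_Fvec) (auto intro: finite_subset[OF _ fin])
  show "coord (r *\<^sub>R x) i = r * coord x i"
    unfolding scaleR_fvec_def by (subst coord_Fvec) (auto intro: finite_subset[OF _ fin])
qed

instance
  by standard (auto intro!: fvec_eqI simp: algebra_simps)

end

instantiation fvec :: real_inner
begin

definition inner_fvec :: "fvec \<Rightarrow> fvec \<Rightarrow> real"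
  where "inner_fvec x y = (\<Sum>i | coord x i \<noteq> 0. coord x i * coord y i)"
definition norm_fvec :: "fvec \<Rightarrow> real"
  where "norm_fvec x = sqrt (inner x x)"
definition dist_fvec :: "fvec \<Rightarrow> fvec \<Rightarrow> real"
  where "dist_fvec x y = norm (x - y)"
definition sgn_fvec :: "fvec \<Rightarrow> fvec"
  where "sgn_fvec x = x /\<^sub>R norm x"
definition uniformity_fvec :: "(fvec \<times> fvec) filter"
  where "uniformity_fvec = (INF e\<in>{0 <..}. principal {(x, y). dist x y < e})"
definition open_fvec :: "fvec set \<Rightarrow> bool"
  where "open_fvec U = (\<forall>x\<in>U. eventually (\<lambda>(x', y). x' = x \<longrightarrow> y \<in> U) uniformity)"

lemma inner_fvec_superset:
  assumes "finite S" "{i. coord x i \<noteq> 0} \<subseteq> S"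
  shows "inner x y = (\<Sum>i\<in>S. coord x i * coord y i)"
  unfolding inner_fvec_def using assms by (intro sum.mono_neutral_left) auto

instance
proof
  fix x y z :: fvec and r :: real and U :: "fvec set"
  let ?S = "{i. coord x i \<noteq> 0} \<union> {i. coord y i \<noteq> 0} \<union> {i. coord z i \<noteq> 0}"
  have fin: "finite ?S" by (simp add: finite_coord)
  have sum_x: "inner x w = (\<Sum>i\<in>?S. coord x i * coord w i)"
    and sum_y: "inner y w = (\<Sum>i\<in>?S. coord y i * coord w i)"
    and sum_add: "inner (x + y) w = (\<Sum>i\<in>?S. coord (x + y) i * coord w i)"
    and sum_scale: "inner (r *\<^sub>R x) w = (\<Sum>i\<in>?S. coord (r *\<^sub>R x) i * coord w i)" for w
    by (rule inner_fvec_superset[OF fin]; auto)+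
  show "dist x y = norm (x - y)" by (rule dist_fvec_def)
  show "sgn x = x /\<^sub>R norm x" by (rule sgn_fvec_def)
  show "(uniformity :: (fvec \<times> fvec) filter)
      = (INF e\<in>{0 <..}. principal {(x, y). dist x y < e})"
    by (rule uniformity_fvec_def)
  show "open U = (\<forall>x\<in>U. eventually (\<lambda>(x', y). x' = x \<longrightarrow> y \<in> U) uniformity)"
    by (rule open_fvec_def)
  show "inner x y = inner y x"
    unfolding sum_x sum_y by (simp add: mult.commute)
  show "inner (x + y) z = inner x z + inner y z"
    unfolding sum_x sum_y sum_add by (simp add: algebra_simps sum.distrib)
  show "inner (r *\<^sub>R x) y = r * inner x y"
    unfolding sum_x sum_scale by (simp add: algebra_simps sum_distrib_left)
  show "0 \<le> inner x x" unfolding inner_fvec_def by (intro sum_nonneg) auto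
  show "(inner x x = 0) = (x = 0)"
  proof
    assume "inner x x = 0"
    then have "\<forall>i\<in>{i. coord x i \<noteq> 0}. coord x i * coord x i = 0"
      unfolding inner_fvec_def by (subst (asm) sum_nonneg_eq_0_iff) (auto simp: finite_coord)
    then show "x = 0" by (intro fvec_eqI) auto
  qed (simp add: inner_fvec_def)
  show "norm x = sqrt (inner x x)" by (rule norm_fvec_def)
qed

end

definition Rn :: "nat \<Rightarrow> fvec set"
  where "Rn d = {x. \<forall>i\<ge>d. coord x i = 0}"

definition mk :: "nat \<Rightarrow> (nat \<Rightarrow> real) \<Rightarrow> fvec"
  where "mk d u = Fvec (\<lambda>i. if i < d then u i else 0)"

lemma coord_mk [simp]: "coord (mk d u) i = (if i < d then u i else 0)"
  unfolding mk_def by (subst coord_Fvec) (auto intro: finite_subset[of _ "{..<d}"])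

lemma mk_in_Rn [simp]: "mk d u \<in> Rn d"
  by (simp add: Rn_def)

lemma subspace_Rn: "subspace (Rn d)"
  by (auto simp: subspace_def Rn_def)

lemma inner_Rn: "x \<in> Rn d \<Longrightarrow> x \<bullet> y = (\<Sum>i<d. coord x i * coord y i)"
  by (rule inner_fvec_superset) (auto simp: Rn_def not_less[symmetric])

section \<open>Matrices\<close>

text \<open>
  An \<open>r \<times> c\<close> matrix is given by its entry function, of which only the entries \<open>A i j\<close> with
  \<open>i < r\<close> and \<open>j < c\<close> matter.
\<close>

type_synonym mat_fun = "nat \<Rightarrow> nat \<Rightarrow> real"

definition matvec :: "nat \<Rightarrow> nat \<Rightarrow> mat_fun \<Rightarrow> fvec \<Rightarrow> fvec"
  where "matvec r c A x = mk r (\<lambda>i. \<Sum>j<c. A i j * coord x j)"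

definition mtrans :: "mat_fun \<Rightarrow> mat_fun"
  where "mtrans A = (\<lambda>i j. A j i)"

definition mmul :: "nat \<Rightarrow> mat_fun \<Rightarrow> mat_fun \<Rightarrow> mat_fun"
  where "mmul k A A' = (\<lambda>i j. \<Sum>l<k. A i l * A' l j)"

definition mrange :: "nat \<Rightarrow> nat \<Rightarrow> mat_fun \<Rightarrow> fvec set"
  where "mrange r c A = matvec r c A ` Rn c"

definition mker :: "nat \<Rightarrow> nat \<Rightarrow> mat_fun \<Rightarrow> fvec set"
  where "mker r c A = {v \<in> Rn c. matvec r c A v = 0}"

definition eigvals :: "nat \<Rightarrow> mat_fun \<Rightarrow> real set"
  where "eigvals d A = {e. \<exists>v\<in>Rn d. v \<noteq> 0 \<and> matvec d d A v = e *\<^sub>R v}"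

definition lam_min :: "nat \<Rightarrow> mat_fun \<Rightarrow> real"
  where "lam_min d A = Min (eigvals d A)"

definition lam_max :: "nat \<Rightarrow> mat_fun \<Rightarrow> real"
  where "lam_max d A = Max (eigvals d A)"

definition lam_min_pos :: "nat \<Rightarrow> mat_fun \<Rightarrow> real"
  where "lam_min_pos d A =
    (if \<exists>e\<in>eigvals d A. 0 < e then Min {e \<in> eigvals d A. 0 < e} else 0)"

lemma matvec_adjoint:
  assumes "x \<in> Rn c" "y \<in> Rn r"
  shows "y \<bullet> matvec r c A x = matvec c r (mtrans A) y \<bullet> x"
proof -
  have "y \<bullet> matvec r c A x = (\<Sum>i<r. \<Sum>j<c. coord y i * (A i j * coord x j))"
    by (simp add: inner_Rn[OF assms(2)] matvec_def sum_distrib_left)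
  also have "\<dots> = (\<Sum>j<c. \<Sum>i<r. coord y i * (A i j * coord x j))"
    by (rule sum.swap)
  also have "\<dots> = matvec c r (mtrans A) y \<bullet> x"
    by (subst inner_Rn[of _ c]) (simp_all add: matvec_def mtrans_def sum_distrib_left sum_distrib_right ac_simps)
  finally show ?thesis .
qed

lemma matvec_in_Rn: "matvec r c A x \<in> Rn r"
  by (simp add: matvec_def)

lemma matvec_add: "matvec r c A (x + y) = matvec r c A x + matvec r c A y"
  by (intro fvec_eqI) (simp add: matvec_def algebra_simps sum.distrib)

lemma matvec_scaleR: "matvec r c A (a *\<^sub>R x) = a *\<^sub>R matvec r c A x"
  by (intro fvec_eqI) (simp add: matvec_def algebra_simps sum_distrib_left)

section \<open>Convex analysis\<close>

definition subdiff :: "nat \<Rightarrow> (fvec \<Rightarrow> real) \<Rightarrow> fvec \<Rightarrow> fvec set"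
  where "subdiff d f x = {s \<in> Rn d. \<forall>x'\<in>Rn d. f x' \<ge> f x + s \<bullet> (x' - x)}"

definition normal_cone :: "nat \<Rightarrow> fvec set \<Rightarrow> fvec \<Rightarrow> fvec set"
  where "normal_cone d X x = {\<xi> \<in> Rn d. \<forall>x'\<in>X. \<xi> \<bullet> (x' - x) \<le> 0}"

definition bregman :: "(fvec \<Rightarrow> real) \<Rightarrow> fvec \<Rightarrow> fvec \<Rightarrow> fvec \<Rightarrow> real"
  where "bregman f s x x0 = f x - f x0 - s \<bullet> (x - x0)"

text \<open>
  Both conditions are required of every choice of ambient subgradients at points of \<open>X\<close>. The
  Hoelder condition is split because \<open>0 powr 0 = 0\<close>, whereas for
  exponent \<open>0\<close> the bound is \<open>H\<close> also at \<open>x = x'\<close>.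
\<close>

definition holder_class ::
    "nat \<Rightarrow> fvec set \<Rightarrow> (fvec \<Rightarrow> real) \<Rightarrow> real \<Rightarrow> real \<Rightarrow> real \<Rightarrow> bool"
  where "holder_class d X f \<mu> \<nu> H \<longleftrightarrow>
    convex_on (Rn d) f \<and> 0 \<le> \<mu> \<and> 0 \<le> \<nu> \<and> \<nu> \<le> 1 \<and> 0 < H \<and>
    (\<forall>x\<in>X. \<forall>x'\<in>X. \<forall>s\<in>subdiff d f x.
        f x' \<ge> f x + s \<bullet> (x' - x) + \<mu> / 2 * (norm (x' - x))\<^sup>2) \<and>
    (\<forall>x\<in>X. \<forall>x'\<in>X. \<forall>s\<in>subdiff d f x. \<forall>s'\<in>subdiff d f x'.
        norm (s - s') \<le> (if \<nu> = 0 then H else H * norm (x - x') powr \<nu>))"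

definition ambient_smooth :: "nat \<Rightarrow> (fvec \<Rightarrow> real) \<Rightarrow> real \<Rightarrow> bool"
  where "ambient_smooth d f H \<longleftrightarrow>
    (\<exists>G. (\<forall>x\<in>Rn d. G x \<in> Rn d \<and> (f has_derivative (\<lambda>h. G x \<bullet> h)) (at x within Rn d)) \<and>
         lipschitz_on H (Rn d) G)"

text \<open>
  The lower spectral bound on a \<open>d' \<times> d\<close> matrix \<open>A\<close> (namely \<open>B\<close> on the primal side and its
  transpose on the dual side). The Boolean \<open>invoked\<close> records whether the range condition is invoked.
\<close>

definition coupling_bound ::
    "bool \<Rightarrow> nat \<Rightarrow> nat \<Rightarrow> fvec set \<Rightarrow> (fvec \<Rightarrow> real) \<Rightarrow> mat_fun \<Rightarrow> real \<Rightarrow> bool"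
  where "coupling_bound invoked d d' X f A \<mu> \<longleftrightarrow>
    (if invoked then
       (\<forall>x\<in>X. subdiff d f x \<subseteq> mrange d d' (mtrans A)) \<and>
       {x + v |x v. x \<in> X \<and> v \<in> mker d' d A} = X \<and>
       \<mu>\<^sup>2 \<le> lam_min_pos d (mmul d' (mtrans A) A)
     else \<mu>\<^sup>2 \<le> lam_min d (mmul d' (mtrans A) A))"

definition saddle_points ::
    "nat \<Rightarrow> nat \<Rightarrow> fvec set \<Rightarrow> fvec set \<Rightarrow> (fvec \<Rightarrow> real) \<Rightarrow> (fvec \<Rightarrow> real) \<Rightarrow> mat_fun \<Rightarrow> (fvec \<times> fvec) set"
  where "saddle_points dx dy X Y f g B =
    (let F = (\<lambda>x y. f x + y \<bullet> matvec dy dx B x - g y) in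
     {(xs, ys). xs \<in> X \<and> ys \<in> Y \<and> (\<forall>x\<in>X. \<forall>y\<in>Y. F xs y \<le> F xs ys \<and> F xs ys \<le> F x ys)})"

section \<open>Constants\<close>

definition inexact_L :: "real \<Rightarrow> real \<Rightarrow> real \<Rightarrow> real"
  where "inexact_L \<nu> H \<delta> =
    (if \<nu> < 1
     then ((1 - \<nu>) / (2 * (1 + \<nu>) * \<delta>)) powr ((1 - \<nu>) / (1 + \<nu>)) * H powr (2 / (1 + \<nu>))
     else H)"

text \<open>
  The coefficient of the primal quadratic is \<open>reg_coeff \<nu>\<^sub>y H\<^sub>y\<close>, that of the dual one is
  \<open>reg_coeff \<nu>\<^sub>x H\<^sub>x\<close>. It is \<open>1/(4 L)\<close>, where \<open>L = H\<close> since the exponent is \<open>1\<close>.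
\<close>

definition reg_coeff :: "real \<Rightarrow> real \<Rightarrow> real"
  where "reg_coeff \<nu> H = (if \<nu> = 1 then 1 / (4 * H) else 0)"

definition rate_holder :: "real \<Rightarrow> real \<Rightarrow> real \<Rightarrow> real \<Rightarrow> real"
  where "rate_holder \<nu> H \<delta> \<Omega> =
    (let Ht = H * \<delta> powr (- (1 + \<nu>) / 2)
     in max (Ht powr (2 / (1 + 3 * \<nu>)) * \<Omega> powr ((\<nu> - 1) / (1 + 3 * \<nu>))) 1)"

definition pnorm2 :: "real \<Rightarrow> real \<Rightarrow> fvec \<times> fvec \<Rightarrow> real"
  where "pnorm2 \<delta>x \<delta>y z = (\<delta>x *\<^sub>R fst z, \<delta>y *\<^sub>R snd z) \<bullet> z"

section \<open>The Sliding Algorithm\<close>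

text \<open>
  The algorithm is a state transformer that also accumulates the oracle cost: the triple of the
  numbers of evaluations of \<open>f'\<close>, evaluations of \<open>g'\<close>, and products with \<open>B\<close> or its transpose.
\<close>

type_synonym cost = "nat \<times> nat \<times> nat"

record 'z sliding =
  sl_n :: nat
  sl_T :: "nat \<Rightarrow> nat"
  sl_L :: "nat \<Rightarrow> real"
  sl_M :: "nat \<Rightarrow> real"
  sl_pnorm2 :: "'z \<Rightarrow> real"
  sl_dom :: "'z set"
  sl_grad :: "nat \<Rightarrow> 'z \<Rightarrow> 'z \<times> cost"
  sl_Q :: "nat \<Rightarrow> 'z \<Rightarrow> 'z \<times> cost"

text \<open>
  A multi-index is a list, its level is the length of the list; component \<open>t\<^sub>l\<close> is
  \<open>t ! (l - 1)\<close>. The fields \<open>st_grad\<close> and \<open>st_Q\<close> hold the vectors that are computed once per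
  multi-index.
\<close>

record 'z sl_state =
  st_z :: "nat list \<Rightarrow> 'z"
  st_zbar :: "nat list \<Rightarrow> 'z"
  st_grad :: "nat list \<Rightarrow> 'z"
  st_Q :: "nat list \<Rightarrow> 'z"
  st_cost :: cost

primrec alpha :: "nat \<Rightarrow> real" where
  "alpha 0 = 1"
| "alpha (Suc t) = 2 / (1 + sqrt (1 + 4 / (alpha t)\<^sup>2))"

definition sl_eta :: "'z sliding \<Rightarrow> nat list \<Rightarrow> real"
  where "sl_eta A t =
    sl_L A (length t) * (\<Prod>l=1..length t. alpha (t ! (l - 1))) +
    sl_M A (length t) * (\<Prod>l=1..length t. alpha (t ! (l - 1)) / alpha (sl_T A l - 1))"

definition sl_w :: "'z::real_vector sl_state \<Rightarrow> nat list \<Rightarrow> 'z"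
  where "sl_w s t =
    foldr (\<lambda>l z. alpha (t ! (l - 1)) *\<^sub>R z + (1 - alpha (t ! (l - 1))) *\<^sub>R st_zbar s (take l t))
      [1..<Suc (length t)] (st_z s t)"

definition sl_evaluate :: "'z::real_vector sliding \<Rightarrow> nat list \<Rightarrow> 'z sl_state \<Rightarrow> 'z sl_state"
  where "sl_evaluate A t s =
    (let (v, c) = sl_grad A (length t) (sl_w s t);
         (q, c') = sl_Q A (length t) (st_z s t)
     in s\<lparr>st_grad := (st_grad s)(t := v), st_Q := (st_Q s)(t := q), st_cost := st_cost s + c + c'\<rparr>)"

text \<open>
  Pass \<open>j\<close> of the loop of \<open>Rec(k, t)\<close>, with \<open>k = length t\<close> and \<open>rec\<close> standing for
  \<open>Rec(k + 1, _)\<close>.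
\<close>

definition sl_pass ::
    "'z::real_inner sliding \<Rightarrow> (nat list \<Rightarrow> 'z sl_state \<Rightarrow> 'z \<times> 'z sl_state) \<Rightarrow>
     nat list \<Rightarrow> nat \<Rightarrow> 'z sl_state \<Rightarrow> 'z sl_state"
  where "sl_pass A rec t j s =
    (let k = length t; t' = t @ [j]; t'' = t @ [j + 1];
         (zt, s1) = rec t' (sl_evaluate A t' s);
         (q, c) = sl_Q A (k + 1) zt;
         zb = alpha j *\<^sub>R zt + (1 - alpha j) *\<^sub>R st_zbar s1 t';
         z1 = arg_min (\<lambda>z. (q - st_Q s1 t') \<bullet> z + 1 / 2 * sl_eta A t' * sl_pnorm2 A (z - zt))
                (\<lambda>z. z \<in> sl_dom A);
         zs = fold (\<lambda>l zs. zs(t'' @ replicate (l - (k + 1)) 0 :=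
                              zs (t' @ [sl_T A (k + 2)] @ replicate (l - (k + 2)) 0)))
                [k + 2..<sl_n A + 1] ((st_z s1)(t'' := z1))
     in s1\<lparr>st_z := zs, st_zbar := (st_zbar s1)(t'' := zb), st_cost := st_cost s1 + c\<rparr>)"

text \<open>\<open>sl_rec A m t\<close> is \<open>Rec(k, t)\<close> for \<open>k = length t\<close> and \<open>m = n - k\<close> remaining levels.\<close>

primrec sl_rec ::
    "'z::real_inner sliding \<Rightarrow> nat \<Rightarrow> nat list \<Rightarrow> 'z sl_state \<Rightarrow> 'z \<times> 'z sl_state" where
  "sl_rec A 0 t s =
    (arg_min
       (\<lambda>z. \<Sum>i=1..sl_n A. (st_grad s (take i t) + st_Q s (take i t)) \<bullet> z +
              1 / 2 * sl_eta A (take i t) * sl_pnorm2 A (z - st_z s (take i t)))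
       (\<lambda>z. z \<in> sl_dom A), s)"
| "sl_rec A (Suc m) t s =
    (let s0 = s\<lparr>st_zbar := (st_zbar s)(t @ [0] := st_z s (t @ [0]))\<rparr>;
         T = sl_T A (length t + 1);
         s1 = fold (sl_pass A (sl_rec A m) t) [0..<T] s0
     in (st_zbar s1 (t @ [T]), s1))"

text \<open>
  The second argument is the cost of evaluations made before the start. Of the initial values only
  those of \<open>st_z\<close> at zero multi-indices are ever read.
\<close>

definition run_sliding :: "'z::real_inner sliding \<Rightarrow> cost \<Rightarrow> 'z \<Rightarrow> 'z \<times> cost"
  where "run_sliding A c0 zin =
    (let (zout, s) = sl_rec A (sl_n A) []
           \<lparr>st_z = (\<lambda>_. zin), st_zbar = (\<lambda>_. undefined), st_grad = (\<lambda>_. undefined),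
            st_Q = (\<lambda>_. undefined), st_cost = c0\<rparr>
     in (zout, st_cost s))"

section \<open>The decomposition of the bilinear problem\<close>

definition eval_f :: "(fvec \<Rightarrow> fvec) \<Rightarrow> fvec \<Rightarrow> fvec \<times> cost"
  where "eval_f f' x = (f' x, (1, 0, 0))"

definition eval_g :: "(fvec \<Rightarrow> fvec) \<Rightarrow> fvec \<Rightarrow> fvec \<times> cost"
  where "eval_g g' y = (g' y, (0, 1, 0))"

definition eval_mv :: "nat \<Rightarrow> nat \<Rightarrow> mat_fun \<Rightarrow> fvec \<Rightarrow> fvec \<times> cost"
  where "eval_mv r c A x = (matvec r c A x, (0, 0, 1))"

definition grad_p1 :: "(fvec \<Rightarrow> fvec) \<Rightarrow> fvec \<times> fvec \<Rightarrow> (fvec \<times> fvec) \<times> cost"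
  where "grad_p1 f' z = (let (s, c) = eval_f f' (fst z) in ((s, 0), c))"

definition grad_p2 :: "(fvec \<Rightarrow> fvec) \<Rightarrow> fvec \<times> fvec \<Rightarrow> (fvec \<times> fvec) \<times> cost"
  where "grad_p2 g' z = (let (s, c) = eval_g g' (snd z) in ((0, s), c))"

text \<open>In \<open>p3\<close> and its gradient, \<open>s\<close> and \<open>r\<close> are the subgradients \<open>f'(x\<^sub>i\<^sub>n)\<close> and \<open>g'(y\<^sub>i\<^sub>n)\<close>.\<close>

definition p3 ::
    "nat \<Rightarrow> nat \<Rightarrow> mat_fun \<Rightarrow> real \<Rightarrow> real \<Rightarrow> fvec \<Rightarrow> fvec \<Rightarrow> fvec \<times> fvec \<Rightarrow> real"
  where "p3 dx dy B \<beta>x \<beta>y s r z =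
    \<beta>x / 2 * (norm (matvec dy dx B (fst z) - r))\<^sup>2 +
    \<beta>y / 2 * (norm (matvec dx dy (mtrans B) (snd z) + s))\<^sup>2"

definition grad_p3 ::
    "nat \<Rightarrow> nat \<Rightarrow> mat_fun \<Rightarrow> real \<Rightarrow> real \<Rightarrow> fvec \<Rightarrow> fvec \<Rightarrow> fvec \<times> fvec \<Rightarrow> (fvec \<times> fvec) \<times> cost"
  where "grad_p3 dx dy B \<beta>x \<beta>y s r z =
    (let (u, c1) = eval_mv dy dx B (fst z);
         (u', c2) = eval_mv dx dy (mtrans B) (u - r);
         (v, c3) = eval_mv dx dy (mtrans B) (snd z);
         (v', c4) = eval_mv dy dx B (v + s)
     in ((\<beta>x *\<^sub>R u', \<beta>y *\<^sub>R v'), c1 + c2 + c3 + c4))"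

definition bilin_Q3 ::
    "nat \<Rightarrow> nat \<Rightarrow> mat_fun \<Rightarrow> fvec \<times> fvec \<Rightarrow> (fvec \<times> fvec) \<times> cost"
  where "bilin_Q3 dx dy B z =
    (let (u, c1) = eval_mv dx dy (mtrans B) (snd z);
         (v, c2) = eval_mv dy dx B (fst z)
     in ((u, - v), c1 + c2))"

definition oracle_grad ::
    "nat \<Rightarrow> nat \<Rightarrow> mat_fun \<Rightarrow> (fvec \<Rightarrow> fvec) \<Rightarrow> (fvec \<Rightarrow> fvec) \<Rightarrow> real \<Rightarrow> real \<Rightarrow> fvec \<Rightarrow> fvec \<Rightarrow>
     nat \<Rightarrow> fvec \<times> fvec \<Rightarrow> (fvec \<times> fvec) \<times> cost"
  where "oracle_grad dx dy B f' g' \<beta>x \<beta>y s r i =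
    (if i = 1 then grad_p1 f' else if i = 2 then grad_p2 g' else grad_p3 dx dy B \<beta>x \<beta>y s r)"

definition oracle_Q ::
    "nat \<Rightarrow> nat \<Rightarrow> mat_fun \<Rightarrow> nat \<Rightarrow> fvec \<times> fvec \<Rightarrow> (fvec \<times> fvec) \<times> cost"
  where "oracle_Q dx dy B i = (if i = 3 then bilin_Q3 dx dy B else (\<lambda>_. (0, (0, 0, 0))))"

text \<open>
  The algorithm run on the bilinear problem: the pair \<open>(p\<^sub>\<pi>\<^sub>(\<^sub>i\<^sub>), Q\<^sub>\<pi>\<^sub>(\<^sub>i\<^sub>))\<close> sits at level \<open>i\<close>, and the
  two subgradients at the starting point that enter \<open>p3\<close> are evaluated once, beforehand.
\<close>

definition bilinear_sliding ::
    "nat \<Rightarrow> nat \<Rightarrow> mat_fun \<Rightarrow> fvec set \<Rightarrow> fvec set \<Rightarrow> (fvec \<Rightarrow> fvec) \<Rightarrow> (fvec \<Rightarrow> fvec) \<Rightarrow>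
     real \<Rightarrow> real \<Rightarrow> real \<Rightarrow> real \<Rightarrow> (nat \<Rightarrow> real) \<Rightarrow> (nat \<Rightarrow> real) \<Rightarrow> (nat \<Rightarrow> nat) \<Rightarrow> (nat \<Rightarrow> nat) \<Rightarrow>
     fvec \<times> fvec \<Rightarrow> (fvec \<times> fvec) \<times> cost"
  where "bilinear_sliding dx dy B X Y f' g' \<beta>x \<beta>y \<delta>x \<delta>y L M \<pi> T zin =
    (let (s, c) = eval_f f' (fst zin);
         (r, c') = eval_g g' (snd zin)
     in run_sliding
          \<lparr>sl_n = 3, sl_T = T, sl_L = L \<circ> \<pi>, sl_M = M \<circ> \<pi>, sl_pnorm2 = pnorm2 \<delta>x \<delta>y,
           sl_dom = X \<times> Y, sl_grad = oracle_grad dx dy B f' g' \<beta>x \<beta>y s r \<circ> \<pi>,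
           sl_Q = oracle_Q dx dy B \<circ> \<pi>\<rparr>
          (c + c') zin)"

text \<open>
  The vector computed by \<open>grad_p3\<close> is the gradient of \<open>p3\<close>: the remainder of the affine
  approximation is exactly the quadratic part.
\<close>

lemma grad_p3_expansion:
  assumes "z \<in> Rn dx \<times> Rn dy" "h \<in> Rn dx \<times> Rn dy" "s \<in> Rn dx" "r \<in> Rn dy"
  shows "p3 dx dy B \<beta>x \<beta>y s r (z + h) =
    p3 dx dy B \<beta>x \<beta>y s r z + fst (grad_p3 dx dy B \<beta>x \<beta>y s r z) \<bullet> h +
    \<beta>x / 2 * (norm (matvec dy dx B (fst h)))\<^sup>2 +
    \<beta>y / 2 * (norm (matvec dx dy (mtrans B) (snd h)))\<^sup>2"
proof -
  let ?u = "matvec dy dx B (fst z) - r" and ?v = "matvec dx dy (mtrans B) (snd z) + s"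
  have "?u \<in> Rn dy" "?v \<in> Rn dx"
    using assms subspace_diff[OF subspace_Rn] subspace_add[OF subspace_Rn] matvec_in_Rn by blast+
  then have *: "?u \<bullet> matvec dy dx B (fst h) = matvec dx dy (mtrans B) ?u \<bullet> fst h"
    and "?v \<bullet> matvec dx dy (mtrans B) (snd h) = matvec dy dx (mtrans (mtrans B)) ?v \<bullet> snd h"
    using assms by (auto intro!: matvec_adjoint)
  then have **: "?v \<bullet> matvec dx dy (mtrans B) (snd h) = matvec dy dx B ?v \<bullet> snd h"
    by (simp add: mtrans_def)
  have sq: "(norm (a + b))\<^sup>2 = (norm a)\<^sup>2 + 2 * (a \<bullet> b) + (norm b)\<^sup>2" for a b :: fvec
    by (simp add: power2_norm_eq_inner inner_simps inner_commute)
  have "p3 dx dy B \<beta>x \<beta>y s r (z + h) =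
      \<beta>x / 2 * (norm (?u + matvec dy dx B (fst h)))\<^sup>2 +
      \<beta>y / 2 * (norm (?v + matvec dx dy (mtrans B) (snd h)))\<^sup>2"
    by (simp add: p3_def matvec_add algebra_simps)
  also have "\<dots> = p3 dx dy B \<beta>x \<beta>y s r z +
      (\<beta>x * (?u \<bullet> matvec dy dx B (fst h)) + \<beta>y * (?v \<bullet> matvec dx dy (mtrans B) (snd h))) +
      \<beta>x / 2 * (norm (matvec dy dx B (fst h)))\<^sup>2 +
      \<beta>y / 2 * (norm (matvec dx dy (mtrans B) (snd h)))\<^sup>2"
    unfolding sq p3_def by (simp add: distrib_left)
  finally show ?thesis
    unfolding * ** by (simp add: grad_p3_def eval_mv_def inner_prod_def)
qed

end

theory Submission
  imports Defs "HOL-Library.Sublist"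
begin

text \<open>
  The Sliding Algorithm nests accelerated gradient loops. Composing \<open>p\<^sub>i\<close> with the affine maps
  \<open>a\<^sub>1 \<circ> \<dots> \<circ> a\<^sub>k\<close> of the outer loops and dividing by \<open>\<alpha>\<^sub>t\<^sub>1 \<dots> \<alpha>\<^sub>t\<^sub>k\<close> turns the call \<open>Rec(k, t)\<close> into a
  solver for a subproblem in which the levels up to \<open>k\<close> are replaced by linear-plus-prox terms, while
  the deeper levels enter as rescaled convex functions. The inequality that every call satisfies
  (\<open>achieved_rec\<close>) bounds the gap of its subproblem against an arbitrary point \<open>u\<close> by a
  nonnegative multiple, for each deeper level, of the squared distance from \<open>u\<close> to the prox centre at the start of the
  call minus the same quantity at its end, plus the accumulated oracle tolerances. It is proved by
  induction on the number of deeper levels. A pass of a loop is an accelerated gradient step for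
  \<open>p\<^sub>k\<^sub>+\<^sub>1\<close> merged with an extragradient step for the skew operator \<open>Q\<^sub>k\<^sub>+\<^sub>1\<close>
  (\<open>accelerated_extragradient_step\<close>); weighting pass \<open>j\<close> by \<open>1/\<alpha>\<^sub>j\<close> makes all terms telescope, because
  the prox weights are proportional to \<open>\<alpha>\<^sub>j\<close> and the last centres of one pass are the first centres of
  the next one. At the top level, level \<open>i\<close> contributes a coefficient of order
  \<open>L\<^sub>i / P\<^sub>i\<^sup>2 + M\<^sub>i / P\<^sub>i\<close>, where \<open>P\<^sub>i\<close> is the product of the first \<open>i\<close> loop lengths, and \<open>P\<^sub>i\<close> is also
  the number of evaluations at level \<open>i\<close>.
\<close>

text \<open>
  For the bilinear problem the gap is taken at the saddle point \<open>z*\<close>. The optimality conditions turn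
  the first two functions together with the linear term of \<open>Q\<^sub>3\<close> into the two Bregman divergences. The
  quadratic \<open>p\<^sub>3\<close> contributes multiples of \<open>\<parallel>B (x - x*)\<parallel>\<^sup>2\<close> and \<open>\<parallel>B\<^sup>T (y - y*)\<parallel>\<^sup>2\<close>, which the
  lower spectral bounds convert into strong convexity; cocoercivity of the gradients limits its price to half of the
  initial divergences (\<open>regularizer_lower_bound\<close>). Altogether \<open>16\<close> times the gap is at least
  \<open>\<Psi>(z\<^sub>o\<^sub>u\<^sub>t) - 8 (D\<^sub>f + D\<^sub>g)(z\<^sub>i\<^sub>n)\<close> (\<open>potential_lower_bound\<close>). Once the three coefficients are at most
  \<open>1/72\<close> and the tolerances sum up to at most \<open>\<Omega>/192\<close>, the right-hand side adds up to
  \<open>2/3 \<Omega> + 1/12 \<Omega> = 3/4 \<Omega>\<close>. When a range condition is invoked, the spectral bound only holds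
  orthogonally to a kernel; the feasible set is invariant under kernel translations and all oracle
  vectors are orthogonal to the kernel, so first-order optimality keeps every iterate in the
  orthogonal slice through the starting point.
\<close>

text \<open>
  The coefficients are that small as soon as \<open>P\<^sub>i\<close> exceeds a fixed multiple of the rate of level \<open>i\<close>;
  for a Hoelder level this is the computation in \<open>holder_rate_suffices\<close>, in which the tolerance, and
  hence the smoothness constant, itself depends on \<open>P\<^sub>i\<close>. Because the rates increase with the level, loop lengths can
  be chosen greedily so that every \<open>P\<^sub>i\<close> also stays below a fixed multiple of the rate
  (\<open>nested_loop_lengths\<close>).
\<close>

section \<open>The step sizes\<close>

lemma alpha_pos: "0 < alpha t"
  by (induction t) (auto intro!: divide_pos_pos add_pos_nonneg)

lemma inverse_alpha_Suc: "1 / alpha (Suc t) = (1 + sqrt (1 + 4 / (alpha t)\<^sup>2)) / 2"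
  by simp

text \<open>
  The number \<open>1 / \<alpha>\<^sub>t\<^sub>+\<^sub>1\<close> is the positive root of \<open>b\<^sup>2 - b = 1 / \<alpha>\<^sub>t\<^sup>2\<close>. The recursion of the step sizes is
  chosen for this identity, on which all telescoping below rests.
\<close>

lemma alpha_step: "1 / (alpha (Suc t))\<^sup>2 - 1 / alpha (Suc t) = 1 / (alpha t)\<^sup>2"
proof -
  define r where "r = sqrt (1 + 4 / (alpha t)\<^sup>2)"
  have r2: "r\<^sup>2 = 1 + 4 / (alpha t)\<^sup>2" by (simp add: r_def)
  have "1 / (alpha (Suc t))\<^sup>2 = (1 / alpha (Suc t))\<^sup>2" by (simp add: power_divide)
  also have "\<dots> = ((1 + r) / 2)\<^sup>2" by (simp only: inverse_alpha_Suc r_def)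
  also have "\<dots> = (1 + r) / 2 + (r\<^sup>2 - 1) / 4" by (simp add: power2_eq_square field_simps)
  also have "\<dots> = 1 / alpha (Suc t) + 1 / (alpha t)\<^sup>2"
    by (simp only: inverse_alpha_Suc r_def[symmetric] r2) simp
  finally show ?thesis by simp
qed

lemma inverse_alpha_growth: "1 / alpha t + 1 / 2 \<le> 1 / alpha (Suc t)"
proof -
  have "2 / alpha t = sqrt (4 / (alpha t)\<^sup>2)"
    using alpha_pos[of t] by (simp add: real_sqrt_divide)
  also have "\<dots> \<le> sqrt (1 + 4 / (alpha t)\<^sup>2)" by simp
  finally show ?thesis unfolding inverse_alpha_Suc by (simp add: field_simps)
qed

lemma inverse_alpha_ge: "1 + real t / 2 \<le> 1 / alpha t"
proof (induction t)
  case (Suc t)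
  then show ?case using inverse_alpha_growth[of t] by (simp add: field_simps del: alpha.simps)
qed simp

lemma alpha_le: "alpha t \<le> 2 / (real t + 2)"
  using inverse_alpha_ge[of t] alpha_pos[of t] by (simp add: field_simps)

lemma alpha_le_1: "alpha t \<le> 1"
proof -
  have "2 / (real t + 2) \<le> 1" by simp
  with alpha_le[of t] show ?thesis by linarith
qed

lemma alpha_last_le: "0 < T \<Longrightarrow> alpha (T - 1) \<le> 2 / real T"
  using alpha_le[of "T - 1"] frac_le[of 2 2 "real T" "real T + 1"]
  by (simp add: of_nat_diff add.commute)

lemma alpha_antimono: "s \<le> t \<Longrightarrow> alpha t \<le> alpha s"
proof (induction rule: dec_induct)
  case (step t)
  have "1 / alpha t \<le> 1 / alpha (Suc t)" using inverse_alpha_growth[of t] by linarith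
  then have "alpha (Suc t) \<le> alpha t"
    using alpha_pos[of t] alpha_pos[of "Suc t"] by (simp add: field_simps del: alpha.simps)
  then show ?case using step by linarith
qed simp

text \<open>
  Dividing the hypothesis by \<open>\<alpha>\<^sub>j\<^sup>2\<close> makes it telescope, since \<open>(1 - \<alpha>\<^sub>j) / \<alpha>\<^sub>j\<^sup>2 = 1 / \<alpha>\<^sub>j\<^sub>-\<^sub>1\<^sup>2\<close>. The value
  \<open>\<Phi> 0\<close> drops out because \<open>\<alpha>\<^sub>0 = 1\<close>.
\<close>

lemma accelerated_telescope:
  fixes \<Phi> d :: "nat \<Rightarrow> real"
  assumes "0 < T" "\<And>j. j < T \<Longrightarrow> \<Phi> (Suc j) \<le> (1 - alpha j) * \<Phi> j + alpha j * d j"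
  shows "\<Phi> T \<le> (alpha (T - 1))\<^sup>2 * (\<Sum>j<T. d j / alpha j)"
  using assms
proof (induction T)
  case (Suc T)
  show ?case
  proof (cases "T = 0")
    case True
    with Suc.prems(2)[of 0] show ?thesis by simp
  next
    case False
    then obtain t where t: "T = Suc t" by (cases T) auto
    let ?a = "alpha T" and ?b = "alpha t"
    have pos: "0 < ?a" "0 < ?b" by (rule alpha_pos)+
    have "1 / ?a\<^sup>2 - 1 / ?a = 1 / ?b\<^sup>2" unfolding t by (rule alpha_step)
    then have w: "1 - ?a = ?a\<^sup>2 / ?b\<^sup>2" using pos by (simp add: field_simps power2_eq_square)
    have IH: "\<Phi> T \<le> ?b\<^sup>2 * (\<Sum>j<T. d j / alpha j)"
      using Suc.IH Suc.prems(2) False t by simp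
    have "\<Phi> (Suc T) \<le> (1 - ?a) * \<Phi> T + ?a * d T" using Suc.prems(2) by simp
    also have "\<dots> \<le> (1 - ?a) * (?b\<^sup>2 * (\<Sum>j<T. d j / alpha j)) + ?a * d T"
      using IH alpha_le_1[of T] by (intro add_right_mono mult_left_mono) auto
    also have "\<dots> = ?a\<^sup>2 * (\<Sum>j<Suc T. d j / alpha j)"
      unfolding w using pos by (simp add: field_simps power2_eq_square)
    finally show ?thesis by simp
  qed
qed simp

text \<open>
  A loop of length \<open>T\<close> therefore multiplies the oracle tolerance by at most \<open>T\<close>.
\<close>

lemma alpha_weighted_errors:
  "0 < T \<Longrightarrow> (alpha (T - 1))\<^sup>2 * (\<Sum>j<T. 1 / (alpha j)\<^sup>2) \<le> real T"
proof -
  assume "0 < T"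
  have "(alpha (T - 1))\<^sup>2 * (1 / (alpha j)\<^sup>2) \<le> 1" if "j < T" for j
  proof -
    have "alpha (T - 1) \<le> alpha j" using that by (intro alpha_antimono) auto
    then have "(alpha (T - 1))\<^sup>2 \<le> (alpha j)\<^sup>2"
      using alpha_pos[of "T - 1"] by (intro power_mono) auto
    then show ?thesis using alpha_pos[of j] by (simp add: divide_le_eq)
  qed
  then have "(\<Sum>j<T. (alpha (T - 1))\<^sup>2 * (1 / (alpha j)\<^sup>2)) \<le> (\<Sum>j<T. 1)"
    by (intro sum_mono) auto
  then show ?thesis by (simp add: sum_distrib_left)
qed

section \<open>Prox steps in a quadratic geometry\<close>

text \<open>
  A weighted squared norm \<open>N\<close>, given by a self-adjoint operator \<open>D\<close>, for which prox steps over the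
  feasible set exist. Existence is an assumption because the ambient space need not be complete.
\<close>

locale prox_geometry =
  fixes D :: "'z::real_inner \<Rightarrow> 'z" and N :: "'z \<Rightarrow> real" and Z :: "'z set"
  assumes linear_D: "linear D"
    and selfadjoint_D: "D x \<bullet> y = x \<bullet> D y"
    and N_eq: "N x = D x \<bullet> x"
    and N_nonneg: "0 \<le> N x"
    and convex_Z: "convex Z"
    and minimizer: "0 < h \<Longrightarrow> \<exists>z\<in>Z. \<forall>z'\<in>Z. c \<bullet> z + h / 2 * N z \<le> c \<bullet> z' + h / 2 * N z'"
begin

lemma N_minus_commute: "N (x - y) = N (y - x)"
  by (simp add: N_eq linear_diff[OF linear_D] inner_simps)

lemma N_scaleR: "N (r *\<^sub>R x) = r\<^sup>2 * N x"
  by (simp add: N_eq linear_scale[OF linear_D] power2_eq_square)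

lemma D_inner_commute: "D x \<bullet> y = D y \<bullet> x"
  by (metis selfadjoint_D inner_commute)

lemma N_three_points: "N (u - v) = N (u - z) + N (z - v) + 2 * (D (z - v) \<bullet> (u - z))"
  by (simp add: N_eq linear_diff[OF linear_D] inner_simps D_inner_commute[of v u]
      D_inner_commute[of z u] D_inner_commute[of z v])

text \<open>
  The defect is \<open>a (1 - a) N (x - y)\<close>; it appears when both terms are expanded around the
  combination.
\<close>

lemma N_convex_comb:
  assumes "0 \<le> a" "a \<le> 1"
  shows "N (a *\<^sub>R x + (1 - a) *\<^sub>R y - v) \<le> a * N (x - v) + (1 - a) * N (y - v)"
proof -
  let ?z = "a *\<^sub>R x + (1 - a) *\<^sub>R y"
  have x: "x - ?z = (1 - a) *\<^sub>R (x - y)" and y: "y - ?z = a *\<^sub>R (y - x)"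
    by (simp_all add: algebra_simps)
  have "a * N (x - v) + (1 - a) * N (y - v) = N (?z - v) + a * N (x - ?z) + (1 - a) * N (y - ?z)
     + 2 * (D (?z - v) \<bullet> (a *\<^sub>R (x - ?z) + (1 - a) *\<^sub>R (y - ?z)))"
    unfolding N_three_points[of x v ?z] N_three_points[of y v ?z]
    by (simp add: algebra_simps)
  moreover have "a *\<^sub>R (x - ?z) + (1 - a) *\<^sub>R (y - ?z) = 0"
    unfolding x y by (simp add: algebra_simps)
  moreover have "0 \<le> a * N (x - ?z)" "0 \<le> (1 - a) * N (y - ?z)" using assms N_nonneg by auto
  ultimately show ?thesis by simp
qed

lemma prox_expansion:
  "c \<bullet> (z + d) + h / 2 * N (z + d - v) =
    c \<bullet> z + h / 2 * N (z - v) + (c + h *\<^sub>R D (z - v)) \<bullet> d + h / 2 * N d"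
  using N_three_points[of "z + d" v z] by (simp add: algebra_simps inner_simps)

text \<open>
  A minimiser of the prox objective exists, as the objective is a single quadratic up to a constant,
  so \<open>arg_min\<close> returns one. If the directional derivative towards some feasible \<open>u\<close> were negative, a short step towards
  \<open>u\<close> would decrease the objective.
\<close>

lemma prox_optimality:
  assumes I: "finite I" and h: "0 < (\<Sum>i\<in>I. h i)"
    and z: "z = arg_min (\<lambda>z. \<Sum>i\<in>I. c i \<bullet> z + 1 / 2 * h i * N (z - v i)) (\<lambda>z. z \<in> Z)"
  shows "z \<in> Z" "\<And>u. u \<in> Z \<Longrightarrow> 0 \<le> (\<Sum>i\<in>I. c i + h i *\<^sub>R D (z - v i)) \<bullet> (u - z)"
proof -
  define \<psi> where "\<psi> = (\<lambda>z. \<Sum>i\<in>I. c i \<bullet> z + 1 / 2 * h i * N (z - v i))"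
  define H where "H = (\<Sum>i\<in>I. h i)"
  define G where "G = (\<lambda>z. \<Sum>i\<in>I. c i + h i *\<^sub>R D (z - v i))"
  have expand: "\<psi> (z + d) = \<psi> z + G z \<bullet> d + H / 2 * N d" for z d
  proof -
    have "\<psi> (z + d) = (\<Sum>i\<in>I. c i \<bullet> z + 1 / 2 * h i * N (z - v i)
        + (c i + h i *\<^sub>R D (z - v i)) \<bullet> d + h i * (1 / 2 * N d))"
      unfolding \<psi>_def
    proof (rule sum.cong[OF refl])
      fix i assume "i \<in> I"
      show "c i \<bullet> (z + d) + 1 / 2 * h i * N (z + d - v i) = c i \<bullet> z + 1 / 2 * h i * N (z - v i)
        + (c i + h i *\<^sub>R D (z - v i)) \<bullet> d + h i * (1 / 2 * N d)"
        using prox_expansion[of "c i" z d "h i" "v i"] by simp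
    qed
    also have "\<dots> = \<psi> z + G z \<bullet> d + H * (1 / 2 * N d)"
      unfolding \<psi>_def G_def H_def inner_sum_left sum_distrib_right by (simp only: sum.distrib)
    finally show ?thesis by simp
  qed
  obtain z0 where z0: "z0 \<in> Z" "\<And>z'. z' \<in> Z \<Longrightarrow> G 0 \<bullet> z0 + H / 2 * N z0 \<le> G 0 \<bullet> z' + H / 2 * N z'"
    using minimizer[of H "G 0"] h unfolding H_def by blast
  have "\<psi> z0 \<le> \<psi> z'" if "z' \<in> Z" for z'
    using z0(2)[OF that] expand[of 0 z0] expand[of 0 z'] by simp
  then have "is_arg_min \<psi> (\<lambda>z. z \<in> Z) z0"
    using z0(1) by (auto simp: is_arg_min_def not_less)
  then have min: "is_arg_min \<psi> (\<lambda>z. z \<in> Z) z"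
    unfolding z \<psi>_def[symmetric] arg_min_def by (rule someI)
  then show zZ: "z \<in> Z" by (simp add: is_arg_min_def)
  fix u assume u: "u \<in> Z"
  show "0 \<le> (\<Sum>i\<in>I. c i + h i *\<^sub>R D (z - v i)) \<bullet> (u - z)"
  proof (rule ccontr)
    let ?g = "G z \<bullet> (u - z)" and ?q = "H / 2 * N (u - z)"
    assume "\<not> ?thesis"
    then have neg: "?g < 0" by (simp add: G_def)
    have q: "0 \<le> ?q" using N_nonneg h by (simp add: H_def)
    \<comment> \<open>short enough for half of the linear decrease to outweigh the quadratic term; the summand 1 avoids a division by zero\<close>
    define s where "s = min 1 (- ?g / (2 * (?q + 1)))"
    have s: "0 < s" "s \<le> 1" "s \<le> - ?g / (2 * (?q + 1))" using neg q
      by (auto simp: s_def intro!: divide_pos_pos divide_neg_pos)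
    have "(1 - s) *\<^sub>R z + s *\<^sub>R u \<in> Z" using convex_Z zZ u s by (auto intro: convexD)
    then have "z + s *\<^sub>R (u - z) \<in> Z" by (simp add: algebra_simps)
    then have "\<psi> z \<le> \<psi> (z + s *\<^sub>R (u - z))" using min by (auto simp: is_arg_min_def not_less)
    then have "0 \<le> s * ?g + s\<^sup>2 * ?q" by (simp add: expand N_scaleR mult_ac)
    also have "\<dots> = s * (?g + s * ?q)" by (simp add: power2_eq_square algebra_simps)
    finally have "0 \<le> ?g + s * ?q" using s(1) by (simp only: zero_le_mult_iff) auto
    moreover have "s * ?q \<le> s * (?q + 1)" using s by simp
    moreover have "s * (?q + 1) \<le> - ?g / 2"
      using s(3) q by (simp add: field_simps)
    ultimately show False using neg by linarith
  qed
qed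

text \<open>
  Summed over the levels, this turns first-order optimality into the three-point inequality of a
  prox step.
\<close>

lemma prox_identity:
  "c \<bullet> (z - u) + h / 2 * (N (z - v) + N (u - z) - N (u - v)) = - ((c + h *\<^sub>R D (z - v)) \<bullet> (u - z))"
  unfolding N_three_points[of u v z] by (simp add: algebra_simps inner_simps add_divide_distrib)

text \<open>
  One pass of a loop, with all data of the surrounding recursion abstracted: \<open>z\<close> is the prox centre,
  \<open>zt\<close> the answer of the inner call, \<open>zn\<close> the corrected centre for the next pass, and \<open>zb\<close>, \<open>zb'\<close> are the old and
  the new average. \<open>E\<close> collects the linear-plus-prox terms of the outer levels, \<open>P\<close> is the function of this
  level, and \<open>F\<close> and \<open>l\<close> are the functions and the linear terms of the deeper levels. Smoothness of
  \<open>P\<close> at \<open>zb'\<close> is combined with its lower models at \<open>u\<close> and at \<open>zb\<close>, as in accelerated gradient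
  descent. In \<open>qt \<bullet> (zt - u)\<close> the part along \<open>zn - u\<close> is paid for by the correction step, and the
  part along \<open>zt - zn\<close> by the two squares that the prox weight provides beyond \<open>\<Lambda>\<close>.
\<close>

lemma accelerated_extragradient_step:
  fixes E P F l :: "'z \<Rightarrow> real"
  assumes a: "0 < a" "a \<le> 1"
    and zb': "zb' = a *\<^sub>R zt + (1 - a) *\<^sub>R zb" and w: "w = a *\<^sub>R z + (1 - a) *\<^sub>R zb"
    and inner: "E zt + ((gr + q) \<bullet> (zt - u) + \<eta> / 2 * (N (zt - z) + N (u - zt) - N (u - z)))
         + ((F zb' - F (a *\<^sub>R u + (1 - a) *\<^sub>R zb)) / a + l zt) \<le> r"
    and E: "E zb' \<le> a * E zt + (1 - a) * E zb"
    and F: "F (a *\<^sub>R u + (1 - a) *\<^sub>R zb) \<le> a * F u + (1 - a) * F zb"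
    and l: "l zb' = a * l zt + (1 - a) * l zb"
    and P_smooth: "P zb' \<le> P w + gr \<bullet> (zb' - w) + a * \<Lambda> / 2 * N (zt - z) + \<epsilon>"
    and P_u: "P w + gr \<bullet> (u - w) \<le> P u" and P_zb: "P w + gr \<bullet> (zb - w) \<le> P zb"
    and correction: "(qt - q) \<bullet> (zn - u) + \<eta> / 2 * (N (zn - zt) + N (u - zn) - N (u - zt)) \<le> 0"
    and lip: "(qt - q) \<bullet> (zt - zn) \<le> M / 2 * (N (zt - z) + N (zn - zt))"
    and skew: "qt \<bullet> (zt - u) = qu \<bullet> (zt - u)"
    and M: "M + \<Lambda> \<le> \<eta>" "0 \<le> \<Lambda>"
  shows "E zb' + (P zb' - P u) + (F zb' - F u) + qu \<bullet> (zb' - u) + l zb' \<le>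
     (1 - a) * (E zb + (P zb - P u) + (F zb - F u) + qu \<bullet> (zb - u) + l zb)
     + a * (r + \<eta> / 2 * (N (u - z) - N (u - zn)) + \<epsilon> / a)"
proof -
  have P1: "a * (P w + gr \<bullet> (u - w)) \<le> a * P u" using P_u a by simp
  have P2: "(1 - a) * (P w + gr \<bullet> (zb - w)) \<le> (1 - a) * P zb"
    using P_zb a by (intro mult_left_mono) auto
  have gr: "gr \<bullet> (zb' - w) = a * (gr \<bullet> (u - w)) + (1 - a) * (gr \<bullet> (zb - w)) + a * (gr \<bullet> (zt - u))"
    unfolding zb' w by (simp add: algebra_simps inner_simps)
  have qu: "qu \<bullet> (zb' - u) = (1 - a) * (qu \<bullet> (zb - u)) + a * (qt \<bullet> (zt - u))"
    unfolding skew zb' by (simp add: algebra_simps inner_simps)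
  have qt: "qt \<bullet> (zt - u) = q \<bullet> (zt - u) + (qt - q) \<bullet> (zn - u) + (qt - q) \<bullet> (zt - zn)"
    by (simp add: algebra_simps inner_simps)
  \<comment> \<open>the prox weight dominates the curvature and the Lipschitz error together\<close>
  have "(M + \<Lambda>) * N (zt - z) \<le> \<eta> * N (zt - z)" "M * N (zn - zt) \<le> \<eta> * N (zn - zt)"
    using M N_nonneg by (auto intro!: mult_right_mono)
  then have small: "M / 2 * (N (zt - z) + N (zn - zt)) \<le>
      (\<eta> - \<Lambda>) / 2 * N (zt - z) + \<eta> / 2 * N (zn - zt)" by (simp add: algebra_simps diff_divide_distrib)
  define X where "X = E zt + gr \<bullet> (zt - u) + qt \<bullet> (zt - u) + \<Lambda> / 2 * N (zt - z) + l zt"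
  define Y where "Y = (F zb' - F (a *\<^sub>R u + (1 - a) *\<^sub>R zb)) / a"
  have "X + Y \<le> r + \<eta> / 2 * (N (u - z) - N (u - zn))"
    unfolding X_def Y_def using inner correction lip small qt by (simp add: algebra_simps inner_simps diff_divide_distrib)
  then have "a * (X + Y) \<le> a * (r + \<eta> / 2 * (N (u - z) - N (u - zn)))" using a by simp
  moreover have "a * Y = F zb' - F (a *\<^sub>R u + (1 - a) *\<^sub>R zb)" using a by (simp add: Y_def)
  ultimately have key: "a * X + F zb' \<le> a * (r + \<eta> / 2 * (N (u - z) - N (u - zn))) + F (a *\<^sub>R u + (1 - a) *\<^sub>R zb)"
    by (simp add: algebra_simps)
  have ea: "a * (r + \<eta> / 2 * (N (u - z) - N (u - zn)) + \<epsilon> / a) = a * (r + \<eta> / 2 * (N (u - z) - N (u - zn))) + \<epsilon>"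
    using a by (simp add: algebra_simps)
  have "P zb' \<le> a * P u + (1 - a) * P zb + a * (gr \<bullet> (zt - u)) + a * \<Lambda> / 2 * N (zt - z) + \<epsilon>"
    using P_smooth P1 P2 gr by (simp add: algebra_simps)
  then show ?thesis unfolding ea using key F E
    unfolding X_def qu l by (simp add: algebra_simps)
qed

end

section \<open>The sliding recursion\<close>

text \<open>
  The warm start of the deeper levels copies entries of the state table one after another. As sources
  and targets are disjoint, the order does not matter.
\<close>

lemma fold_copy_other:
  "x \<notin> f ` set ls \<Longrightarrow> fold (\<lambda>l zs. zs(f l := zs (g l))) ls zs x = zs x"
  by (induction ls arbitrary: zs) auto

lemma fold_copy:
  assumes "distinct (map f ls)" "f ` set ls \<inter> g ` set ls = {}" "l \<in> set ls"
  shows "fold (\<lambda>l zs. zs(f l := zs (g l))) ls zs (f l) = zs (g l)"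
  using assms
proof (induction ls rule: rev_induct)
  case (snoc x ls)
  show ?case
  proof (cases "l = x")
    case True
    have "g x \<notin> f ` set ls" using snoc.prems(2) by auto
    then show ?thesis using True fold_copy_other[of "g x" f ls g zs] by (simp add: fun_upd_def)
  next
    case False
    then have l: "l \<in> set ls" using snoc.prems by auto
    moreover have "f x \<notin> f ` set ls" using snoc.prems by auto
    ultimately have "f l \<noteq> f x" by (metis image_eqI)
    then show ?thesis using snoc l by auto
  qed
qed simp

definition index_scale :: "nat list \<Rightarrow> real"
  where "index_scale t = (\<Prod>l=1..length t. alpha (t ! (l - 1)))"

lemma index_scale_Nil [simp]: "index_scale [] = 1"
  by (simp add: index_scale_def)

lemma index_scale_snoc: "index_scale (t @ [j]) = index_scale t * alpha j"
  by (simp add: index_scale_def nth_append) (auto intro!: disjI2 prod.cong)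

lemma index_scale_pos: "0 < index_scale t"
  unfolding index_scale_def by (intro prod_pos) (simp add: alpha_pos)

text \<open>
  The map \<open>a\<^sub>1 \<circ> \<dots> \<circ> a\<^sub>k\<close> of the current multi-index as a function of its argument, whereas \<open>sl_w\<close> only has
  its value at the prox centre.
\<close>

definition sl_affine :: "'z::real_vector sl_state \<Rightarrow> nat list \<Rightarrow> 'z \<Rightarrow> 'z"
  where "sl_affine s t =
    foldr (\<lambda>l z. alpha (t ! (l - 1)) *\<^sub>R z + (1 - alpha (t ! (l - 1))) *\<^sub>R st_zbar s (take l t))
      [1..<Suc (length t)]"

lemma sl_w_affine: "sl_w s t = sl_affine s t (st_z s t)"
  by (simp add: sl_w_def sl_affine_def)

lemma sl_affine_Nil [simp]: "sl_affine s [] z = z"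
  by (simp add: sl_affine_def)

lemma sl_affine_cong:
  assumes "\<And>l. 1 \<le> l \<Longrightarrow> l \<le> length t \<Longrightarrow> st_zbar s' (take l t) = st_zbar s (take l t)"
  shows "sl_affine s' t = sl_affine s t"
  unfolding sl_affine_def using assms by (intro ext foldr_cong) auto

lemma sl_affine_snoc:
  "sl_affine s (t @ [j]) z = sl_affine s t (alpha j *\<^sub>R z + (1 - alpha j) *\<^sub>R st_zbar s (t @ [j]))"
proof -
  have "[1..<Suc (length (t @ [j]))] = [1..<Suc (length t)] @ [Suc (length t)]" by simp
  then show ?thesis
    unfolding sl_affine_def by (simp only: foldr_append) (auto intro!: foldr_cong simp: nth_append)
qed

lemma sl_affine_diff: "sl_affine s t x - sl_affine s t y = index_scale t *\<^sub>R (x - y)"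
proof (induction t arbitrary: x y rule: rev_induct)
  case (snoc j t)
  show ?case unfolding sl_affine_snoc snoc.IH index_scale_snoc by (simp add: algebra_simps)
qed simp

lemma sl_affine_comb:
  "sl_affine s t (a *\<^sub>R x + (1 - a) *\<^sub>R y) = a *\<^sub>R sl_affine s t x + (1 - a) *\<^sub>R sl_affine s t y"
proof -
  have "sl_affine s t (a *\<^sub>R x + (1 - a) *\<^sub>R y) - sl_affine s t y = a *\<^sub>R (sl_affine s t x - sl_affine s t y)"
    unfolding sl_affine_diff by (simp add: algebra_simps)
  then show ?thesis by (simp add: algebra_simps)
qed

lemma sl_affine_in:
  assumes "convex S" "z \<in> S" "\<And>l. 1 \<le> l \<Longrightarrow> l \<le> length t \<Longrightarrow> st_zbar s (take l t) \<in> S"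
  shows "sl_affine s t z \<in> S"
  using assms(2,3)
proof (induction t arbitrary: z rule: rev_induct)
  case (snoc j t)
  have zb: "st_zbar s (t @ [j]) \<in> S" using snoc.prems(2)[of "Suc (length t)"] by simp
  have "sl_affine s t (alpha j *\<^sub>R z + (1 - alpha j) *\<^sub>R st_zbar s (t @ [j])) \<in> S"
  proof (rule snoc.IH)
    show "alpha j *\<^sub>R z + (1 - alpha j) *\<^sub>R st_zbar s (t @ [j]) \<in> S"
      using assms(1) snoc.prems(1) zb alpha_pos[of j] alpha_le_1[of j]
      by (intro convexD) (auto simp: less_imp_le)
    show "st_zbar s (take l t) \<in> S" if "1 \<le> l" "l \<le> length t" for l
      using snoc.prems(2)[of l] that by simp
  qed
  then show ?case by (simp add: sl_affine_snoc)
qed simp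

text \<open>
  Frame condition of the call \<open>Rec(k, t)\<close>: it only writes entries at proper extensions of \<open>t\<close>.
\<close>

definition same_outside :: "nat list \<Rightarrow> 'z sl_state \<Rightarrow> 'z sl_state \<Rightarrow> bool"
  where "same_outside t s s' \<longleftrightarrow> (\<forall>l. \<not> strict_prefix t l \<longrightarrow>
    st_z s' l = st_z s l \<and> st_zbar s' l = st_zbar s l \<and>
    st_grad s' l = st_grad s l \<and> st_Q s' l = st_Q s l)"

lemma same_outside_refl: "same_outside t s s"
  by (simp add: same_outside_def)

lemma same_outside_trans: "same_outside t s s' \<Longrightarrow> same_outside t s' s'' \<Longrightarrow> same_outside t s s''"
  by (simp add: same_outside_def)

lemma not_strict_prefix_take: "\<not> strict_prefix t (take i t)"
  by (metis prefix_order.less_le_not_le take_is_prefix)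

lemma same_outside_take:
  assumes "same_outside t s s'"
  shows "st_z s' (take i t) = st_z s (take i t)" "st_zbar s' (take i t) = st_zbar s (take i t)"
    "st_grad s' (take i t) = st_grad s (take i t)" "st_Q s' (take i t) = st_Q s (take i t)"
  using assms not_strict_prefix_take unfolding same_outside_def by blast+

text \<open>
  The set \<open>V\<close> consists of directions along which the feasible set is invariant and which the oracle
  vectors do not see; it will be a product of kernels. The oracles are inexact only through the constants \<open>e\<close>. The
  bound on \<open>Q\<close> is \<open>M\<close>-Lipschitz continuity with respect to \<open>N\<close> and its dual norm, combined with the
  arithmetic-geometric mean inequality.
\<close>

locale sliding = prox_geometry D N Z
  for D :: "'z::real_inner \<Rightarrow> 'z" and N and Z +
  fixes A :: "'z sliding" and p :: "nat \<Rightarrow> 'z \<Rightarrow> real" and e :: "nat \<Rightarrow> real"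
    and V :: "'z set" and z0 :: 'z
  assumes pnorm: "sl_pnorm2 A = N" and dom: "sl_dom A = Z"
    and n_pos: "0 < sl_n A"
    and T_pos: "\<lbrakk>1 \<le> i; i \<le> sl_n A\<rbrakk> \<Longrightarrow> 0 < sl_T A i"
    and L_pos: "\<lbrakk>1 \<le> i; i \<le> sl_n A\<rbrakk> \<Longrightarrow> 0 < sl_L A i"
    and M_nonneg: "\<lbrakk>1 \<le> i; i \<le> sl_n A\<rbrakk> \<Longrightarrow> 0 \<le> sl_M A i"
    and e_nonneg: "\<lbrakk>1 \<le> i; i \<le> sl_n A\<rbrakk> \<Longrightarrow> 0 \<le> e i"
    and z0: "z0 \<in> Z"
    and V_uminus: "v \<in> V \<Longrightarrow> - v \<in> V"
    and V_shift: "\<lbrakk>z \<in> Z; v \<in> V\<rbrakk> \<Longrightarrow> z + v \<in> Z"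
    and grad_V: "\<lbrakk>1 \<le> i; i \<le> sl_n A; z \<in> Z; v \<in> V\<rbrakk> \<Longrightarrow> fst (sl_grad A i z) \<bullet> v = 0"
    and Q_V: "\<lbrakk>1 \<le> i; i \<le> sl_n A; z \<in> Z; v \<in> V\<rbrakk> \<Longrightarrow> fst (sl_Q A i z) \<bullet> v = 0"
    and grad_lower: "\<lbrakk>1 \<le> i; i \<le> sl_n A; w \<in> Z; z \<in> Z\<rbrakk> \<Longrightarrow>
      p i w + fst (sl_grad A i w) \<bullet> (z - w) \<le> p i z"
    and grad_upper: "\<lbrakk>1 \<le> i; i \<le> sl_n A; w \<in> Z; z \<in> Z\<rbrakk> \<Longrightarrow>
      p i z \<le> p i w + fst (sl_grad A i w) \<bullet> (z - w) + sl_L A i / 2 * N (z - w) + e i"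
    and Q_skew: "\<lbrakk>1 \<le> i; i \<le> sl_n A; z \<in> Z; u \<in> Z\<rbrakk> \<Longrightarrow>
      fst (sl_Q A i z) \<bullet> (z - u) = fst (sl_Q A i u) \<bullet> (z - u)"
    and Q_lipschitz: "\<lbrakk>1 \<le> i; i \<le> sl_n A; z \<in> Z; z' \<in> Z; y \<in> Z; y' \<in> Z\<rbrakk> \<Longrightarrow>
      (fst (sl_Q A i z) - fst (sl_Q A i z')) \<bullet> (y - y') \<le> sl_M A i / 2 * (N (z - z') + N (y - y'))"
begin

abbreviation "n \<equiv> sl_n A"
abbreviation "T \<equiv> sl_T A"
abbreviation "grad i z \<equiv> fst (sl_grad A i z)"
abbreviation "Q i z \<equiv> fst (sl_Q A i z)"
abbreviation "last_alpha l \<equiv> alpha (T l - 1)"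

text \<open>
  The affine slice through the starting point that is orthogonal to \<open>V\<close> in the geometry of \<open>D\<close>. All
  iterates lie in it.
\<close>

definition slice :: "'z set"
  where "slice = {z \<in> Z. \<forall>v\<in>V. D (z - z0) \<bullet> v = 0}"

lemma slice_subset: "z \<in> slice \<Longrightarrow> z \<in> Z"
  by (simp add: slice_def)

lemma z0_slice: "z0 \<in> slice"
  by (simp add: slice_def z0 linear_0[OF linear_D])

lemma convex_slice: "convex slice"
proof (rule convexI)
  fix x y :: 'z and a b :: real
  assume *: "x \<in> slice" "y \<in> slice" "0 \<le> a" "0 \<le> b" "a + b = 1"
  have "a *\<^sub>R x + b *\<^sub>R y \<in> Z" using * convex_Z by (auto simp: slice_def intro: convexD)
  moreover have "D (a *\<^sub>R x + b *\<^sub>R y - z0) \<bullet> v = 0" if "v \<in> V" for v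
  proof -
    have "a *\<^sub>R x + b *\<^sub>R y - z0 = a *\<^sub>R (x - z0) + b *\<^sub>R (y - z0)"
      using *(5) by (simp add: algebra_simps) (metis scaleR_left.add scaleR_one)
    then show ?thesis
      using * that by (simp add: slice_def linear_add[OF linear_D] linear_scale[OF linear_D] inner_simps)
  qed
  ultimately show "a *\<^sub>R x + b *\<^sub>R y \<in> slice" by (simp add: slice_def)
qed

lemma slice_comb: "\<lbrakk>x \<in> slice; y \<in> slice; 0 \<le> a; a \<le> 1\<rbrakk> \<Longrightarrow> a *\<^sub>R x + (1 - a) *\<^sub>R y \<in> slice"
  using convex_slice by (auto intro: convexD)

lemma Z_comb: "\<lbrakk>x \<in> Z; y \<in> Z; 0 \<le> a; a \<le> 1\<rbrakk> \<Longrightarrow> a *\<^sub>R x + (1 - a) *\<^sub>R y \<in> Z"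
  using convex_Z by (auto intro: convexD)

text \<open>
  For \<open>v\<close> in \<open>V\<close> both \<open>z + v\<close> and \<open>z - v\<close> are feasible, so the derivative of the prox objective along \<open>v\<close>
  vanishes. The linear terms do not contribute to it, and what remains says that the minimiser
  inherits membership in the slice from the prox centres.
\<close>

lemma prox_step:
  assumes I: "finite I" and h: "\<And>i. i \<in> I \<Longrightarrow> 0 \<le> h i" "0 < (\<Sum>i\<in>I. h i)"
    and c: "\<And>i v. i \<in> I \<Longrightarrow> v \<in> V \<Longrightarrow> c i \<bullet> v = 0"
    and y: "\<And>i. i \<in> I \<Longrightarrow> y i \<in> slice"
    and z: "z = arg_min (\<lambda>z. \<Sum>i\<in>I. c i \<bullet> z + 1 / 2 * h i * N (z - y i)) (\<lambda>z. z \<in> Z)"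
  shows "z \<in> slice"
    "\<And>u. u \<in> Z \<Longrightarrow> (\<Sum>i\<in>I. c i \<bullet> (z - u) + h i / 2 * (N (z - y i) + N (u - z) - N (u - y i))) \<le> 0"
proof -
  let ?G = "\<Sum>i\<in>I. c i + h i *\<^sub>R D (z - y i)"
  note opt = prox_optimality[OF I h(2) z]
  show "(\<Sum>i\<in>I. c i \<bullet> (z - u) + h i / 2 * (N (z - y i) + N (u - z) - N (u - y i))) \<le> 0" if "u \<in> Z" for u
    using opt(2)[OF that] by (simp only: prox_identity sum_negf inner_sum_left[symmetric])
  have "D (z - z0) \<bullet> v = 0" if v: "v \<in> V" for v
  proof -
    have "?G \<bullet> v \<ge> 0" using opt(2)[OF V_shift[OF opt(1) v]] by simp
    moreover have "?G \<bullet> (- v) \<ge> 0" using opt(2)[OF V_shift[OF opt(1) V_uminus[OF v]]] by simp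
    ultimately have "0 = ?G \<bullet> v" by simp
    also have "\<dots> = (\<Sum>i\<in>I. c i \<bullet> v + h i * (D (z - z0) \<bullet> v) - h i * (D (y i - z0) \<bullet> v))"
      by (simp add: inner_sum_left inner_simps linear_diff[OF linear_D] algebra_simps)
    also have "\<dots> = (\<Sum>i\<in>I. h i * (D (z - z0) \<bullet> v))"
      using c v y by (intro sum.cong) (auto simp: slice_def)
    also have "\<dots> = (\<Sum>i\<in>I. h i) * (D (z - z0) \<bullet> v)" by (simp add: sum_distrib_right)
    finally show ?thesis using h(2) by simp
  qed
  then show "z \<in> slice" using opt(1) by (simp add: slice_def)
qed

lemma p_convex:
  assumes i: "1 \<le> i" "i \<le> n" and xy: "x \<in> Z" "y \<in> Z" and a: "0 \<le> a" "a \<le> 1"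
  shows "p i (a *\<^sub>R x + (1 - a) *\<^sub>R y) \<le> a * p i x + (1 - a) * p i y"
proof -
  let ?w = "a *\<^sub>R x + (1 - a) *\<^sub>R y"
  have w: "?w \<in> Z" using xy a by (rule Z_comb)
  have "a * (p i ?w + grad i ?w \<bullet> (x - ?w)) \<le> a * p i x"
    and "(1 - a) * (p i ?w + grad i ?w \<bullet> (y - ?w)) \<le> (1 - a) * p i y"
    using grad_lower[OF i w] xy a by (auto intro!: mult_left_mono)
  moreover have "a * (grad i ?w \<bullet> (x - ?w)) + (1 - a) * (grad i ?w \<bullet> (y - ?w)) = 0"
    by (simp add: algebra_simps inner_simps)
  ultimately show ?thesis by (simp add: algebra_simps)
qed

text \<open>
  The factor that accompanies \<open>M\<close> in \<open>\<eta>\<close>. For admissible multi-indices each quotient is at least \<open>1\<close>, so that \<open>\<eta>\<close> always dominates the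
  Lipschitz constant of \<open>Q\<close>.
\<close>

definition index_ratio :: "nat list \<Rightarrow> real"
  where "index_ratio t = (\<Prod>l=1..length t. alpha (t ! (l - 1)) / last_alpha l)"

lemma index_ratio_Nil [simp]: "index_ratio [] = 1"
  by (simp add: index_ratio_def)

lemma index_ratio_snoc: "index_ratio (t @ [j]) = index_ratio t * (alpha j / last_alpha (Suc (length t)))"
  by (simp add: index_ratio_def nth_append) (auto intro!: disjI2 prod.cong)

lemma index_ratio_ge_1:
  assumes "\<And>l. l < length t \<Longrightarrow> t ! l < T (Suc l)"
  shows "1 \<le> index_ratio t"
  unfolding index_ratio_def
proof (rule prod_ge_1)
  fix l assume "l \<in> {1..length t}"
  then have "t ! (l - 1) < T (Suc (l - 1))" "Suc (l - 1) = l" using assms[of "l - 1"] by auto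
  then have "last_alpha l \<le> alpha (t ! (l - 1))" by (intro alpha_antimono) auto
  then show "1 \<le> alpha (t ! (l - 1)) / last_alpha l" using alpha_pos[of "T l - 1"] by simp
qed

lemma eta_eq: "sl_eta A t = sl_L A (length t) * index_scale t + sl_M A (length t) * index_ratio t"
  by (simp add: sl_eta_def index_scale_def index_ratio_def)

lemma eta_pos:
  assumes "1 \<le> length t" "length t \<le> n" "\<And>l. l < length t \<Longrightarrow> t ! l < T (Suc l)"
  shows "0 < sl_eta A t" "sl_M A (length t) + sl_L A (length t) * index_scale t \<le> sl_eta A t"
    "sl_M A (length t) \<le> sl_eta A t"
proof -
  have "sl_M A (length t) * 1 \<le> sl_M A (length t) * index_ratio t"
    using M_nonneg[OF assms(1,2)] index_ratio_ge_1[OF assms(3)] by (intro mult_left_mono) auto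
  moreover have "0 < sl_L A (length t) * index_scale t"
    using L_pos[OF assms(1,2)] index_scale_pos[of t] by simp
  ultimately show "0 < sl_eta A t" "sl_M A (length t) + sl_L A (length t) * index_scale t \<le> sl_eta A t"
    "sl_M A (length t) \<le> sl_eta A t"
    using M_nonneg[OF assms(1,2)] by (auto simp: eta_eq)
qed

text \<open>
  The weight with which level \<open>i\<close> enters the guarantee of \<open>Rec(k, t)\<close>, \<open>k < i\<close>. For \<open>k = i\<close> it is half of
  the prox weight \<open>\<eta>\<close>, so that the loop's own level and the deeper ones are treated uniformly.
\<close>

definition coeff :: "nat \<Rightarrow> nat list \<Rightarrow> real"
  where "coeff i t = (sl_L A i * index_scale t * (\<Prod>l\<in>{length t<..i}. (last_alpha l)\<^sup>2) +
     sl_M A i * index_ratio t * (\<Prod>l\<in>{length t<..i}. last_alpha l)) / 2"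

text \<open>
  The tolerance of level \<open>i\<close> accumulated during \<open>Rec(k, t)\<close>: each of the loops \<open>k + 1, \<dots>, i\<close> costs its
  length as a factor, and the rescaling of \<open>p\<^sub>i\<close> divides by the step sizes of the outer loops.
\<close>

definition err :: "nat \<Rightarrow> nat list \<Rightarrow> real"
  where "err i t = e i * real (\<Prod>l\<in>{length t<..i}. T l) / index_scale t"

lemma coeff_length: "coeff (length t) t = sl_eta A t / 2"
  by (simp add: coeff_def eta_eq)

lemma err_length: "err (length t) t = e (length t) / index_scale t"
  by (simp add: err_def)

lemma prod_greaterThanAtMost_first:
  "k < i \<Longrightarrow> (\<Prod>l\<in>{k<..i}. h l) = h (Suc k) * (\<Prod>l\<in>{Suc k<..i::nat}. h l)"
  by (subst prod.remove[of _ "Suc k"]) (auto intro!: arg_cong2[where f="(*)"] prod.cong)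

lemma sum_greaterThanAtMost_first:
  "k < i \<Longrightarrow> (\<Sum>l\<in>{k<..i}. h l) = h (Suc k) + (\<Sum>l\<in>{Suc k<..i::nat}. h l :: real)"
  by (subst sum.remove[of _ "Suc k"]) (auto intro!: arg_cong2[where f="(+)"] sum.cong)

text \<open>
  Divided by \<open>\<alpha>\<^sub>j\<close>, the weights do not depend on the pass \<open>j\<close>. This is what makes the
  distances to the prox centres telescope over a loop.
\<close>

lemma coeff_snoc:
  assumes "length t < i"
  shows "(last_alpha (Suc (length t)))\<^sup>2 * (coeff i (t @ [j]) / alpha j) = coeff i t"
  using alpha_pos[of j] alpha_pos[of "T (Suc (length t)) - 1"]
  unfolding coeff_def index_scale_snoc index_ratio_snoc prod_greaterThanAtMost_first[OF assms]
  by (simp add: field_simps power2_eq_square)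

lemma err_snoc_sum:
  assumes "length t < i" "i \<le> n"
  shows "(last_alpha (Suc (length t)))\<^sup>2 * (\<Sum>j<T (Suc (length t)). err i (t @ [j]) / alpha j) \<le> err i t"
proof -
  let ?T = "T (Suc (length t))"
  let ?c = "e i * real (\<Prod>l\<in>{Suc (length t)<..i}. T l) / index_scale t"
  have "0 \<le> ?c" using e_nonneg[of i] assms index_scale_pos[of t]
    by (auto intro!: divide_nonneg_pos mult_nonneg_nonneg prod_nonneg)
  have "(\<Sum>j<?T. err i (t @ [j]) / alpha j) = ?c * (\<Sum>j<?T. 1 / (alpha j)\<^sup>2)"
    unfolding sum_distrib_left by (intro sum.cong) (auto simp: err_def index_scale_snoc power2_eq_square)
  then have "(last_alpha (Suc (length t)))\<^sup>2 * (\<Sum>j<?T. err i (t @ [j]) / alpha j) =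
      ?c * ((last_alpha (Suc (length t)))\<^sup>2 * (\<Sum>j<?T. 1 / (alpha j)\<^sup>2))" by simp
  also have "\<dots> \<le> ?c * real ?T"
    using alpha_weighted_errors[of ?T] T_pos[of "Suc (length t)"] assms \<open>0 \<le> ?c\<close>
    by (intro mult_left_mono) auto
  also have "\<dots> = err i t"
    unfolding err_def prod_greaterThanAtMost_first[OF assms(1)] by simp
  finally show ?thesis .
qed

text \<open>
  What \<open>Rec(k, t)\<close> needs when \<open>m = n - k\<close> levels remain: feasible centres and averages and
  admissible oracle vectors at the prefixes of \<open>t\<close>, and feasible initial centres at the zero extensions of
  \<open>t\<close>.
\<close>

definition ready :: "nat \<Rightarrow> nat list \<Rightarrow> 'z sl_state \<Rightarrow> bool"
  where "ready m t s \<longleftrightarrow> length t + m = n \<and>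
    (\<forall>l<length t. t ! l < T (Suc l)) \<and>
    (\<forall>i\<in>{1..length t}. st_z s (take i t) \<in> slice \<and> st_zbar s (take i t) \<in> slice \<and>
       (\<forall>v\<in>V. (st_grad s (take i t) + st_Q s (take i t)) \<bullet> v = 0)) \<and>
    (\<forall>i<m. st_z s (t @ replicate (Suc i) 0) \<in> slice)"

text \<open>
  The gap of the subproblem of \<open>Rec(k, t)\<close> between \<open>z\<close> and \<open>u\<close> splits into the prox terms of the levels up
  to \<open>k\<close> and the rescaled functions of the deeper levels. The prox terms carry an additional
  \<open>N (u - z)\<close>, which reflects strong convexity of the subproblem.
\<close>

definition outer_gap :: "'z sl_state \<Rightarrow> nat list \<Rightarrow> 'z \<Rightarrow> 'z \<Rightarrow> real"
  where "outer_gap s t u z = (\<Sum>i=1..length t.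
    (st_grad s (take i t) + st_Q s (take i t)) \<bullet> (z - u) + sl_eta A (take i t) / 2 *
      (N (z - st_z s (take i t)) + N (u - z) - N (u - st_z s (take i t))))"

definition inner_gap :: "'z sl_state \<Rightarrow> nat list \<Rightarrow> 'z \<Rightarrow> 'z \<Rightarrow> real"
  where "inner_gap s t u z = (\<Sum>i\<in>{length t<..n}.
    (p i (sl_affine s t z) - p i (sl_affine s t u)) / index_scale t + Q i u \<bullet> (z - u))"

text \<open>
  The guarantee of \<open>Rec(k, t)\<close>. The last centres at level \<open>i > k\<close> sit at \<open>t\<close> followed by \<open>T\<^sub>k\<^sub>+\<^sub>1\<close> and zeros; these are the
  entries that the calling loop copies for its next pass.
\<close>

definition achieved :: "nat \<Rightarrow> nat list \<Rightarrow> 'z sl_state \<Rightarrow> 'z \<times> 'z sl_state \<Rightarrow> bool"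
  where "achieved m t s r \<longleftrightarrow> fst r \<in> slice \<and> same_outside t s (snd r) \<and>
    (\<forall>i<m. st_z (snd r) (t @ T (Suc (length t)) # replicate i 0) \<in> slice) \<and>
    (\<forall>u\<in>Z. outer_gap s t u (fst r) + inner_gap s t u (fst r) \<le> (\<Sum>i\<in>{length t<..n}.
       coeff i t * (N (u - st_z s (t @ replicate (i - length t) 0)) -
         N (u - st_z (snd r) (t @ T (Suc (length t)) # replicate (i - Suc (length t)) 0))) + err i t))"

text \<open>
  At the innermost level the call is a single prox step and the guarantee is its three-point
  inequality.
\<close>

lemma achieved_base:
  assumes "ready 0 t s"
  shows "achieved 0 t s (sl_rec A 0 t s)"
proof -
  let ?I = "{1..n}"
  have len: "length t = n" using assms by (simp add: ready_def)
  have eta: "0 < sl_eta A (take i t)" if "i \<in> ?I" for i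
    using that assms len by (intro eta_pos) (auto simp: ready_def)
  define z where "z = fst (sl_rec A 0 t s)"
  have z: "z = arg_min (\<lambda>z. \<Sum>i\<in>?I. (st_grad s (take i t) + st_Q s (take i t)) \<bullet> z +
      1 / 2 * sl_eta A (take i t) * N (z - st_z s (take i t))) (\<lambda>z. z \<in> Z)"
    by (simp add: z_def pnorm dom)
  have pos: "0 < (\<Sum>i\<in>?I. sl_eta A (take i t))" using eta n_pos by (intro sum_pos) auto
  note step = prox_step[OF _ _ pos _ _ z]
  have "z \<in> slice" using assms eta len by (intro step(1)) (auto simp: ready_def less_imp_le)
  moreover have "outer_gap s t u z \<le> 0" if "u \<in> Z" for u
    using assms eta len that unfolding outer_gap_def len
    by (intro step(2)) (auto simp: ready_def less_imp_le)
  moreover have "snd (sl_rec A 0 t s) = s" by simp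
  ultimately show ?thesis
    unfolding achieved_def z_def[symmetric] by (simp add: same_outside_refl inner_gap_def len)
qed

end

section \<open>One pass of a loop\<close>

lemma strict_prefix_snocD: "strict_prefix (t @ [j]) l \<Longrightarrow> strict_prefix t l"
  by (auto simp: strict_prefix_def prefix_def)

lemma strict_prefix_append_Cons: "strict_prefix t (t @ i # r)"
  by (auto simp: strict_prefix_def)

context sliding
begin

text \<open>
  The invariant of the loop of \<open>Rec(k, t)\<close> before pass \<open>j\<close>, relative to the state \<open>s0\<close> in which the loop starts.
\<close>

definition loop_ready :: "nat \<Rightarrow> nat list \<Rightarrow> nat \<Rightarrow> 'z sl_state \<Rightarrow> 'z sl_state \<Rightarrow> bool"
  where "loop_ready m t j s0 s \<longleftrightarrow> same_outside t s0 s \<and> st_zbar s (t @ [j]) \<in> slice \<and>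
    (\<forall>i\<le>m. st_z s (t @ j # replicate i 0) \<in> slice)"

lemma sl_evaluate_simps:
  "st_z (sl_evaluate A t s) = st_z s"
  "st_zbar (sl_evaluate A t s) = st_zbar s"
  "st_grad (sl_evaluate A t s) = (st_grad s)(t := grad (length t) (sl_w s t))"
  "st_Q (sl_evaluate A t s) = (st_Q s)(t := Q (length t) (st_z s t))"
  by (simp_all add: sl_evaluate_def case_prod_beta)

lemma affine_slice:
  assumes "ready m t s" "z \<in> Z"
  shows "sl_affine s t z \<in> Z"
  using assms by (intro sl_affine_in convex_Z) (auto simp: ready_def slice_def)

text \<open>
  All effects of one pass on the state: the inner call meets its precondition, the invariant is
  carried on to the next pass, the new centre is a prox step around the answer of the inner call, and the
  deeper centres are inherited from the inner call.
\<close>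

lemma pass_state:
  assumes ready: "ready (Suc m) t s0" and loop: "loop_ready m t j s0 s" and j: "j < T (Suc (length t))"
    and IH: "\<And>s. ready m (t @ [j]) s \<Longrightarrow> achieved m (t @ [j]) s (sl_rec A m (t @ [j]) s)"
  defines "s' \<equiv> sl_pass A (sl_rec A m) t j s"
    and "r \<equiv> sl_rec A m (t @ [j]) (sl_evaluate A (t @ [j]) s)"
    and "zn \<equiv> st_z (sl_pass A (sl_rec A m) t j s) (t @ [Suc j])"
    and "qt \<equiv> Q (Suc (length t)) (fst (sl_rec A m (t @ [j]) (sl_evaluate A (t @ [j]) s)))"
    and "q \<equiv> Q (Suc (length t)) (st_z s (t @ [j]))"
  shows "achieved m (t @ [j]) (sl_evaluate A (t @ [j]) s) r"
    and "loop_ready m t (Suc j) s0 s'"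
    and "st_zbar s' (t @ [Suc j]) = alpha j *\<^sub>R fst r + (1 - alpha j) *\<^sub>R st_zbar s (t @ [j])"
    and "\<And>u. u \<in> Z \<Longrightarrow> (qt - q) \<bullet> (zn - u) + sl_eta A (t @ [j]) / 2 *
      (N (zn - fst r) + N (u - zn) - N (u - fst r)) \<le> 0"
    and "\<And>i. i < m \<Longrightarrow> st_z s' (t @ Suc j # 0 # replicate i 0) =
      st_z (snd r) (t @ j # T (Suc (Suc (length t))) # replicate i 0)"
proof -
  let ?t' = "t @ [j]" and ?t'' = "t @ [Suc j]"
  define k where "k = length t"
  define s1 where "s1 = snd r"
  define zt where "zt = fst r"
  have km: "k + Suc m = n" and tl: "\<And>l. l < length t \<Longrightarrow> t ! l < T (Suc l)"
    using ready by (auto simp: ready_def k_def)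
  have k1: "1 \<le> Suc k" "Suc k \<le> n" using km by auto
  have same: "same_outside t s0 s" and zb: "st_zbar s ?t' \<in> slice"
    and zs: "\<And>i. i \<le> m \<Longrightarrow> st_z s (t @ j # replicate i 0) \<in> slice"
    using loop by (auto simp: loop_ready_def)
  have z: "st_z s ?t' \<in> slice" using zs[of 0] by simp
  have t'l: "\<And>l. l < length ?t' \<Longrightarrow> ?t' ! l < T (Suc l)"
    using tl j by (auto simp: nth_append less_Suc_eq)
  have outer: "st_z s (take i t) \<in> slice" "st_zbar s (take i t) \<in> slice"
      "\<And>v. v \<in> V \<Longrightarrow> (st_grad s (take i t) + st_Q s (take i t)) \<bullet> v = 0"
    if "i \<in> {1..length t}" for i
    using ready that unfolding same_outside_take[OF same] by (auto simp: ready_def)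
  have w: "sl_w s ?t' \<in> Z"
    unfolding sl_w_affine
  proof (rule sl_affine_in[OF convex_Z])
    show "st_z s ?t' \<in> Z" using z by (rule slice_subset)
    show "st_zbar s (take l ?t') \<in> Z" if "1 \<le> l" "l \<le> length ?t'" for l
      using that outer(2)[of l] zb by (cases "l = Suc (length t)") (auto dest: slice_subset)
  qed
  have "ready m ?t' (sl_evaluate A ?t' s)"
    unfolding ready_def sl_evaluate_simps
  proof (intro conjI ballI allI impI)
    show "length ?t' + m = n" using km by (simp add: k_def)
    show "?t' ! l < T (Suc l)" if "l < length ?t'" for l using t'l that .
    show "st_z s (?t' @ replicate (Suc i) 0) \<in> slice" if "i < m" for i
      using zs[of "Suc i"] that by simp
    fix i assume i: "i \<in> {1..length ?t'}"
    show "st_z s (take i ?t') \<in> slice"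
      using i outer(1)[of i] z by (cases "i = Suc (length t)") auto
    show "st_zbar s (take i ?t') \<in> slice"
      using i outer(2)[of i] zb by (cases "i = Suc (length t)") auto
    fix v assume v: "v \<in> V"
    show "(((st_grad s)(?t' := grad (length ?t') (sl_w s ?t'))) (take i ?t') +
        ((st_Q s)(?t' := Q (length ?t') (st_z s ?t'))) (take i ?t')) \<bullet> v = 0"
    proof (cases "i = Suc (length t)")
      case True
      then show ?thesis
        using grad_V[OF k1 w v] Q_V[OF k1 slice_subset[OF z] v] by (simp add: k_def inner_add_left)
    next
      case False
      then have i': "i \<in> {1..length t}" using i by auto
      then have "take i ?t' = take i t" "take i t \<noteq> ?t'" by (auto dest!: arg_cong[of _ _ length])
      then show ?thesis using outer(3)[OF i' v] by simp
    qed
  qed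
  then show achieved: "achieved m ?t' (sl_evaluate A ?t' s) r" unfolding r_def by (rule IH)
  have zt: "zt \<in> slice" and same1: "same_outside ?t' (sl_evaluate A ?t' s) s1"
    and zs1: "\<And>i. i < m \<Longrightarrow> st_z s1 (?t' @ T (Suc (Suc k)) # replicate i 0) \<in> slice"
    using achieved by (simp_all add: achieved_def zt_def s1_def k_def)
  have s1_t': "st_zbar s1 ?t' = st_zbar s ?t'" "st_Q s1 ?t' = q"
    using same1 by (simp_all add: same_outside_def sl_evaluate_simps q_def)
  define c where "c = snd (sl_Q A (k + 1) zt)"
  define z1 where "z1 = arg_min (\<lambda>z. (qt - q) \<bullet> z + 1 / 2 * sl_eta A ?t' * N (z - zt)) (\<lambda>z. z \<in> Z)"
  define F where "F = (\<lambda>l. ?t'' @ replicate (l - (k + 1)) (0::nat))"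
  define G where "G = (\<lambda>l. ?t' @ [T (k + 2)] @ replicate (l - (k + 2)) (0::nat))"
  define zs' where "zs' = fold (\<lambda>l zs. zs(F l := zs (G l))) [k + 2..<n + 1] ((st_z s1)(?t'' := z1))"
  have s': "s' = s1\<lparr>st_z := zs', st_zbar := (st_zbar s1)(?t'' := alpha j *\<^sub>R zt + (1 - alpha j) *\<^sub>R st_zbar s ?t'),
      st_cost := st_cost s1 + c\<rparr>"
    unfolding s'_def sl_pass_def Let_def s1_t'[symmetric] zs'_def z1_def F_def G_def c_def zt_def s1_def r_def qt_def k_def
    by (simp add: case_prod_beta pnorm dom)
  have FG: "F l \<noteq> G l'" for l l' unfolding F_def G_def by simp
  have zs'_other: "zs' x = st_z s1 x" if "\<not> strict_prefix t x" for x
  proof -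
    have "x \<notin> F ` set [k + 2..<n + 1]" "x \<noteq> ?t''"
      using that by (auto simp: F_def strict_prefix_append_Cons)
    then show ?thesis unfolding zs'_def by (simp add: fold_copy_other)
  qed
  have zs'_first: "zs' ?t'' = z1"
  proof -
    have "?t'' \<noteq> F l" if "k + 2 \<le> l" for l
      using that by (auto simp: F_def dest!: arg_cong[of _ _ length])
    then have "?t'' \<notin> F ` set [k + 2..<n + 1]" by auto
    then show ?thesis unfolding zs'_def by (simp add: fold_copy_other)
  qed
  have zs'_copy: "zs' (t @ Suc j # 0 # replicate i 0) = st_z s1 (t @ j # T (Suc (Suc k)) # replicate i 0)"
    if "i < m" for i
  proof -
    have inj: "inj_on F {k + 2..<n + 1}"
      by (rule inj_onI) (auto simp: F_def dest!: arg_cong[of _ _ length])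
    have "zs' (F (k + 2 + i)) = ((st_z s1)(?t'' := z1)) (G (k + 2 + i))"
      unfolding zs'_def
    proof (rule fold_copy)
      show "distinct (map F [k + 2..<n + 1])" unfolding distinct_map set_upt using inj by simp
      show "F ` set [k + 2..<n + 1] \<inter> G ` set [k + 2..<n + 1] = {}" using FG by auto
      show "k + 2 + i \<in> set [k + 2..<n + 1]" using that km by auto
    qed
    then show ?thesis by (simp add: F_def G_def)
  qed
  have zn: "zn = z1" unfolding zn_def s'_def[symmetric] s' using zs'_first by simp
  have eta: "0 < sl_eta A ?t'"
    using eta_pos(1)[of ?t'] t'l k1 by (simp add: k_def)
  have z1': "z1 = arg_min (\<lambda>z. \<Sum>i\<in>{0::nat}. (qt - q) \<bullet> z + 1 / 2 * sl_eta A ?t' * N (z - zt)) (\<lambda>z. z \<in> Z)"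
    by (simp add: z1_def)
  have orth: "(qt - q) \<bullet> v = 0" if "v \<in> V" for v
    using Q_V[OF k1 slice_subset[OF z] that] Q_V[OF k1 slice_subset[OF zt] that]
    by (simp add: qt_def q_def k_def zt_def r_def inner_diff_left)
  have "z1 \<in> slice" using zt orth eta by (intro prox_step(1)[OF _ _ _ _ _ z1']) auto
  then show "loop_ready m t (Suc j) s0 s'"
    unfolding loop_ready_def
  proof (intro conjI allI impI)
    show "same_outside t s0 s'"
    proof (rule same_outside_trans[OF same])
      have "st_z s1 l = st_z s l" "st_zbar s1 l = st_zbar s l" "st_grad s1 l = st_grad s l" "st_Q s1 l = st_Q s l"
        if "\<not> strict_prefix t l" for l
      proof -
        have "\<not> strict_prefix ?t' l" "l \<noteq> ?t'" using that strict_prefix_snocD[of t j l] by (auto simp: strict_prefix_append_Cons)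
        then show "st_z s1 l = st_z s l" "st_zbar s1 l = st_zbar s l" "st_grad s1 l = st_grad s l" "st_Q s1 l = st_Q s l"
          using same1 by (simp_all add: same_outside_def sl_evaluate_simps)
      qed
      then show "same_outside t s s'"
        unfolding same_outside_def s' by (auto simp: zs'_other strict_prefix_append_Cons)
    qed
    show "st_zbar s' ?t'' \<in> slice"
      unfolding s' using slice_comb[OF zt zb] alpha_pos[of j] alpha_le_1[of j] by simp
    fix i assume "i \<le> m"
    then show "st_z s' (t @ Suc j # replicate i 0) \<in> slice" if "z1 \<in> slice"
      using that zs'_first zs'_copy[of "i - 1"] zs1[of "i - 1"] unfolding s' by (cases i) auto
  qed
  show "st_zbar s' ?t'' = alpha j *\<^sub>R fst r + (1 - alpha j) *\<^sub>R st_zbar s ?t'"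
    unfolding s' zt_def by simp
  show "(qt - q) \<bullet> (zn - u) + sl_eta A ?t' / 2 * (N (zn - fst r) + N (u - zn) - N (u - fst r)) \<le> 0"
    if "u \<in> Z" for u
    using prox_step(2)[OF _ _ _ _ _ z1' that] eta orth zt unfolding zn zt_def[symmetric] by simp
  show "st_z s' (t @ Suc j # 0 # replicate i 0) = st_z (snd r) (t @ j # T (Suc (Suc (length t))) # replicate i 0)"
    if "i < m" for i
    using zs'_copy[OF that] unfolding s' s1_def k_def by simp
qed

lemma outer_gap_convex:
  assumes "ready m t s" "0 \<le> a" "a \<le> 1"
  shows "outer_gap s t u (a *\<^sub>R x + (1 - a) *\<^sub>R y) \<le> a * outer_gap s t u x + (1 - a) * outer_gap s t u y"
proof -
  define gap where "gap = (\<lambda>i z. (st_grad s (take i t) + st_Q s (take i t)) \<bullet> (z - u) + sl_eta A (take i t) / 2 *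
    (N (z - st_z s (take i t)) + N (u - z) - N (u - st_z s (take i t))))"
  have outer: "outer_gap s t u z = (\<Sum>i=1..length t. gap i z)" for z
    by (simp only: outer_gap_def gap_def)
  define xy where "xy = a *\<^sub>R x + (1 - a) *\<^sub>R y"
  have "gap i xy \<le> a * gap i x + (1 - a) * gap i y" if i: "i \<in> {1..length t}" for i
  proof -
    define c v h where "c = st_grad s (take i t) + st_Q s (take i t)" and "v = st_z s (take i t)"
      and "h = sl_eta A (take i t) / 2"
    have "0 < sl_eta A (take i t)"
      using i assms(1) by (intro eta_pos) (auto simp: ready_def)
    then have h: "0 \<le> h" by (simp add: h_def)
    have "N (xy - v) + N (xy - u) \<le> a * (N (x - v) + N (x - u)) + (1 - a) * (N (y - v) + N (y - u))"
      using N_convex_comb[OF assms(2,3), of x y v] N_convex_comb[OF assms(2,3), of x y u]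
      unfolding xy_def by (simp add: algebra_simps)
    then have "h * (N (xy - v) + N (xy - u)) \<le> h * (a * (N (x - v) + N (x - u)) + (1 - a) * (N (y - v) + N (y - u)))"
      using h by (rule mult_left_mono)
    moreover have "c \<bullet> (xy - u) = a * (c \<bullet> (x - u)) + (1 - a) * (c \<bullet> (y - u))"
      by (simp add: xy_def algebra_simps inner_simps)
    ultimately show ?thesis
      unfolding gap_def c_def[symmetric] v_def[symmetric] h_def[symmetric] N_minus_commute[of u]
      by (simp add: algebra_simps)
  qed
  then have "(\<Sum>i=1..length t. gap i xy) \<le> (\<Sum>i=1..length t. a * gap i x + (1 - a) * gap i y)"
    by (rule sum_mono)
  then show ?thesis
    unfolding outer xy_def[symmetric] by (simp add: sum.distrib sum_distrib_left)
qed

text \<open>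
  Here the one-pass inequality is instantiated by the data in the state. Rescaling \<open>p\<^sub>i\<close> by the affine map of
  \<open>t @ [j]\<close> is the same as rescaling by that of \<open>t\<close>, evaluating at the convex combination with the current average, and
  dividing by \<open>\<alpha>\<^sub>j\<close>, which is how the guarantee of the inner call acquires the form of a convexity
  estimate along the new average.
\<close>

lemma pass_gap:
  assumes ready: "ready (Suc m) t s0" and loop: "loop_ready m t j s0 s" and j: "j < T (Suc (length t))"
    and IH: "\<And>s. ready m (t @ [j]) s \<Longrightarrow> achieved m (t @ [j]) s (sl_rec A m (t @ [j]) s)"
    and u: "u \<in> Z"
  defines "s' \<equiv> sl_pass A (sl_rec A m) t j s"
    and "gap \<equiv> \<lambda>z. outer_gap s0 t u z + inner_gap s0 t u z"
  shows "gap (st_zbar s' (t @ [Suc j])) \<le> (1 - alpha j) * gap (st_zbar s (t @ [j])) + alpha j *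
    (\<Sum>i\<in>{length t<..n}. coeff i (t @ [j]) * (N (u - st_z s (t @ j # replicate (i - Suc (length t)) 0)) -
       N (u - st_z s' (t @ Suc j # replicate (i - Suc (length t)) 0))) + err i (t @ [j]))"
proof -
  let ?t' = "t @ [j]" and ?t'' = "t @ [Suc j]"
  define k where "k = length t"
  define se where "se = sl_evaluate A ?t' s"
  define zt where "zt = fst (sl_rec A m ?t' se)"
  define s1 where "s1 = snd (sl_rec A m ?t' se)"
  define z zb zn zb' where "z = st_z s ?t'" and "zb = st_zbar s ?t'" and "zn = st_z s' ?t''"
    and "zb' = st_zbar s' ?t''"
  define qt q where "qt = Q (Suc k) zt" and "q = Q (Suc k) z"
  define a sc where "a = alpha j" and "sc = index_scale t"
  define aff where "aff = sl_affine s0 t"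
  note state = pass_state[OF ready loop j IH, folded s'_def se_def k_def, folded zt_def s1_def,
    folded z_def zn_def, folded q_def qt_def zb_def zb'_def a_def, simplified]
  have k1: "1 \<le> Suc k" "Suc k \<le> n" and km: "k + Suc m = n" using ready by (auto simp: ready_def k_def)
  have same: "same_outside t s0 s" and zbZ: "zb \<in> Z"
    and zs: "\<And>i. i \<le> m \<Longrightarrow> st_z s (t @ j # replicate i 0) \<in> slice"
    using loop by (auto simp: loop_ready_def zb_def dest: slice_subset)
  have zZ: "z \<in> Z" using zs[of 0] by (simp add: z_def slice_subset)
  have ach: "zt \<in> slice" "same_outside ?t' se s1" using state(1)
    by (simp_all add: achieved_def zt_def s1_def)
  have ztZ: "zt \<in> Z" using ach(1) by (rule slice_subset)
  have znZ: "zn \<in> Z" using state(2) by (auto simp: loop_ready_def zn_def dest!: spec[of _ 0] slice_subset)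
  have a: "0 < a" "a \<le> 1" using alpha_pos alpha_le_1 by (auto simp: a_def)
  have sc: "0 < sc" by (simp add: sc_def index_scale_pos)
  have zb': "zb' = a *\<^sub>R zt + (1 - a) *\<^sub>R zb" using state(3) .
  have aff_se: "sl_affine se t = aff" "sl_affine s t = aff"
    unfolding aff_def using same_outside_take(2)[OF same]
    by (auto intro!: sl_affine_cong simp: se_def sl_evaluate_simps)
  have affZ: "aff x \<in> Z" if "x \<in> Z" for x unfolding aff_def using affine_slice[OF ready that] .
  have aff_diff: "aff x - aff y = sc *\<^sub>R (x - y)" for x y
    unfolding aff_def sc_def by (rule sl_affine_diff)
  have aff_comb: "aff (b *\<^sub>R x + (1 - b) *\<^sub>R y) = b *\<^sub>R aff x + (1 - b) *\<^sub>R aff y" for b x y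
    unfolding aff_def by (rule sl_affine_comb)
  have aff': "sl_affine se ?t' x = aff (a *\<^sub>R x + (1 - a) *\<^sub>R zb)" for x
    unfolding sl_affine_snoc aff_se a_def zb_def by (simp add: se_def sl_evaluate_simps)
  define w where "w = a *\<^sub>R z + (1 - a) *\<^sub>R zb"
  have wZ: "w \<in> Z" unfolding w_def using zZ zbZ a by (intro Z_comb) auto
  have zb'Z: "zb' \<in> Z" unfolding zb' using ztZ zbZ a by (intro Z_comb) auto
  have sl_w: "sl_w s ?t' = aff w"
    unfolding sl_w_affine sl_affine_snoc aff_se w_def a_def z_def zb_def ..
  define gr where "gr = grad (Suc k) (aff w)"
  define E where "E = outer_gap s0 t u"
  define P where "P = (\<lambda>x. p (Suc k) (aff x) / sc)"
  define F where "F = (\<lambda>x. \<Sum>i\<in>{Suc k<..n}. p i (aff x) / sc)"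
  define l where "l = (\<lambda>x. \<Sum>i\<in>{Suc k<..n}. Q i u \<bullet> (x - u))"
  define zz where "zz = (\<lambda>i. st_z s (t @ j # replicate (i - Suc k) 0))"
  define zz' where "zz' = (\<lambda>i. st_z s' (t @ Suc j # replicate (i - Suc k) 0))"
  define D' where "D' = (\<lambda>i. coeff i ?t' * (N (u - zz i) - N (u - zz' i)) + err i ?t')"
  define \<eta> where "\<eta> = sl_eta A ?t'"
  define \<Lambda> where "\<Lambda> = sl_L A (Suc k) * sc * a"
  have gap: "gap x = E x + (P x - P u) + (F x - F u) + Q (Suc k) u \<bullet> (x - u) + l x" for x
    unfolding gap_def inner_gap_def E_def P_def F_def l_def k_def[symmetric] sum_greaterThanAtMost_first[of k n, OF Suc_le_lessD, OF k1(2)]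
      aff_def[symmetric] sc_def[symmetric]
    by (simp add: sum.distrib sum_subtractf diff_divide_distrib)
  have D'_first: "D' (Suc k) = \<eta> / 2 * (N (u - z) - N (u - zn)) + (e (Suc k) / sc) / a"
    using coeff_length[of ?t'] err_length[of ?t']
    by (simp add: D'_def zz_def zz'_def z_def zn_def \<eta>_def k_def index_scale_snoc sc_def a_def)
  have outer: "outer_gap se ?t' u zt = E zt + ((gr + q) \<bullet> (zt - u) + \<eta> / 2 * (N (zt - z) + N (u - zt) - N (u - z)))"
  proof -
    have ne: "take i t \<noteq> ?t'" if "i \<in> {1..length t}" for i
      using that by (auto dest!: arg_cong[of _ _ length])
    have "outer_gap se ?t' u zt = (\<Sum>i=1..length t. (st_grad se (take i ?t') + st_Q se (take i ?t')) \<bullet> (zt - u)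
        + sl_eta A (take i ?t') / 2 * (N (zt - st_z se (take i ?t')) + N (u - zt) - N (u - st_z se (take i ?t'))))
        + ((gr + q) \<bullet> (zt - u) + \<eta> / 2 * (N (zt - z) + N (u - zt) - N (u - z)))"
      unfolding outer_gap_def
      by (simp add: se_def sl_evaluate_simps sl_w gr_def q_def z_def \<eta>_def k_def) (auto intro!: sum.cong)
    also have "(\<Sum>i=1..length t. (st_grad se (take i ?t') + st_Q se (take i ?t')) \<bullet> (zt - u)
        + sl_eta A (take i ?t') / 2 * (N (zt - st_z se (take i ?t')) + N (u - zt) - N (u - st_z se (take i ?t')))) = E zt"
      unfolding E_def outer_gap_def
      by (intro sum.cong) (auto simp: se_def sl_evaluate_simps same_outside_take[OF same] ne)
    finally show ?thesis .
  qed
  have inner: "inner_gap se ?t' u zt = (F zb' - F (a *\<^sub>R u + (1 - a) *\<^sub>R zb)) / a + l zt"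
    unfolding inner_gap_def F_def l_def aff' zb' sum_subtractf[symmetric] sum.distrib[symmetric] sum_divide_distrib
    by (intro sum.cong) (auto simp: k_def index_scale_snoc sc_def a_def diff_divide_distrib)
  \<comment> \<open>the centres used by the inner call are those of pass j, and the ones it leaves behind are those of pass j + 1\<close>
  have rhs: "(\<Sum>i\<in>{length ?t'<..n}. coeff i ?t' * (N (u - st_z se (?t' @ replicate (i - length ?t') 0)) -
      N (u - st_z s1 (?t' @ T (Suc (length ?t')) # replicate (i - Suc (length ?t')) 0))) + err i ?t')
      = (\<Sum>i\<in>{Suc k<..n}. D' i)"
  proof (rule sum.cong)
    fix i assume "i \<in> {Suc k<..n}"
    then have "i - Suc (Suc k) < m" "replicate (i - Suc k) 0 = 0 # replicate (i - Suc (Suc k)) (0::nat)"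
      using km by (auto simp: Suc_diff_Suc[symmetric])
    then show "coeff i ?t' * (N (u - st_z se (?t' @ replicate (i - length ?t') 0)) -
      N (u - st_z s1 (?t' @ T (Suc (length ?t')) # replicate (i - Suc (length ?t')) 0))) + err i ?t' = D' i"
      using state(5)[of "i - Suc (Suc k)"]
      by (simp add: D'_def zz_def zz'_def k_def[symmetric] se_def sl_evaluate_simps)
  qed (simp add: k_def)
  have bound: "outer_gap se ?t' u zt + inner_gap se ?t' u zt \<le> (\<Sum>i\<in>{Suc k<..n}. D' i)"
    unfolding rhs[symmetric] using state(1) u unfolding achieved_def zt_def[symmetric] s1_def[symmetric] by blast
  have "gap zb' \<le> (1 - a) * gap zb + a * ((\<Sum>i\<in>{Suc k<..n}. D' i) + \<eta> / 2 * (N (u - z) - N (u - zn)) + (e (Suc k) / sc) / a)"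
    unfolding gap
  proof (rule accelerated_extragradient_step[OF a zb' w_def])
    show "E zt + ((gr + q) \<bullet> (zt - u) + \<eta> / 2 * (N (zt - z) + N (u - zt) - N (u - z))) +
        ((F zb' - F (a *\<^sub>R u + (1 - a) *\<^sub>R zb)) / a + l zt) \<le> (\<Sum>i\<in>{Suc k<..n}. D' i)"
      using bound unfolding outer inner .
    show "E zb' \<le> a * E zt + (1 - a) * E zb"
      unfolding E_def zb' using a by (intro outer_gap_convex[OF ready]) auto
    show "F (a *\<^sub>R u + (1 - a) *\<^sub>R zb) \<le> a * F u + (1 - a) * F zb"
      unfolding F_def sum_distrib_left sum.distrib[symmetric]
    proof (rule sum_mono)
      fix i assume "i \<in> {Suc k<..n}"
      then have "p i (aff (a *\<^sub>R u + (1 - a) *\<^sub>R zb)) \<le> a * p i (aff u) + (1 - a) * p i (aff zb)"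
        unfolding aff_comb using affZ u zbZ a by (intro p_convex) auto
      then have "p i (aff (a *\<^sub>R u + (1 - a) *\<^sub>R zb)) / sc \<le> (a * p i (aff u) + (1 - a) * p i (aff zb)) / sc"
        using sc by (simp add: divide_right_mono)
      then show "p i (aff (a *\<^sub>R u + (1 - a) *\<^sub>R zb)) / sc \<le> a * (p i (aff u) / sc) + (1 - a) * (p i (aff zb) / sc)"
        by (simp add: add_divide_distrib)
    qed
    show "l zb' = a * l zt + (1 - a) * l zb"
      unfolding l_def sum_distrib_left sum.distrib[symmetric] zb'
      by (intro sum.cong) (auto simp: algebra_simps inner_simps)
    have "p (Suc k) (aff zb') \<le> p (Suc k) (aff w) + gr \<bullet> (aff zb' - aff w) + sl_L A (Suc k) / 2 * N (aff zb' - aff w) + e (Suc k)"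
      unfolding gr_def using affZ wZ zb'Z by (intro grad_upper[OF k1])
    also have "\<dots> = p (Suc k) (aff w) + sc * (gr \<bullet> (zb' - w)) + sl_L A (Suc k) / 2 * (sc\<^sup>2 * N (zb' - w)) + e (Suc k)"
      unfolding aff_diff N_scaleR by simp
    also have "zb' - w = a *\<^sub>R (zt - z)" unfolding zb' w_def by (simp add: algebra_simps)
    finally have "p (Suc k) (aff zb') \<le> p (Suc k) (aff w) + sc * (gr \<bullet> a *\<^sub>R (zt - z)) +
        sl_L A (Suc k) / 2 * (sc\<^sup>2 * (a\<^sup>2 * N (zt - z))) + e (Suc k)" unfolding N_scaleR .
    then have "p (Suc k) (aff zb') / sc \<le> (p (Suc k) (aff w) + sc * (gr \<bullet> a *\<^sub>R (zt - z)) +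
        sl_L A (Suc k) / 2 * (sc\<^sup>2 * (a\<^sup>2 * N (zt - z))) + e (Suc k)) / sc"
      using sc by (simp add: divide_right_mono)
    also have "\<dots> = P w + gr \<bullet> (a *\<^sub>R (zt - z)) + a * \<Lambda> / 2 * N (zt - z) + e (Suc k) / sc"
      using sc by (simp add: P_def \<Lambda>_def field_simps power2_eq_square)
    also have "a *\<^sub>R (zt - z) = zb' - w" unfolding zb' w_def by (simp add: algebra_simps)
    finally show "P zb' \<le> P w + gr \<bullet> (zb' - w) + a * \<Lambda> / 2 * N (zt - z) + e (Suc k) / sc"
      by (simp add: P_def)
    have lower: "P w + gr \<bullet> (x - w) \<le> P x" if "x \<in> Z" for x
    proof -
      have "p (Suc k) (aff w) + gr \<bullet> (aff x - aff w) \<le> p (Suc k) (aff x)"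
        unfolding gr_def using affZ wZ that by (intro grad_lower[OF k1])
      then have "(p (Suc k) (aff w) + gr \<bullet> (aff x - aff w)) / sc \<le> p (Suc k) (aff x) / sc"
        using sc by (simp add: divide_right_mono)
      then show ?thesis unfolding aff_diff P_def using sc by (simp add: add_divide_distrib)
    qed
    show "P w + gr \<bullet> (u - w) \<le> P u" "P w + gr \<bullet> (zb - w) \<le> P zb"
      by (rule lower[OF u] lower[OF zbZ])+
    show "(qt - q) \<bullet> (zn - u) + \<eta> / 2 * (N (zn - zt) + N (u - zn) - N (u - zt)) \<le> 0"
      using state(4)[OF u] by (simp add: \<eta>_def)
    show "(qt - q) \<bullet> (zt - zn) \<le> sl_M A (Suc k) / 2 * (N (zt - z) + N (zn - zt))"
      using Q_lipschitz[OF k1 ztZ zZ ztZ znZ] by (simp add: qt_def q_def N_minus_commute[of zt zn])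
    show "qt \<bullet> (zt - u) = Q (Suc k) u \<bullet> (zt - u)"
      unfolding qt_def by (rule Q_skew[OF k1 ztZ u])
    show "sl_M A (Suc k) + \<Lambda> \<le> \<eta>"
    proof -
      have "\<And>l. l < length ?t' \<Longrightarrow> ?t' ! l < T (Suc l)"
        using ready j by (auto simp: nth_append less_Suc_eq ready_def)
      then show ?thesis
        using eta_pos(2)[of ?t'] k1 by (simp add: \<eta>_def \<Lambda>_def k_def index_scale_snoc sc_def a_def mult_ac)
    qed
    show "0 \<le> \<Lambda>" using L_pos[OF k1] sc a by (simp add: \<Lambda>_def)
  qed
  also have "(\<Sum>i\<in>{Suc k<..n}. D' i) + \<eta> / 2 * (N (u - z) - N (u - zn)) + (e (Suc k) / sc) / a = (\<Sum>i\<in>{k<..n}. D' i)"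
    using sum_greaterThanAtMost_first[of k n D'] k1 D'_first by simp
  finally show ?thesis
    unfolding zb'_def zb_def a_def D'_def zz_def zz'_def k_def .
qed

section \<open>Convergence and cost of the sliding algorithm\<close>

text \<open>
  The passes of a loop are combined by the accelerated telescope. The distances collapse to
  those at the two ends of the loop, and the tolerances pick up the loop length.
\<close>

lemma achieved_rec:
  "ready m t s \<Longrightarrow> achieved m t s (sl_rec A m t s)"
proof (induction m arbitrary: t s)
  case 0
  then show ?case by (rule achieved_base)
next
  case (Suc m)
  define k where "k = length t"
  define s0 where "s0 = s\<lparr>st_zbar := (st_zbar s)(t @ [0] := st_z s (t @ [0]))\<rparr>"
  define st where "st = (\<lambda>j. fold (sl_pass A (sl_rec A m) t) [0..<j] s0)"
  let ?T = "T (Suc k)"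
  have km: "k + Suc m = n" using Suc.prems by (simp add: ready_def k_def)
  have Tpos: "0 < ?T" using T_pos[of "Suc k"] km by simp
  have rec: "sl_rec A (Suc m) t s = (st_zbar (st ?T) (t @ [?T]), st ?T)"
    by (simp add: Let_def st_def s0_def k_def)
  have ne: "take i t \<noteq> t @ [0]" for i by (auto dest: arg_cong[of _ _ length])
  have ss0: "same_outside t s s0"
    unfolding same_outside_def s0_def by (auto simp: strict_prefix_append_Cons)
  have ready0: "ready (Suc m) t s0"
    using Suc.prems ne unfolding ready_def s0_def by simp
  have st_Suc: "st (Suc j) = sl_pass A (sl_rec A m) t j (st j)" for j
    by (simp add: st_def)
  have loop: "loop_ready m t j s0 (st j)" if "j \<le> ?T" for j
    using that
  proof (induction j)
    case 0
    have "st_z s0 (t @ 0 # replicate i 0) \<in> slice" if "i \<le> m" for i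
      using ready0 that unfolding ready_def by (auto dest!: spec[of _ i])
    from this this[of 0] show ?case
      by (simp add: loop_ready_def st_def same_outside_refl) (simp add: s0_def)
  next
    case (Suc j)
    then show ?case unfolding st_Suc using pass_state(2)[OF ready0, of j "st j"] Suc.IH Suc.prems \<open>\<And>t s. ready m t s \<Longrightarrow> achieved m t s (sl_rec A m t s)\<close>
      by (simp add: k_def)
  qed
  define out where "out = st_zbar (st ?T) (t @ [?T])"
  define zz where "zz = (\<lambda>i j. st_z (st j) (t @ j # replicate (i - Suc k) 0))"
  have gap_le: "outer_gap s0 t u out + inner_gap s0 t u out \<le>
      (\<Sum>i\<in>{k<..n}. coeff i t * (N (u - zz i 0) - N (u - zz i ?T)) + err i t)" if u: "u \<in> Z" for u
  proof -
    define gap where "gap = (\<lambda>j. outer_gap s0 t u (st_zbar (st j) (t @ [j])) + inner_gap s0 t u (st_zbar (st j) (t @ [j])))"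
    define d where "d = (\<lambda>j. \<Sum>i\<in>{k<..n}. coeff i (t @ [j]) * (N (u - zz i j) - N (u - zz i (Suc j))) + err i (t @ [j]))"
    have "gap (Suc j) \<le> (1 - alpha j) * gap j + alpha j * d j" if "j < ?T" for j
      using pass_gap[OF ready0 loop[of j] _ Suc.IH u] that
      unfolding gap_def d_def zz_def st_Suc by (simp add: k_def)
    then have "gap ?T \<le> (last_alpha (Suc k))\<^sup>2 * (\<Sum>j<?T. d j / alpha j)"
      by (intro accelerated_telescope Tpos)
    also have "\<dots> = (\<Sum>i\<in>{k<..n}. \<Sum>j<?T. (last_alpha (Suc k))\<^sup>2 * (coeff i (t @ [j]) / alpha j) * (N (u - zz i j) - N (u - zz i (Suc j)))
        + (last_alpha (Suc k))\<^sup>2 * (err i (t @ [j]) / alpha j))"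
      unfolding d_def sum_divide_distrib sum_distrib_left
      by (subst sum.swap) (simp add: algebra_simps add_divide_distrib diff_divide_distrib)
    also have "\<dots> \<le> (\<Sum>i\<in>{k<..n}. coeff i t * (N (u - zz i 0) - N (u - zz i ?T)) + err i t)"
    proof (rule sum_mono)
      fix i assume i: "i \<in> {k<..n}"
      have "(\<Sum>j<?T. (last_alpha (Suc k))\<^sup>2 * (coeff i (t @ [j]) / alpha j) * (N (u - zz i j) - N (u - zz i (Suc j))))
          = (\<Sum>j<?T. coeff i t * (N (u - zz i j) - N (u - zz i (Suc j))))"
        using coeff_snoc[of t i] i by (intro sum.cong) (auto simp: k_def)
      also have "\<dots> = coeff i t * (N (u - zz i 0) - N (u - zz i ?T))"
        unfolding sum_distrib_left[symmetric] sum_lessThan_telescope'[of "\<lambda>j. N (u - zz i j)"] ..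
      finally show "(\<Sum>j<?T. (last_alpha (Suc k))\<^sup>2 * (coeff i (t @ [j]) / alpha j) * (N (u - zz i j) - N (u - zz i (Suc j)))
        + (last_alpha (Suc k))\<^sup>2 * (err i (t @ [j]) / alpha j)) \<le> coeff i t * (N (u - zz i 0) - N (u - zz i ?T)) + err i t"
        using err_snoc_sum[of t i] i by (simp add: sum.distrib k_def sum_distrib_left)
    qed
    finally show ?thesis by (simp add: gap_def out_def)
  qed
  have final: "same_outside t s0 (st ?T)" "out \<in> slice"
      "\<And>i. i \<le> m \<Longrightarrow> st_z (st ?T) (t @ ?T # replicate i 0) \<in> slice"
    using loop[of ?T] by (auto simp: loop_ready_def out_def)
  have "outer_gap s0 t = outer_gap s t" "inner_gap s0 t = inner_gap s t"
    unfolding outer_gap_def inner_gap_def same_outside_take[OF ss0]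
      sl_affine_cong[of t s0 s, OF same_outside_take(2)[OF ss0]] by simp_all
  moreover have "zz i 0 = st_z s (t @ replicate (i - k) 0)" if "i \<in> {k<..n}" for i
  proof -
    have "replicate (i - k) 0 = 0 # replicate (i - Suc k) (0::nat)"
      using that by (auto simp: Suc_diff_Suc[symmetric])
    then show ?thesis by (simp add: zz_def st_def s0_def)
  qed
  ultimately show ?case
    unfolding rec achieved_def out_def[symmetric]
    using final gap_le same_outside_trans[OF ss0 final(1)] by (simp add: k_def[symmetric] zz_def)
qed

text \<open>
  All centres start at the initial point, and the distances to the final centres are dropped.
\<close>

lemma run_sliding_gap:
  fixes c :: cost
  defines "zout \<equiv> fst (run_sliding A c z0)"
  shows "zout \<in> slice"
    and "\<And>u. u \<in> Z \<Longrightarrow> (\<Sum>i\<in>{0<..n}. p i zout - p i u + Q i u \<bullet> (zout - u)) \<le>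
      (\<Sum>i\<in>{0<..n}. coeff i [] * N (u - z0) + err i [])"
proof -
  define s :: "'z sl_state" where "s = \<lparr>st_z = (\<lambda>_. z0), st_zbar = (\<lambda>_. undefined), st_grad = (\<lambda>_. undefined),
            st_Q = (\<lambda>_. undefined), st_cost = c\<rparr>"
  have "ready n [] s" by (simp add: ready_def s_def z0_slice)
  then have ach: "achieved n [] s (sl_rec A n [] s)" by (rule achieved_rec)
  have zout: "zout = fst (sl_rec A n [] s)"
    by (simp add: zout_def run_sliding_def s_def case_prod_beta)
  show "zout \<in> slice" using ach by (simp add: achieved_def zout)
  fix u assume u: "u \<in> Z"
  let ?y = "\<lambda>i. st_z (snd (sl_rec A n [] s)) (T (Suc 0) # replicate (i - Suc 0) 0)"
  have "(\<Sum>i\<in>{0<..n}. p i zout - p i u + Q i u \<bullet> (zout - u)) \<le>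
      (\<Sum>i\<in>{0<..n}. coeff i [] * (N (u - z0) - N (u - ?y i)) + err i [])"
    using ach u by (simp add: achieved_def zout outer_gap_def inner_gap_def s_def)
  also have "\<dots> \<le> (\<Sum>i\<in>{0<..n}. coeff i [] * N (u - z0) + err i [])"
  proof (rule sum_mono)
    fix i assume "i \<in> {0<..n}"
    then have "0 \<le> coeff i []"
      using L_pos[of i] M_nonneg[of i] alpha_pos unfolding coeff_def
      by (auto intro!: divide_nonneg_pos add_nonneg_nonneg mult_nonneg_nonneg prod_nonneg simp: less_imp_le)
    then show "coeff i [] * (N (u - z0) - N (u - ?y i)) + err i [] \<le> coeff i [] * N (u - z0) + err i []"
      using N_nonneg by (simp add: algebra_simps)
  qed
  finally show "(\<Sum>i\<in>{0<..n}. p i zout - p i u + Q i u \<bullet> (zout - u)) \<le>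
      (\<Sum>i\<in>{0<..n}. coeff i [] * N (u - z0) + err i [])" .
qed

end

text \<open>
  A pass at level \<open>i\<close> evaluates the gradient once and \<open>Q\<close> twice, at the centre and at the answer of the inner
  call. The map \<open>\<phi>\<close> stands for any one of the three counters.
\<close>

lemma sl_rec_cost:
  fixes A :: "'z::real_inner sliding" and \<phi> :: "cost \<Rightarrow> nat"
  assumes add: "\<And>c c'. \<phi> (c + c') = \<phi> c + \<phi> c'"
    and a: "\<And>i z. \<phi> (snd (sl_grad A i z)) = a i" and b: "\<And>i z. \<phi> (snd (sl_Q A i z)) = b i"
  shows "\<phi> (st_cost (snd (sl_rec A m t s))) = \<phi> (st_cost s) +
    (\<Sum>i\<in>{length t<..length t + m}. (\<Prod>l\<in>{length t<..i}. sl_T A l) * (a i + 2 * b i))"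
proof (induction m arbitrary: t s)
  case (Suc m)
  let ?k = "length t"
  define C where "C = (\<Sum>i\<in>{Suc ?k<..Suc ?k + m}. (\<Prod>l\<in>{Suc ?k<..i}. sl_T A l) * (a i + 2 * b i))"
  have pass: "\<phi> (st_cost (sl_pass A (sl_rec A m) t j s)) = \<phi> (st_cost s) + (a (Suc ?k) + 2 * b (Suc ?k) + C)" for j s
    using Suc.IH[of "t @ [j]"]
    by (simp add: sl_pass_def sl_evaluate_def Let_def case_prod_beta add a b C_def)
  have "\<phi> (st_cost (fold (sl_pass A (sl_rec A m) t) [0..<T] s)) =
      \<phi> (st_cost s) + T * (a (Suc ?k) + 2 * b (Suc ?k) + C)" for T s
    by (induction T) (simp_all add: pass)
  moreover have "sl_T A (Suc ?k) * C = (\<Sum>i\<in>{Suc ?k<..Suc ?k + m}. (\<Prod>l\<in>{?k<..i}. sl_T A l) * (a i + 2 * b i))"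
    unfolding C_def sum_distrib_left
  proof (rule sum.cong[OF refl])
    fix i assume "i \<in> {Suc ?k<..Suc ?k + m}"
    then have "{?k<..i} = insert (Suc ?k) {Suc ?k<..i}" by auto
    then show "sl_T A (Suc ?k) * ((\<Prod>l\<in>{Suc ?k<..i}. sl_T A l) * (a i + 2 * b i)) =
        (\<Prod>l\<in>{?k<..i}. sl_T A l) * (a i + 2 * b i)" by simp
  qed
  moreover have "{?k<..?k + Suc m} = insert (Suc ?k) {Suc ?k<..Suc ?k + m}" "{?k<..Suc ?k} = {Suc ?k}" by auto
  ultimately show ?case by (simp add: Let_def algebra_simps)
qed simp

lemma run_sliding_cost:
  fixes A :: "'z::real_inner sliding" and \<phi> :: "cost \<Rightarrow> nat"
  assumes "\<And>c c'. \<phi> (c + c') = \<phi> c + \<phi> c'"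
    and "\<And>i z. \<phi> (snd (sl_grad A i z)) = a i" and "\<And>i z. \<phi> (snd (sl_Q A i z)) = b i"
  shows "\<phi> (snd (run_sliding A c0 z0)) = \<phi> c0 +
    (\<Sum>i\<in>{0<..sl_n A}. (\<Prod>l\<in>{0<..i}. sl_T A l) * (a i + 2 * b i))"
  using sl_rec_cost[where A = A and \<phi> = \<phi> and t = "[]" and m = "sl_n A", OF assms]
  by (simp add: run_sliding_def case_prod_beta)

section \<open>Compactness and spectra in coordinate subspaces\<close>

definition unit_vec :: "nat \<Rightarrow> fvec"
  where "unit_vec i = mk (Suc i) (\<lambda>l. if l = i then 1 else 0)"

lemma coord_unit_vec [simp]: "coord (unit_vec i) l = (if l = i then 1 else 0)"
  by (simp add: unit_vec_def)

lemma coord_sum: "coord (\<Sum>i\<in>I. h i) l = (\<Sum>i\<in>I. coord (h i) l)"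
  by (induction I rule: infinite_finite_induct) auto

lemma mk_expand: "mk d u = (\<Sum>i<d. u i *\<^sub>R unit_vec i)"
proof (rule fvec_eqI)
  fix l
  have "(\<Sum>i<d. u i * (if l = i then 1 else 0)) = (if l < d then u l else 0)"
    by (simp add: if_distrib[of "(*) _"] cong: if_cong)
  then show "coord (mk d u) l = coord (\<Sum>i<d. u i *\<^sub>R unit_vec i) l"
    by (simp add: coord_sum)
qed

lemma Rn_expand: "x \<in> Rn d \<Longrightarrow> x = (\<Sum>i<d. coord x i *\<^sub>R unit_vec i)"
  unfolding mk_expand[symmetric] by (rule fvec_eqI) (auto simp: Rn_def)

lemma abs_coord_le_norm: "\<bar>coord x i\<bar> \<le> norm x"
proof (cases "coord x i = 0")
  case False
  have "(coord x i)\<^sup>2 \<le> (\<Sum>i | coord x i \<noteq> 0. coord x i * coord x i)"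
    using False member_le_sum[of i "{i. coord x i \<noteq> 0}" "\<lambda>i. coord x i * coord x i"] finite_coord[of x]
    by (simp add: power2_eq_square)
  then have "(coord x i)\<^sup>2 \<le> (norm x)\<^sup>2"
    unfolding power2_norm_eq_inner inner_fvec_def .
  then show ?thesis by (simp add: abs_le_square_iff[symmetric])
qed simp

lemma bounded_linear_coord: "bounded_linear (\<lambda>x. coord x i)"
  by (rule bounded_linear_intro[where K = 1]) (auto simp: abs_coord_le_norm)

lemma continuous_matvec: "continuous_on S (matvec r c A)"
  unfolding matvec_def mk_expand
  by (intro continuous_intros bounded_linear.continuous_on[OF bounded_linear_coord])

lemma linear_matvec: "linear (matvec r c A)"
  by (rule linearI) (simp_all add: matvec_add matvec_scaleR)

text \<open>
  Every added coordinate realises the box as a continuous image of the product of the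
  lower-dimensional box with an interval.
\<close>

lemma compact_Rn_box: "compact {x \<in> Rn d. \<forall>i. \<bar>coord x i\<bar> \<le> r}"
proof (induction d)
  case 0
  have "{x \<in> Rn 0. \<forall>i. \<bar>coord x i\<bar> \<le> r} \<subseteq> {0}"
    by (auto simp: Rn_def intro: fvec_eqI)
  then show ?case by (meson finite.emptyI finite.insertI finite_imp_compact finite_subset)
next
  case (Suc d)
  let ?B = "{x \<in> Rn d. \<forall>i. \<bar>coord x i\<bar> \<le> r}"
  let ?h = "\<lambda>(x, t). x + t *\<^sub>R unit_vec d"
  have "{x \<in> Rn (Suc d). \<forall>i. \<bar>coord x i\<bar> \<le> r} = ?h ` (?B \<times> {-r..r})"
  proof (intro equalityI subsetI)
    fix x assume x: "x \<in> {x \<in> Rn (Suc d). \<forall>i. \<bar>coord x i\<bar> \<le> r}"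
    then have "\<bar>coord x d\<bar> \<le> r" by blast
    moreover have "x - coord x d *\<^sub>R unit_vec d \<in> ?B"
    proof -
      have y: "coord (x - coord x d *\<^sub>R unit_vec d) i = (if i = d then 0 else coord x i)" for i by simp
      have "coord x i = 0" if "d \<le> i" "i \<noteq> d" for i using x that by (auto simp: Rn_def)
      moreover have "\<bar>coord x i\<bar> \<le> r" for i using x by blast
      moreover have "0 \<le> r" using \<open>\<bar>coord x d\<bar> \<le> r\<close> by linarith
      ultimately show ?thesis unfolding Rn_def mem_Collect_eq y by auto
    qed
    ultimately have "(x - coord x d *\<^sub>R unit_vec d, coord x d) \<in> ?B \<times> {-r..r}" by auto
    then show "x \<in> ?h ` (?B \<times> {-r..r})" by (rule rev_image_eqI) simp
  next
    fix x assume "x \<in> ?h ` (?B \<times> {-r..r})"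
    then show "x \<in> {x \<in> Rn (Suc d). \<forall>i. \<bar>coord x i\<bar> \<le> r}"
      by (auto simp: Rn_def)
  qed
  moreover have "compact (?h ` (?B \<times> {-r..r}))"
    by (intro compact_continuous_image compact_Times Suc compact_Icc)
      (auto simp: case_prod_beta intro!: continuous_intros)
  ultimately show ?case by simp
qed

lemma compact_Rn:
  assumes "closed S" "bounded S" "S \<subseteq> Rn d"
  shows "compact S"
proof -
  obtain r where r: "\<And>x. x \<in> S \<Longrightarrow> norm x \<le> r" using assms(2) by (auto simp: bounded_iff)
  let ?B = "{x \<in> Rn d. \<forall>i. \<bar>coord x i\<bar> \<le> r}"
  have "x \<in> ?B" if "x \<in> S" for x
    using subsetD[OF assms(3) that] order_trans[OF abs_coord_le_norm r[OF that]] by simp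
  then have S: "?B \<inter> S = S" by (simp add: Int_absorb1 subset_iff)
  show ?thesis using compact_Int_closed[OF compact_Rn_box assms(1), of d r] unfolding S .
qed

text \<open>
  Outside a large ball the quadratic term exceeds the linear one, so that the problem reduces to a
  compact set.
\<close>

lemma quadratic_attains_min:
  fixes Z :: "(fvec \<times> fvec) set" and N :: "fvec \<times> fvec \<Rightarrow> real"
  assumes Z: "closed Z" "Z \<noteq> {}" "Z \<subseteq> Rn a \<times> Rn b"
    and N: "continuous_on Z N" "\<And>z. m * (norm z)\<^sup>2 \<le> N z" "0 < m"
    and h: "0 < h"
  shows "\<exists>z\<in>Z. \<forall>z'\<in>Z. c \<bullet> z + h / 2 * N z \<le> c \<bullet> z' + h / 2 * N z'"
proof -
  define \<psi> where "\<psi> = (\<lambda>z. c \<bullet> z + h / 2 * N z)"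
  obtain z1 where z1: "z1 \<in> Z" using Z(2) by blast
  \<comment> \<open>the radius beyond which the objective exceeds its value at z1\<close>
  define R where "R = 1 + 2 * (norm c + \<bar>\<psi> z1\<bar>) / (h * m)"
  have R: "1 \<le> R" using h N(3) by (simp add: R_def)
  have big: "\<psi> z1 < \<psi> z" if "R < norm z" for z
  proof -
    have "norm c + \<bar>\<psi> z1\<bar> < h * m / 2 * norm z"
    proof -
      have "2 * (norm c + \<bar>\<psi> z1\<bar>) / (h * m) < norm z" using that by (simp add: R_def)
      then show ?thesis using h N(3) by (simp add: field_simps)
    qed
    then have "(norm c + \<bar>\<psi> z1\<bar>) * norm z < (h * m / 2 * norm z) * norm z"
      using that R by (intro mult_strict_right_mono) auto
    also have "\<dots> = h / 2 * (m * (norm z)\<^sup>2)" by (simp add: power2_eq_square)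
    also have "\<dots> \<le> h / 2 * N z" using N(2) h by (intro mult_left_mono) auto
    finally have "norm c * norm z + \<bar>\<psi> z1\<bar> * norm z < h / 2 * N z" by (simp add: algebra_simps)
    moreover have "\<bar>\<psi> z1\<bar> * 1 \<le> \<bar>\<psi> z1\<bar> * norm z" using that R by (intro mult_left_mono) auto
    moreover have "- (norm c * norm z) \<le> c \<bullet> z" using Cauchy_Schwarz_ineq2[of c z] by linarith
    moreover have "\<psi> z1 \<le> \<bar>\<psi> z1\<bar>" by simp
    ultimately have "\<psi> z1 < c \<bullet> z + h / 2 * N z" by linarith
    then show ?thesis by (simp add: \<psi>_def)
  qed
  define Br where "Br = (\<lambda>d. {x \<in> Rn d. \<forall>i. \<bar>coord x i\<bar> \<le> R})"
  let ?S = "(Br a \<times> Br b) \<inter> Z"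
  have "compact ?S" unfolding Br_def by (intro compact_Int_closed compact_Times compact_Rn_box Z)
  have inS: "z \<in> ?S" if "z \<in> Z" "norm z \<le> R" for z
  proof -
    have "norm (fst z) \<le> R" "norm (snd z) \<le> R"
      using that norm_fst_le[of "fst z" "snd z"] norm_snd_le[of "snd z" "fst z"] by auto
    then have "\<bar>coord (fst z) i\<bar> \<le> R" "\<bar>coord (snd z) i\<bar> \<le> R" for i
      by (auto intro: order_trans[OF abs_coord_le_norm])
    then show ?thesis using that Z(3) by (cases z) (auto simp: Br_def)
  qed
  have "z1 \<in> ?S" using big[of z1] z1 by (intro inS) (auto simp: not_less[symmetric])
  moreover have "continuous_on ?S \<psi>"
    unfolding \<psi>_def by (intro continuous_intros continuous_on_subset[OF N(1)]) auto
  ultimately obtain z where z: "z \<in> ?S" "\<And>z'. z' \<in> ?S \<Longrightarrow> \<psi> z \<le> \<psi> z'"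
    using continuous_attains_inf[OF \<open>compact ?S\<close>] by blast
  have "\<psi> z \<le> \<psi> z'" if "z' \<in> Z" for z'
  proof (cases "norm z' \<le> R")
    case True
    then show ?thesis using z(2) inS that by blast
  next
    case False
    then show ?thesis using big[of z'] z(2)[OF \<open>z1 \<in> ?S\<close>] by simp
  qed
  then show ?thesis using z(1) unfolding \<psi>_def by blast
qed

text \<open>
  A minimiser \<open>v\<close> of the Rayleigh quotient on the unit sphere of \<open>S\<close> is an eigenvector. With
  \<open>g = A v - l v\<close>, which lies in \<open>S\<close> by invariance, the nonnegative quadratic form \<open>A x \<bullet> x - l \<parallel>x\<parallel>\<^sup>2\<close> has
  the value \<open>2 s \<parallel>g\<parallel>\<^sup>2 + O(s\<^sup>2)\<close> at \<open>v + s g\<close>, hence \<open>g = 0\<close>.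
\<close>

lemma minimal_eigenvector:
  assumes S: "subspace S" "closed S" "S \<subseteq> Rn d" and w: "w \<in> S" "w \<noteq> 0"
    and A: "linear A" "continuous_on S A" "\<And>x. x \<in> S \<Longrightarrow> A x \<in> S"
      "\<And>x y. x \<in> S \<Longrightarrow> y \<in> S \<Longrightarrow> A x \<bullet> y = x \<bullet> A y"
  obtains v l where "v \<in> S" "v \<noteq> 0" "A v = l *\<^sub>R v" "\<And>x. x \<in> S \<Longrightarrow> l * (norm x)\<^sup>2 \<le> A x \<bullet> x"
proof -
  let ?U = "S \<inter> {x. norm x = 1}"
  have "closed ?U" by (intro closed_Int S closed_Collect_eq continuous_intros)
  moreover have "bounded ?U" by (auto simp: bounded_iff)
  ultimately have "compact ?U" using S(3) by (intro compact_Rn) auto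
  moreover have "(1 / norm w) *\<^sub>R w \<in> ?U" using w subspace_scale[OF S(1)] by auto
  moreover have "continuous_on ?U (\<lambda>x. A x \<bullet> x)"
    by (intro continuous_intros continuous_on_subset[OF A(2)]) auto
  ultimately obtain v where v: "v \<in> ?U" "\<And>x. x \<in> ?U \<Longrightarrow> A v \<bullet> v \<le> A x \<bullet> x"
    using continuous_attains_inf[of ?U "\<lambda>x. A x \<bullet> x"] by blast
  define l where "l = A v \<bullet> v"
  have low: "l * (norm x)\<^sup>2 \<le> A x \<bullet> x" if "x \<in> S" for x
  proof (cases "x = 0")
    case False
    have "(1 / norm x) *\<^sub>R x \<in> ?U" using that False subspace_scale[OF S(1)] by auto
    from v(2)[OF this] have "l \<le> A x \<bullet> x / (norm x)\<^sup>2"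
      by (simp add: l_def linear_scale[OF A(1)] power2_eq_square)
    then show ?thesis using False by (simp add: field_simps)
  qed (simp add: linear_0[OF A(1)])
  have vS: "v \<in> S" and v1: "norm v = 1" using v(1) by auto
  define g where "g = A v - l *\<^sub>R v"
  have gS: "g \<in> S" unfolding g_def by (intro subspace_diff subspace_scale S A vS)
  define q where "q = A g \<bullet> g - l * (g \<bullet> g)"
  have "0 \<le> q" using low[OF gS] by (simp add: q_def power2_norm_eq_inner)
  have quad: "0 \<le> 2 * s * (norm g)\<^sup>2 + s\<^sup>2 * q" for s
  proof -
    have "v + s *\<^sub>R g \<in> S" by (intro subspace_add subspace_scale S vS gS)
    from low[OF this] have "l * ((v + s *\<^sub>R g) \<bullet> (v + s *\<^sub>R g)) \<le> A (v + s *\<^sub>R g) \<bullet> (v + s *\<^sub>R g)"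
      by (simp add: power2_norm_eq_inner)
    also have "A (v + s *\<^sub>R g) \<bullet> (v + s *\<^sub>R g) = A v \<bullet> v + 2 * s * (A v \<bullet> g) + s\<^sup>2 * (A g \<bullet> g)"
      using A(4)[OF gS vS] by (simp add: linear_add[OF A(1)] linear_scale[OF A(1)] inner_simps
          inner_commute power2_eq_square algebra_simps)
    finally have "0 \<le> 2 * s * (A v \<bullet> g - l * (v \<bullet> g)) + s\<^sup>2 * q"
      using v1 by (simp add: l_def q_def inner_simps power2_norm_eq_inner norm_eq_1 inner_commute
          power2_eq_square algebra_simps)
    moreover have "A v \<bullet> g - l * (v \<bullet> g) = (norm g)\<^sup>2"
      unfolding power2_norm_eq_inner by (simp add: g_def inner_simps algebra_simps)
    ultimately show ?thesis by simp
  qed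
  have "norm g = 0"
  proof (rule ccontr)
    assume "norm g \<noteq> 0"
    then have G: "0 < (norm g)\<^sup>2" by simp
    \<comment> \<open>a negative step so short that the linear term prevails\<close>
    define s where "s = - ((norm g)\<^sup>2 / (q + 1))"
    have "0 \<le> 2 * s * (norm g)\<^sup>2 + s\<^sup>2 * q" by (rule quad)
    also have "\<dots> = ((norm g)\<^sup>2)\<^sup>2 / (q + 1) * (q / (q + 1) - 2)"
    proof -
      have "2 * (- (G / r)) * G + (- (G / r))\<^sup>2 * q = G\<^sup>2 / r * (q / r - 2)" for G r :: real
        by (cases "r = 0") (simp_all add: field_simps power2_eq_square)
      then show ?thesis unfolding s_def .
    qed
    also have "\<dots> < 0" using G \<open>0 \<le> q\<close> by (intro mult_pos_neg) (auto simp: divide_less_eq)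
    finally show False by simp
  qed
  then have "A v = l *\<^sub>R v" by (simp add: g_def)
  with that vS v1 low show ?thesis by (metis norm_zero zero_neq_one)
qed

lemma matvec_gram: "matvec d d (mmul d' (mtrans A) A) x = matvec d d' (mtrans A) (matvec d' d A x)"
proof (rule fvec_eqI)
  fix i
  have "(\<Sum>j<d. (\<Sum>l<d'. A l i * A l j) * coord x j) = (\<Sum>l<d'. A l i * (\<Sum>j<d. A l j * coord x j))"
    unfolding sum_distrib_right sum_distrib_left by (subst sum.swap) (simp add: mult.assoc)
  then show "coord (matvec d d (mmul d' (mtrans A) A) x) i = coord (matvec d d' (mtrans A) (matvec d' d A x)) i"
    by (simp add: matvec_def mmul_def mtrans_def)
qed

lemma gram_inner:
  assumes "x \<in> Rn d" "y \<in> Rn d"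
  shows "matvec d d (mmul d' (mtrans A) A) x \<bullet> y = matvec d' d A x \<bullet> matvec d' d A y"
  unfolding matvec_gram using matvec_adjoint[OF assms(2), of "matvec d' d A x" d' A] by (simp add: matvec_in_Rn)

text \<open>
  Eigenvectors to different eigenvalues are orthogonal, so there are at most \<open>d\<close> of them. Finiteness is
  what gives \<open>Min\<close> and \<open>Max\<close> over the eigenvalues their meaning.
\<close>

lemma finite_eigvals_gram: "finite (eigvals d (mmul d' (mtrans A) A))"
proof -
  let ?G = "matvec d d (mmul d' (mtrans A) A)" and ?E = "eigvals d (mmul d' (mtrans A) A)"
  have "\<forall>l\<in>?E. \<exists>v. v \<in> Rn d \<and> v \<noteq> 0 \<and> ?G v = l *\<^sub>R v" by (auto simp: eigvals_def)
  then obtain v where v: "\<And>l. l \<in> ?E \<Longrightarrow> v l \<in> Rn d \<and> v l \<noteq> 0 \<and> ?G (v l) = l *\<^sub>R v l" by metis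
  have inner0: "v l \<bullet> v l' = 0" if "l \<in> ?E" "l' \<in> ?E" "l \<noteq> l'" for l l'
  proof -
    have "?G (v l) \<bullet> v l' = v l \<bullet> ?G (v l')"
      using v[OF that(1)] v[OF that(2)] gram_inner by (metis inner_commute)
    then have "l * (v l \<bullet> v l') = l' * (v l \<bullet> v l')" using v[OF that(1)] v[OF that(2)] by simp
    then show ?thesis using that(3) by simp
  qed
  have inj: "inj_on v ?E" using inner0 v by (intro inj_onI) (metis inner_eq_zero_iff)
  have "pairwise orthogonal (v ` ?E)"
    by (auto simp: pairwise_def orthogonal_def intro!: inner0)
  moreover have "0 \<notin> v ` ?E" using v by auto
  ultimately have ind: "independent (v ` ?E)" by (rule pairwise_orthogonal_independent)
  have "v ` ?E \<subseteq> span (unit_vec ` {..<d})"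
  proof
    fix x assume "x \<in> v ` ?E"
    then have "x \<in> Rn d" using v by auto
    then have "x = (\<Sum>i<d. coord x i *\<^sub>R unit_vec i)" by (rule Rn_expand)
    also have "\<dots> \<in> span (unit_vec ` {..<d})" by (intro span_sum span_scale span_base) auto
    finally show "x \<in> span (unit_vec ` {..<d})" .
  qed
  then have "finite (v ` ?E)" using independent_span_bound[OF _ ind] by blast
  then show ?thesis using inj finite_imageD by blast
qed

lemma closed_Rn: "closed (Rn d)"
proof -
  have "Rn d = (\<Inter>i\<in>{d..}. {x. coord x i = 0})" by (auto simp: Rn_def)
  then show ?thesis
    by (auto intro!: closed_INT closed_Collect_eq continuous_intros
        bounded_linear.continuous_on[OF bounded_linear_coord])
qed

text \<open>
  The largest eigenvalue is found as the negative of the least one of the negated operator.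
\<close>

lemma lam_max_bound:
  assumes x: "x \<in> Rn d"
  shows "(norm (matvec d' d A x))\<^sup>2 \<le> lam_max d (mmul d' (mtrans A) A) * (norm x)\<^sup>2"
proof (cases "x = 0")
  case True
  then show ?thesis using linear_0[OF linear_matvec] by simp
next
  case False
  let ?G = "matvec d d (mmul d' (mtrans A) A)"
  have lin: "linear (\<lambda>x. - ?G x)" by (intro linear_compose_neg linear_matvec)
  obtain v l where v: "v \<in> Rn d" "v \<noteq> 0" "- ?G v = l *\<^sub>R v"
    and low: "\<And>x. x \<in> Rn d \<Longrightarrow> l * (norm x)\<^sup>2 \<le> - ?G x \<bullet> x"
  proof (rule minimal_eigenvector[OF subspace_Rn closed_Rn order_refl x False lin])
    show "continuous_on (Rn d) (\<lambda>x. - ?G x)" by (intro continuous_intros continuous_matvec)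
    show "- ?G x \<in> Rn d" if "x \<in> Rn d" for x by (intro subspace_neg subspace_Rn matvec_in_Rn)
    show "- ?G x \<bullet> y = x \<bullet> - ?G y" if "x \<in> Rn d" "y \<in> Rn d" for x y
      using gram_inner[OF that] gram_inner[OF that(2,1)] by (simp add: inner_commute)
  qed blast
  have "?G v = (- l) *\<^sub>R v" using v(3) by (metis minus_equation_iff scaleR_minus_left)
  then have "- l \<in> eigvals d (mmul d' (mtrans A) A)" using v by (auto simp: eigvals_def)
  then have "- l \<le> lam_max d (mmul d' (mtrans A) A)"
    unfolding lam_max_def by (intro Max_ge finite_eigvals_gram)
  then have "- l * (norm x)\<^sup>2 \<le> lam_max d (mmul d' (mtrans A) A) * (norm x)\<^sup>2"
    by (intro mult_right_mono) auto
  moreover have "(norm (matvec d' d A x))\<^sup>2 \<le> - l * (norm x)\<^sup>2"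
    using low[OF x] gram_inner[OF x x, of d' A] by (simp add: power2_norm_eq_inner)
  ultimately show ?thesis by simp
qed

lemma norm_matvec_le:
  assumes "lam_max d (mmul d' (mtrans A) A) \<le> L\<^sup>2" "0 \<le> L" "x \<in> Rn d"
  shows "norm (matvec d' d A x) \<le> L * norm x"
proof -
  have "(norm (matvec d' d A x))\<^sup>2 \<le> L\<^sup>2 * (norm x)\<^sup>2"
    using lam_max_bound[OF assms(3)] assms(1) by (meson mult_right_mono order_trans zero_le_power2)
  then show ?thesis using assms(2) by (metis mult_nonneg_nonneg norm_ge_zero power2_le_imp_le power_mult_distrib)
qed

text \<open>
  A matrix and its transpose have the same operator norm: \<open>\<parallel>A\<^sup>T y\<parallel>\<^sup>2 = \<langle>y, A A\<^sup>T y\<rangle> \<le> \<parallel>y\<parallel> L \<parallel>A\<^sup>T y\<parallel>\<close>.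
\<close>

lemma norm_matvec_trans_le:
  assumes "lam_max d (mmul d' (mtrans A) A) \<le> L\<^sup>2" "0 \<le> L" "y \<in> Rn d'"
  shows "norm (matvec d d' (mtrans A) y) \<le> L * norm y"
proof -
  let ?x = "matvec d d' (mtrans A) y"
  have "(norm ?x)\<^sup>2 = y \<bullet> matvec d' d A ?x"
    unfolding power2_norm_eq_inner using matvec_adjoint[OF matvec_in_Rn assms(3)] by metis
  also have "\<dots> \<le> norm y * norm (matvec d' d A ?x)" by (rule norm_cauchy_schwarz)
  also have "\<dots> \<le> norm y * (L * norm ?x)"
    by (intro mult_left_mono norm_matvec_le[OF assms(1,2)] matvec_in_Rn) auto
  finally have "norm ?x * norm ?x \<le> (L * norm y) * norm ?x" by (simp add: power2_eq_square mult_ac)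
  then show ?thesis using assms(2) by (cases "norm ?x = 0") (auto simp: mult_le_cancel_right)
qed

text \<open>
  The trivial space when the range condition is not invoked: in both cases the spectral bound then holds on the
  orthogonal complement of this space.
\<close>

definition invariant_kernel :: "bool \<Rightarrow> nat \<Rightarrow> nat \<Rightarrow> mat_fun \<Rightarrow> fvec set"
  where "invariant_kernel invoked d d' A = (if invoked then mker d' d A else {0})"

text \<open>
  The least eigenvalue of the Gram matrix on the orthogonal complement \<open>S\<close> of the kernel bounds the
  quadratic form there. It is positive when the range condition is invoked, as \<open>S\<close> meets the
  kernel only in \<open>0\<close>, so it is then bounded below by the smallest positive eigenvalue.
\<close>

lemma coupling_lower_bound:
  assumes bound: "coupling_bound invoked d d' X f A \<mu>" and x: "x \<in> Rn d"
    and orth: "\<And>k. k \<in> invariant_kernel invoked d d' A \<Longrightarrow> x \<bullet> k = 0"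
  shows "\<mu>\<^sup>2 * (norm x)\<^sup>2 \<le> (norm (matvec d' d A x))\<^sup>2"
proof (cases "x = 0")
  case False
  let ?M = "mmul d' (mtrans A) A"
  let ?G = "matvec d d ?M"
  define S where "S = {x \<in> Rn d. \<forall>k\<in>invariant_kernel invoked d d' A. x \<bullet> k = 0}"
  have ker: "k \<in> Rn d \<and> matvec d' d A k = 0" if "k \<in> invariant_kernel invoked d d' A" for k
    using that subspace_0[OF subspace_Rn] linear_0[OF linear_matvec]
    by (auto simp: invariant_kernel_def mker_def split: if_splits)
  have xS: "x \<in> S" using x orth by (simp add: S_def)
  have "subspace S"
    unfolding subspace_def S_def using subspace_Rn[of d] by (auto simp: subspace_def inner_simps)
  moreover have "closed S"
  proof -
    have "S = Rn d \<inter> (\<Inter>k\<in>invariant_kernel invoked d d' A. {x. x \<bullet> k = 0})" by (auto simp: S_def)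
    then show ?thesis by (auto intro!: closed_Int closed_Rn closed_INT closed_Collect_eq continuous_intros)
  qed
  moreover have "S \<subseteq> Rn d" by (auto simp: S_def)
  ultimately obtain v l where v: "v \<in> S" "v \<noteq> 0" "?G v = l *\<^sub>R v"
    and low: "\<And>x. x \<in> S \<Longrightarrow> l * (norm x)\<^sup>2 \<le> ?G x \<bullet> x"
  proof (rule minimal_eigenvector[OF _ _ _ xS False linear_matvec continuous_matvec])
    show "?G x \<in> S" if "x \<in> S" for x
      using that ker gram_inner[of x d _ d' A] by (auto simp: S_def matvec_in_Rn)
    show "?G x \<bullet> y = x \<bullet> ?G y" if "x \<in> S" "y \<in> S" for x y
      using that gram_inner[of x d y d' A] gram_inner[of y d x d' A] by (auto simp: S_def inner_commute)
  qed blast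
  have vR: "v \<in> Rn d" using v(1) by (simp add: S_def)
  have eig: "l \<in> eigvals d ?M" using v vR by (auto simp: eigvals_def)
  have "\<mu>\<^sup>2 \<le> l"
  proof (cases invoked)
    case True
    have lv: "l * (norm v)\<^sup>2 = (norm (matvec d' d A v))\<^sup>2"
      using gram_inner[OF vR vR, of d' A] v(3) by (simp add: power2_norm_eq_inner)
    have "matvec d' d A v \<noteq> 0"
    proof
      assume "matvec d' d A v = 0"
      then have "v \<in> invariant_kernel invoked d d' A" using True vR by (simp add: invariant_kernel_def mker_def)
      then have "v \<bullet> v = 0" using v(1) by (simp add: S_def)
      then show False using v(2) by simp
    qed
    then have "0 < l * (norm v)\<^sup>2" unfolding lv by simp
    then have "0 < l" using v(2) by (simp add: zero_less_mult_iff)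
    then have "lam_min_pos d ?M \<le> l"
      unfolding lam_min_pos_def using eig finite_eigvals_gram[of d d' A] by (auto intro!: Min_le)
    then show ?thesis using bound True by (simp add: coupling_bound_def)
  next
    case False
    have "lam_min d ?M \<le> l" unfolding lam_min_def by (intro Min_le finite_eigvals_gram eig)
    then show ?thesis using bound False by (simp add: coupling_bound_def)
  qed
  then have "\<mu>\<^sup>2 * (norm x)\<^sup>2 \<le> l * (norm x)\<^sup>2" by (intro mult_right_mono) auto
  also have "\<dots> \<le> ?G x \<bullet> x" by (rule low[OF xS])
  also have "\<dots> = (norm (matvec d' d A x))\<^sup>2" using gram_inner[OF x x] by (simp add: power2_norm_eq_inner)
  finally show ?thesis .
qed simp

section \<open>Convex functions with Hoelder subgradients\<close>

text \<open>
  Comparison with the integral of \<open>x powr \<nu>\<close>, summand by summand through the mean value theorem.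
\<close>

lemma sum_powr_le:
  assumes "0 \<le> \<nu>"
  shows "(\<Sum>i<n. real (Suc i) powr \<nu>) \<le> real (Suc n) powr (1 + \<nu>) / (1 + \<nu>)"
proof -
  have step: "real (Suc i) powr \<nu> \<le> (real (Suc (Suc i)) powr (1 + \<nu>) - real (Suc i) powr (1 + \<nu>)) / (1 + \<nu>)" for i
  proof -
    have "\<exists>z. real (Suc i) < z \<and> z < real (Suc (Suc i)) \<and>
        real (Suc (Suc i)) powr (1 + \<nu>) - real (Suc i) powr (1 + \<nu>) =
        (real (Suc (Suc i)) - real (Suc i)) * ((1 + \<nu>) * z powr (1 + \<nu> - 1))"
    proof (rule MVT2)
      show "((\<lambda>z. z powr (1 + \<nu>)) has_real_derivative (1 + \<nu>) * z powr (1 + \<nu> - 1)) (at z)"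
        if "real (Suc i) \<le> z" for z
        using that by (intro has_real_derivative_powr) auto
    qed simp
    then obtain z where z: "real (Suc i) < z" and
      eq: "real (Suc (Suc i)) powr (1 + \<nu>) - real (Suc i) powr (1 + \<nu>) = (1 + \<nu>) * z powr \<nu>" by auto
    have "real (Suc i) powr \<nu> \<le> z powr \<nu>" using z assms by (intro powr_mono2) auto
    then show ?thesis unfolding eq using assms by simp
  qed
  have "(\<Sum>i<n. real (Suc i) powr \<nu>) \<le>
      (\<Sum>i<n. (real (Suc (Suc i)) powr (1 + \<nu>) - real (Suc i) powr (1 + \<nu>)) / (1 + \<nu>))"
    by (intro sum_mono step)
  also have "\<dots> = (real (Suc n) powr (1 + \<nu>) - 1) / (1 + \<nu>)"
    unfolding sum_divide_distrib[symmetric] using sum_lessThan_telescope[of "\<lambda>i. real (Suc i) powr (1 + \<nu>)" n] by simp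
  also have "\<dots> \<le> real (Suc n) powr (1 + \<nu>) / (1 + \<nu>)" using assms by (simp add: divide_right_mono)
  finally show ?thesis .
qed

text \<open>
  For smooth \<open>f\<close> this is an integral of the gradient along the segment. Without derivatives, the segment is cut into
  \<open>n\<close> pieces and each increment is bounded by the subgradient at the end of its piece. The resulting
  Riemann sum is \<open>n powr -(1 + \<nu>)\<close> times the sum of the \<open>i powr \<nu>\<close> and yields the sharp factor \<open>1 / (1 + \<nu>)\<close> as
  \<open>n\<close> tends to infinity.
\<close>

lemma subgradient_holder_descent:
  assumes X: "convex X" "X \<subseteq> Rn d" and x: "x \<in> X" "x' \<in> X"
    and s: "\<And>z. z \<in> X \<Longrightarrow> s z \<in> subdiff d f z"
    and holder: "\<And>z. z \<in> X \<Longrightarrow> z \<noteq> x \<Longrightarrow> norm (s z - s x) \<le> H * norm (z - x) powr \<nu>"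
    and \<nu>: "0 \<le> \<nu>" and H: "0 \<le> H"
  shows "f x' \<le> f x + s x \<bullet> (x' - x) + H / (1 + \<nu>) * norm (x' - x) powr (1 + \<nu>)"
proof (cases "x' = x")
  case False
  define h where "h = x' - x"
  have h: "0 < norm h" using False by (simp add: h_def)
  have bound: "f x' - f x - s x \<bullet> h \<le> H * norm h powr (1 + \<nu>) / (1 + \<nu>) * (real (Suc n) / real n) powr (1 + \<nu>)"
    if n: "0 < n" for n
  proof -
    define z where "z = (\<lambda>i. x + (real i / real n) *\<^sub>R h)"
    have zX: "z i \<in> X" if "i \<le> n" for i
    proof -
      have "(1 - real i / real n) *\<^sub>R x + (real i / real n) *\<^sub>R x' \<in> X"
        using X(1) x that n by (intro convexD) auto
      moreover have "(1 - real i / real n) *\<^sub>R x + (real i / real n) *\<^sub>R x' = z i"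
        by (simp add: z_def h_def algebra_simps)
      ultimately show ?thesis by simp
    qed
    have step: "f (z (Suc i)) - f (z i) \<le>
        (1 / real n) * (s x \<bullet> h) + H * norm h powr (1 + \<nu>) / real n powr (1 + \<nu>) * real (Suc i) powr \<nu>" if i: "i < n" for i
    proof -
      have zi: "z (Suc i) \<in> X" "z i \<in> X" using i zX by auto
      have dz: "z i - z (Suc i) = - ((1 / real n) *\<^sub>R h)"
        by (simp add: z_def scaleR_left_diff_distrib[symmetric] diff_divide_distrib[symmetric])
      have zx: "z (Suc i) - x = (real (Suc i) / real n) *\<^sub>R h" by (simp add: z_def)
      have "f (z i) \<ge> f (z (Suc i)) + s (z (Suc i)) \<bullet> (z i - z (Suc i))"
        using s[OF zi(1)] zi(2) X(2) by (auto simp: subdiff_def)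
      then have "f (z (Suc i)) - f (z i) \<le> (1 / real n) * (s (z (Suc i)) \<bullet> h)"
        unfolding dz by simp
      also have "\<dots> = (1 / real n) * (s x \<bullet> h) + (1 / real n) * ((s (z (Suc i)) - s x) \<bullet> h)"
        by (simp add: inner_diff_left algebra_simps diff_divide_distrib)
      also have "(s (z (Suc i)) - s x) \<bullet> h \<le> norm (s (z (Suc i)) - s x) * norm h"
        by (rule norm_cauchy_schwarz)
      also have "\<dots> \<le> (H * norm (z (Suc i) - x) powr \<nu>) * norm h"
      proof -
        have "z (Suc i) - x \<noteq> 0" unfolding zx using h n by simp
        then show ?thesis using holder[OF zi(1)] h by (intro mult_right_mono) auto
      qed
      also have "norm (z (Suc i) - x) powr \<nu> = real (Suc i) powr \<nu> / real n powr \<nu> * norm h powr \<nu>"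
        unfolding zx by (simp add: powr_mult powr_divide)
      finally have "f (z (Suc i)) - f (z i) \<le> (1 / real n) * (s x \<bullet> h) +
          (1 / real n) * ((H * (real (Suc i) powr \<nu> / real n powr \<nu> * norm h powr \<nu>)) * norm h)"
        using n by (simp add: divide_right_mono)
      also have "(1 / real n) * ((H * (real (Suc i) powr \<nu> / real n powr \<nu> * norm h powr \<nu>)) * norm h) =
          H * norm h powr (1 + \<nu>) / real n powr (1 + \<nu>) * real (Suc i) powr \<nu>"
        using n h by (simp add: powr_add powr_one' field_simps)
      finally show ?thesis by simp
    qed
    have "f x' - f x = (\<Sum>i<n. f (z (Suc i)) - f (z i))"
      using sum_lessThan_telescope[of "\<lambda>i. f (z i)" n] n by (simp add: z_def h_def)
    also have "\<dots> \<le> (\<Sum>i<n. (1 / real n) * (s x \<bullet> h) + H * norm h powr (1 + \<nu>) / real n powr (1 + \<nu>) * real (Suc i) powr \<nu>)"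
      using step by (intro sum_mono) auto
    also have "\<dots> = s x \<bullet> h + H * norm h powr (1 + \<nu>) / real n powr (1 + \<nu>) * (\<Sum>i<n. real (Suc i) powr \<nu>)"
      using n by (simp add: sum.distrib sum_distrib_left)
    also have "H * norm h powr (1 + \<nu>) / real n powr (1 + \<nu>) * (\<Sum>i<n. real (Suc i) powr \<nu>) \<le>
        H * norm h powr (1 + \<nu>) / real n powr (1 + \<nu>) * (real (Suc n) powr (1 + \<nu>) / (1 + \<nu>))"
      using H by (intro mult_left_mono sum_powr_le \<nu>) auto
    also have "\<dots> = H * norm h powr (1 + \<nu>) / (1 + \<nu>) * (real (Suc n) / real n) powr (1 + \<nu>)"
      by (simp add: powr_divide)
    finally show ?thesis by simp
  qed
  have "(\<lambda>n. real (Suc n) / real n) \<longlonglongrightarrow> 1" by (rule LIMSEQ_Suc_n_over_n)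
  then have "(\<lambda>n. (real (Suc n) / real n) powr (1 + \<nu>)) \<longlonglongrightarrow> 1 powr (1 + \<nu>)"
    by (intro tendsto_powr tendsto_const) auto
  then have "(\<lambda>n. H * norm h powr (1 + \<nu>) / (1 + \<nu>) * (real (Suc n) / real n) powr (1 + \<nu>)) \<longlonglongrightarrow>
      H * norm h powr (1 + \<nu>) / (1 + \<nu>) * 1 powr (1 + \<nu>)"
    by (intro tendsto_mult tendsto_const)
  then have "f x' - f x - s x \<bullet> h \<le> H * norm h powr (1 + \<nu>) / (1 + \<nu>) * 1 powr (1 + \<nu>)"
    by (rule LIMSEQ_le_const) (use bound in \<open>auto intro!: exI[of _ 1]\<close>)
  then show ?thesis by (simp add: h_def)
qed simp

text \<open>
  Young's inequality with exponents \<open>2 / (1 + \<nu>)\<close> and \<open>2 / (1 - \<nu>)\<close> for the factors \<open>L r\<^sup>2\<close> and a constant \<open>b\<close>. The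
  constant \<open>L\<close> is defined so that \<open>b\<close> contributes exactly \<open>\<delta>\<close>.
\<close>

lemma holder_power_le_quadratic:
  assumes \<nu>: "0 \<le> \<nu>" "\<nu> < 1" and H: "0 < H" and \<delta>: "0 < \<delta>" and r: "0 \<le> r"
  shows "H / (1 + \<nu>) * r powr (1 + \<nu>) \<le> inexact_L \<nu> H \<delta> / 2 * r\<^sup>2 + \<delta>"
proof (cases "r = 0")
  case False
  define L where "L = inexact_L \<nu> H \<delta>"
  define b where "b = 2 * (1 + \<nu>) * \<delta> / (1 - \<nu>)"
  have b: "0 < b" using \<nu> \<delta> by (simp add: b_def)
  have L: "L = (1 / b) powr ((1 - \<nu>) / (1 + \<nu>)) * H powr (2 / (1 + \<nu>))"
    using \<nu> by (simp add: L_def inexact_L_def b_def)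
  have Lpos: "0 < L" unfolding L using b H by simp
  have "L powr ((1 + \<nu>) / 2) = (1 / b) powr ((1 - \<nu>) / 2) * H"
  proof -
    have "(1 - \<nu>) / (1 + \<nu>) * ((1 + \<nu>) / 2) = (1 - \<nu>) / 2" "2 / (1 + \<nu>) * ((1 + \<nu>) / 2) = 1"
      using \<nu> by simp_all
    then show ?thesis unfolding L using H b by (simp only: powr_mult powr_powr) simp
  qed
  then have Lb: "L powr ((1 + \<nu>) / 2) * b powr ((1 - \<nu>) / 2) = H"
    using b by (simp add: powr_divide)
  have "(L * r\<^sup>2) powr ((1 + \<nu>) / 2) * b powr ((1 - \<nu>) / 2) \<le> (1 + \<nu>) / 2 * (L * r\<^sup>2) + (1 - \<nu>) / 2 * b"
    using \<nu> Lpos False b by (intro Youngs_inequality_0) (auto simp: field_simps)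
  moreover have "(L * r\<^sup>2) powr ((1 + \<nu>) / 2) = L powr ((1 + \<nu>) / 2) * r powr (1 + \<nu>)"
  proof -
    have "(r\<^sup>2) powr ((1 + \<nu>) / 2) = (r powr 2) powr ((1 + \<nu>) / 2)" using r by (simp add: powr_numeral)
    also have "\<dots> = r powr (1 + \<nu>)" unfolding powr_powr by (simp add: add_divide_distrib)
    finally show ?thesis using Lpos by (simp add: powr_mult)
  qed
  moreover have "L powr ((1 + \<nu>) / 2) * r powr (1 + \<nu>) * b powr ((1 - \<nu>) / 2) = H * r powr (1 + \<nu>)"
    unfolding Lb[symmetric] by (simp add: mult_ac)
  ultimately have "H * r powr (1 + \<nu>) \<le> (1 + \<nu>) / 2 * (L * r\<^sup>2) + (1 - \<nu>) / 2 * b" by simp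
  also have "(1 - \<nu>) / 2 * b = (1 + \<nu>) * \<delta>" using \<nu> by (simp add: b_def field_simps)
  finally have "H * r powr (1 + \<nu>) \<le> (1 + \<nu>) * (L / 2 * r\<^sup>2 + \<delta>)" by (simp add: algebra_simps)
  then show ?thesis unfolding L_def[symmetric] using \<nu> by (simp add: divide_le_eq mult.commute)
qed (use \<delta> in simp)

lemma inexact_L_pos:
  assumes "0 \<le> \<nu>" "\<nu> \<le> 1" "0 < H" "\<nu> < 1 \<Longrightarrow> 0 < \<delta>"
  shows "0 < inexact_L \<nu> H \<delta>"
  using assms by (auto simp: inexact_L_def)

lemma holder_class_upper_model:
  assumes holder_f: "holder_class d X f \<mu> \<nu> H" and X: "convex X" "X \<subseteq> Rn d"
    and s: "\<And>z. z \<in> X \<Longrightarrow> s z \<in> subdiff d f z" and \<delta>: "\<nu> < 1 \<Longrightarrow> 0 < \<delta>" "0 \<le> \<delta>"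
    and x: "x \<in> X" "x' \<in> X"
  shows "f x' \<le> f x + s x \<bullet> (x' - x) + inexact_L \<nu> H \<delta> / 2 * (norm (x' - x))\<^sup>2 + \<delta>"
proof -
  have \<nu>: "0 \<le> \<nu>" "\<nu> \<le> 1" and H: "0 < H"
    and holder: "\<And>x x' s s'. x \<in> X \<Longrightarrow> x' \<in> X \<Longrightarrow> s \<in> subdiff d f x \<Longrightarrow> s' \<in> subdiff d f x' \<Longrightarrow>
      norm (s - s') \<le> (if \<nu> = 0 then H else H * norm (x - x') powr \<nu>)"
    using holder_f by (auto simp: holder_class_def)
  have "norm (s z - s x) \<le> H * norm (z - x) powr \<nu>" if "z \<in> X" "z \<noteq> x" for z
    using holder[OF that(1) x(1) s[OF that(1)] s[OF x(1)]] that(2) by (auto split: if_splits)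
  then have "f x' \<le> f x + s x \<bullet> (x' - x) + H / (1 + \<nu>) * norm (x' - x) powr (1 + \<nu>)"
    using subgradient_holder_descent[OF X x s] \<nu> H by (simp add: less_imp_le)
  also have "H / (1 + \<nu>) * norm (x' - x) powr (1 + \<nu>) \<le> inexact_L \<nu> H \<delta> / 2 * (norm (x' - x))\<^sup>2 + \<delta>"
  proof (cases "\<nu> < 1")
    case True
    then show ?thesis using \<nu> H \<delta> by (intro holder_power_le_quadratic) auto
  next
    case False
    then have "\<nu> = 1" using \<nu> by simp
    then show ?thesis using \<delta> by (simp add: inexact_L_def powr_numeral)
  qed
  finally show ?thesis by simp
qed

text \<open>
  Difference quotients of a convex function decrease to the directional derivative, which gives the
  subgradient inequality. Conversely, testing a subgradient \<open>s\<close> in the direction \<open>s - G\<close> forces \<open>s = G\<close>.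
\<close>

lemma convex_gradient_subdiff:
  assumes conv: "convex_on (Rn d) f" and x: "x \<in> Rn d" and G: "G \<in> Rn d"
    and deriv: "(f has_derivative (\<lambda>h. G \<bullet> h)) (at x within Rn d)"
  shows "subdiff d f x = {G}"
proof -
  have slope: "((\<lambda>t. (f (x + t *\<^sub>R h) - f x) / t) \<longlongrightarrow> G \<bullet> h) (at_right 0)" if h: "h \<in> Rn d" for h
  proof -
    have "((\<lambda>t. x + t *\<^sub>R h) has_derivative (\<lambda>t. t *\<^sub>R h)) (at 0 within {0<..})"
      by (auto intro!: derivative_eq_intros)
    moreover have "(\<lambda>t. x + t *\<^sub>R h) ` {0<..} \<subseteq> Rn d"
      using x h by (auto intro!: subspace_add subspace_scale subspace_Rn)
    then have "(f has_derivative (\<lambda>h. G \<bullet> h)) (at (x + 0 *\<^sub>R h) within (\<lambda>t. x + t *\<^sub>R h) ` {0<..})"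
      using deriv has_derivative_subset by auto
    ultimately have "((\<lambda>t. f (x + t *\<^sub>R h)) has_derivative (\<lambda>t. G \<bullet> (t *\<^sub>R h))) (at 0 within {0<..})"
      using diff_chain_within[of "\<lambda>t. x + t *\<^sub>R h" "\<lambda>t. t *\<^sub>R h" 0 "{0<..}" f "\<lambda>h. G \<bullet> h"] by (simp add: o_def)
    then have "((\<lambda>t. f (x + t *\<^sub>R h)) has_real_derivative G \<bullet> h) (at 0 within {0<..})"
      unfolding has_field_derivative_def by (simp add: mult.commute[of _ "G \<bullet> h"] mult_commute_abs)
    then show ?thesis unfolding has_field_derivative_iff by simp
  qed
  have "f x' \<ge> f x + G \<bullet> (x' - x)" if x': "x' \<in> Rn d" for x'
  proof -
    have "x' - x \<in> Rn d" using x x' by (intro subspace_diff subspace_Rn)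
    moreover have "eventually (\<lambda>t. (f (x + t *\<^sub>R (x' - x)) - f x) / t \<le> f x' - f x) (at_right 0)"
      unfolding eventually_at_right_field
    proof (intro exI[of _ 1] conjI allI impI)
      fix t :: real assume t: "0 < t" "t < 1"
      have "f ((1 - t) *\<^sub>R x + t *\<^sub>R x') \<le> (1 - t) * f x + t * f x'"
        using convex_onD[OF conv, of t x x'] t x x' by simp
      moreover have "(1 - t) *\<^sub>R x + t *\<^sub>R x' = x + t *\<^sub>R (x' - x)" by (simp add: algebra_simps)
      ultimately have "f (x + t *\<^sub>R (x' - x)) - f x \<le> t * (f x' - f x)"
        by (simp only: right_diff_distrib left_diff_distrib)
      then show "(f (x + t *\<^sub>R (x' - x)) - f x) / t \<le> f x' - f x"
        using t by (simp add: divide_le_eq mult.commute)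
    qed simp
    ultimately have "G \<bullet> (x' - x) \<le> f x' - f x"
      using slope by (intro tendsto_upperbound[of _ _ "at_right 0"]) auto
    then show ?thesis by simp
  qed
  moreover have "s = G" if s: "s \<in> subdiff d f x" for s
  proof -
    have h: "s - G \<in> Rn d" using s G by (auto simp: subdiff_def intro!: subspace_diff subspace_Rn)
    have "eventually (\<lambda>t. s \<bullet> (s - G) \<le> (f (x + t *\<^sub>R (s - G)) - f x) / t) (at_right 0)"
      unfolding eventually_at_right_field
    proof (intro exI[of _ 1] conjI allI impI)
      fix t :: real assume t: "0 < t" "t < 1"
      have "x + t *\<^sub>R (s - G) \<in> Rn d" using x h by (intro subspace_add subspace_scale subspace_Rn)
      then have "f (x + t *\<^sub>R (s - G)) \<ge> f x + s \<bullet> (x + t *\<^sub>R (s - G) - x)"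
        using s unfolding subdiff_def by blast
      then show "s \<bullet> (s - G) \<le> (f (x + t *\<^sub>R (s - G)) - f x) / t" using t by (simp add: le_divide_eq mult.commute)
    qed simp
    then have "s \<bullet> (s - G) \<le> G \<bullet> (s - G)" using slope[OF h] by (intro tendsto_lowerbound[of _ _ "at_right 0"]) auto
    then have "(s - G) \<bullet> (s - G) \<le> 0" by (simp add: inner_diff_left)
    then show ?thesis by (metis eq_iff_diff_eq_0 inner_eq_zero_iff inner_ge_zero order_antisym)
  qed
  ultimately show ?thesis using G by (auto simp: subdiff_def)
qed

text \<open>
  The function \<open>f - \<langle>s0, \<cdot>\<rangle>\<close> is minimal at \<open>x0\<close>, and a gradient step of length \<open>1/H\<close> from \<open>x\<close> decreases it
  by at least \<open>\<parallel>s - s0\<parallel>\<^sup>2 / (2 H)\<close>. The step may leave any convex set that contains \<open>x\<close> and \<open>x0\<close>, which is why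
  smoothness is needed on the whole space.
\<close>

lemma gradient_cocoercive:
  assumes conv: "convex_on (Rn d) f" and smooth: "ambient_smooth d f H" and H: "0 < H"
    and x: "x \<in> Rn d" "x0 \<in> Rn d" and s: "s \<in> subdiff d f x" "s0 \<in> subdiff d f x0"
  shows "(norm (s - s0))\<^sup>2 \<le> 2 * H * bregman f s0 x x0"
proof -
  obtain G where G: "\<And>z. z \<in> Rn d \<Longrightarrow> G z \<in> Rn d \<and> (f has_derivative (\<lambda>h. G z \<bullet> h)) (at z within Rn d)"
    and lip: "lipschitz_on H (Rn d) G" using smooth unfolding ambient_smooth_def by blast
  have sub: "subdiff d f z = {G z}" if "z \<in> Rn d" for z
    using convex_gradient_subdiff[OF conv that] G[OF that] by blast
  have sG: "s = G x" "s0 = G x0" using s sub x by auto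
  define y where "y = x - (1 / H) *\<^sub>R (s - s0)"
  have y: "y \<in> Rn d"
    unfolding y_def sG using x G by (intro subspace_diff subspace_scale subspace_Rn) auto
  have yx: "y - x = - ((1 / H) *\<^sub>R (s - s0))" by (simp add: y_def)
  have "f y \<le> f x + G x \<bullet> (y - x) + H / (1 + 1) * norm (y - x) powr (1 + 1)"
  proof (rule subgradient_holder_descent[of "Rn d" d])
    show "convex (Rn d)" by (rule subspace_imp_convex[OF subspace_Rn])
    show "norm (G z - G x) \<le> H * norm (z - x) powr 1" if "z \<in> Rn d" "z \<noteq> x" for z
      using lipschitz_onD[OF lip that(1) x(1)] that(2) by (simp add: dist_norm)
  qed (use x y sub H in auto)
  then have "f y \<le> f x + s \<bullet> (y - x) + H / 2 * (norm (y - x))\<^sup>2"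
    by (simp add: sG powr_numeral)
  also have "(norm (y - x))\<^sup>2 = (norm (s - s0))\<^sup>2 / H\<^sup>2"
    unfolding yx using H by (simp add: power_divide power_mult_distrib)
  finally have up: "f y \<le> f x - (1 / H) * (s \<bullet> (s - s0)) + (norm (s - s0))\<^sup>2 / (2 * H)"
    unfolding yx using H by (simp add: power2_eq_square)
  have "f y \<ge> f x0 + s0 \<bullet> (y - x0)" using s(2) y by (simp add: subdiff_def)
  also have "s0 \<bullet> (y - x0) = s0 \<bullet> (x - x0) - (1 / H) * (s0 \<bullet> (s - s0))"
    by (simp add: y_def inner_simps algebra_simps)
  finally have "(1 / H) * (s \<bullet> (s - s0)) - (1 / H) * (s0 \<bullet> (s - s0)) \<le> bregman f s0 x x0 + (norm (s - s0))\<^sup>2 / (2 * H)"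
    using up by (simp add: bregman_def)
  moreover have "(1 / H) * (s \<bullet> (s - s0)) - (1 / H) * (s0 \<bullet> (s - s0)) = (norm (s - s0))\<^sup>2 / H"
    unfolding power2_norm_eq_inner by (simp add: inner_diff_left diff_divide_distrib)
  ultimately show ?thesis using H by (simp add: field_simps)
qed

section \<open>Rates and loop lengths\<close>

text \<open>
  With \<open>P\<close> evaluations the admissible tolerance is of order \<open>\<Omega> / P\<close>, so the smoothness constant is of order
  \<open>P powr a\<close> with \<open>a = (1 - \<nu>) / (1 + \<nu>)\<close>. The remaining factor is \<open>x powr (2 - a)\<close> for the Hoelder rate \<open>x\<close>, and
  \<open>P \<ge> K x\<close> leaves the square of \<open>P\<close> divided by \<open>K powr (2 - a) \<ge> K\<close>.
\<close>

lemma holder_rate_suffices: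
  assumes \<nu>: "0 \<le> \<nu>" "\<nu> \<le> 1" and pos: "0 < H" "0 < \<delta>" "0 < \<Omega>" "1 \<le> K"
    and P: "K * rate_holder \<nu> H \<delta> \<Omega> \<le> P"
  defines "tol \<equiv> (if \<nu> < 1 then \<Omega> / (384 * P) else 0)"
  shows "inexact_L \<nu> H tol / \<delta> \<le> 192 / K * P\<^sup>2"
proof -
  define Ht where "Ht = H * \<delta> powr (- (1 + \<nu>) / 2)"
  define x where "x = Ht powr (2 / (1 + 3 * \<nu>)) * \<Omega> powr ((\<nu> - 1) / (1 + 3 * \<nu>))"
  have R: "rate_holder \<nu> H \<delta> \<Omega> = max x 1" by (simp add: rate_holder_def Ht_def x_def Let_def)
  have Ht: "0 < Ht" using pos by (simp add: Ht_def)
  have x0: "0 < x" using Ht pos by (simp add: x_def)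
  have "K * x \<le> K * max x 1" "K * 1 \<le> K * max x 1" using pos by (auto intro!: mult_left_mono)
  then have Kx: "K * x \<le> P" and KP: "K \<le> P" using P R by auto
  have P0: "0 < P" using KP pos by simp
  have xP: "x \<le> P / K" using Kx pos by (simp add: field_simps)
  have Ht_powr: "Ht powr (2 / (1 + \<nu>)) = H powr (2 / (1 + \<nu>)) / \<delta>"
  proof -
    have "- (1 + \<nu>) / 2 * (2 / (1 + \<nu>)) = - 1" using \<nu> by (simp add: field_simps)
    then have "(\<delta> powr (- (1 + \<nu>) / 2)) powr (2 / (1 + \<nu>)) = 1 / \<delta>"
      using pos by (simp only: powr_powr) (simp add: powr_minus_divide)
    then show ?thesis unfolding Ht_def using pos by (simp add: powr_mult)
  qed
  show ?thesis
  proof (cases "\<nu> < 1")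
    case True
    define a where "a = (1 - \<nu>) / (1 + \<nu>)"
    define b where "b = (1 + 3 * \<nu>) / (1 + \<nu>)"
    have a: "0 \<le> a" "a \<le> 1" and b: "1 \<le> b" using \<nu> by (auto simp: a_def b_def field_simps)
    have ab: "a + b = 2" using \<nu> by (simp add: a_def b_def add_divide_distrib[symmetric] divide_eq_eq)
    have x_powr: "x powr b = H powr (2 / (1 + \<nu>)) / \<delta> * \<Omega> powr (- a)"
    proof -
      have "2 / (1 + 3 * \<nu>) * b = 2 / (1 + \<nu>)" "(\<nu> - 1) / (1 + 3 * \<nu>) * b = - a"
      proof -
        have "c / u * (u / w) = c / w" if "u \<noteq> 0" for c u w :: real using that by simp
        moreover have "1 + 3 * \<nu> \<noteq> 0" using \<nu> by simp
        ultimately show "2 / (1 + 3 * \<nu>) * b = 2 / (1 + \<nu>)" "(\<nu> - 1) / (1 + 3 * \<nu>) * b = - a"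
          unfolding a_def b_def by (simp_all only: minus_divide_left minus_diff_eq)
      qed
      then show ?thesis unfolding x_def using Ht pos Ht_powr by (simp add: powr_mult powr_powr)
    qed
    have base: "(1 - \<nu>) / (2 * (1 + \<nu>) * tol) = a * 192 * (P / \<Omega>)"
    proof -
      have "2 * tol = \<Omega> / (192 * P)" using True by (simp add: tol_def)
      then have "2 * (1 + \<nu>) * tol = (1 + \<nu>) * (\<Omega> / (192 * P))" by (metis mult.assoc mult.commute)
      then show ?thesis using P0 pos \<nu> by (simp add: a_def)
    qed
    have "(a * 192 * (P / \<Omega>)) powr a \<le> (192 * (P / \<Omega>)) powr a"
      using a P0 pos by (intro powr_mono2 mult_right_mono) auto
    also have "\<dots> = 192 powr a * P powr a * \<Omega> powr (- a)"
      using P0 pos by (simp add: powr_mult powr_divide powr_minus_divide)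
    also have "\<dots> \<le> 192 powr 1 * P powr a * \<Omega> powr (- a)"
      using a by (intro mult_right_mono powr_mono) auto
    finally have "(a * 192 * (P / \<Omega>)) powr a * (H powr (2 / (1 + \<nu>)) / \<delta>) \<le>
        192 * P powr a * \<Omega> powr (- a) * (H powr (2 / (1 + \<nu>)) / \<delta>)"
      using pos by (intro mult_right_mono) auto
    then have "inexact_L \<nu> H tol / \<delta> \<le> 192 * P powr a * x powr b"
      unfolding inexact_L_def base a_def[symmetric] x_powr using True by (simp add: mult_ac)
    also have "\<dots> \<le> 192 * P powr a * (P / K) powr b"
      using xP x0 b by (intro mult_left_mono powr_mono2) auto
    also have "\<dots> = 192 * P powr (a + b) / K powr b" using P0 pos by (simp add: powr_divide powr_add)
    also have "\<dots> \<le> 192 * P powr (a + b) / K"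
    proof -
      have "K powr 1 \<le> K powr b" using b pos by (intro powr_mono) auto
      then show ?thesis using pos by (intro divide_left_mono) auto
    qed
    finally show ?thesis using P0 by (simp add: ab powr_numeral)
  next
    case False
    then have \<nu>1: "\<nu> = 1" using \<nu> by simp
    have "H / \<delta> = Ht" using Ht_powr Ht pos by (simp add: \<nu>1)
    also have "\<dots> = x\<^sup>2"
    proof -
      have "x\<^sup>2 = x powr 2" using x0 by (simp add: powr_numeral)
      also have "\<dots> = Ht" unfolding x_def \<nu>1 using Ht pos by (simp add: powr_powr)
      finally show ?thesis by simp
    qed
    also have "\<dots> \<le> (P / K)\<^sup>2" using xP x0 by (intro power_mono) auto
    also have "\<dots> = P\<^sup>2 / K * (1 / K)" by (simp add: power2_eq_square)
    also have "\<dots> \<le> P\<^sup>2 / K * 192" using pos by (intro mult_left_mono) (auto simp: divide_le_eq)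
    finally show ?thesis by (simp add: inexact_L_def \<nu>1 mult.commute)
  qed
qed

lemma next_factor:
  assumes "0 < P" "0 \<le> r"
  shows "\<exists>t. 0 < t \<and> r \<le> real (P * t) \<and> real (P * t) \<le> r + real P"
proof -
  have "0 \<le> r / real P" using assms by simp
  then have "real (nat \<lfloor>r / real P\<rfloor>) \<le> r / real P \<and> r / real P \<le> real (nat \<lfloor>r / real P\<rfloor>) + 1" by linarith
  then obtain q where "real q \<le> r / real P" "r / real P \<le> real q + 1" by blast
  then have "real q * real P \<le> r" "r \<le> (real q + 1) * real P" using assms by (simp_all add: field_simps)
  then show ?thesis by (intro exI[of _ "Suc q"]) (simp add: algebra_simps)
qed

text \<open>
  Each loop length is the least one for which the product of the lengths so far reaches its target, up to rounding.
  The overshoot is at most the previous product, which the ordering of the rates keeps below a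
  multiple of the current rate.
\<close>

lemma nested_loop_lengths:
  fixes r :: "nat \<Rightarrow> real"
  assumes K: "1 \<le> K" and r: "1 \<le> r 1" "r 1 \<le> r 2" "r 2 \<le> r 3"
  obtains T :: "nat \<Rightarrow> nat" where "\<And>i. 0 < T i"
    "\<And>i. i \<in> {1, 2, 3} \<Longrightarrow> K * r i \<le> real (\<Prod>l\<in>{0<..i}. T l)"
    "\<And>i. i \<in> {1, 2, 3} \<Longrightarrow> real (\<Prod>l\<in>{0<..i}. T l) \<le> (3 * K + 1) * r i"
proof -
  have Kr: "0 \<le> K * r 1" "0 \<le> K * r 2" "0 \<le> K * r 3" "K * r 1 \<le> K * r 2" "K * r 2 \<le> K * r 3" using K r by auto
  obtain a where a: "0 < a" "K * r 1 \<le> real (1 * a)" "real (1 * a) \<le> K * r 1 + real 1"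
    using next_factor[OF zero_less_one Kr(1)] by blast
  obtain b where b: "0 < b" "K * r 2 \<le> real (a * b)" "real (a * b) \<le> K * r 2 + real a"
    using next_factor[OF a(1) Kr(2)] by blast
  obtain c where c: "0 < c" "K * r 3 \<le> real (a * b * c)" "real (a * b * c) \<le> K * r 3 + real (a * b)"
    using next_factor[OF mult_pos_pos[OF a(1) b(1)] Kr(3)] by blast
  define T where "T = (\<lambda>i::nat. if i = 1 then a else if i = 2 then b else c)"
  have "{0<..1} = {1::nat}" "{0<..2} = {1, 2::nat}" "{0<..3} = {1, 2, 3::nat}" by auto
  then have P: "(\<Prod>l\<in>{0<..1}. T l) = a" "(\<Prod>l\<in>{0<..2}. T l) = a * b" "(\<Prod>l\<in>{0<..3}. T l) = a * b * c"
    by (simp_all add: T_def)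
  show ?thesis
  proof (rule that[of T])
    show "0 < T i" for i using a b c by (simp add: T_def)
    fix i assume "i \<in> {1, 2, 3::nat}"
    then consider "i = 1" | "i = 2" | "i = 3" by blast
    then have "K * r i \<le> real (\<Prod>l\<in>{0<..i}. T l) \<and> real (\<Prod>l\<in>{0<..i}. T l) \<le> (3 * K + 1) * r i"
    proof cases
      case 1
      then show ?thesis unfolding 1 P distrib_right using a r Kr by auto
    next
      case 2
      then show ?thesis unfolding 2 P distrib_right using a b r Kr by auto
    next
      case 3
      then show ?thesis unfolding 3 P distrib_right using a b c r Kr by auto
    qed
    then show "K * r i \<le> real (\<Prod>l\<in>{0<..i}. T l)" "real (\<Prod>l\<in>{0<..i}. T l) \<le> (3 * K + 1) * r i" by auto
  qed
qed

section \<open>Kernel directions and regularisers\<close>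

lemma pnorm2_eq: "pnorm2 \<delta>x \<delta>y z = \<delta>x * (norm (fst z))\<^sup>2 + \<delta>y * (norm (snd z))\<^sup>2"
  by (cases z) (simp add: pnorm2_def power2_norm_eq_inner)

lemma invariant_kernel_iff:
  "k \<in> invariant_kernel invoked d d' A \<Longrightarrow> k \<in> Rn d \<and> matvec d' d A k = 0"
  using subspace_0[OF subspace_Rn] linear_0[OF linear_matvec]
  by (auto simp: invariant_kernel_def mker_def split: if_splits)

lemma zero_in_invariant_kernel: "0 \<in> invariant_kernel invoked d d' A"
  using subspace_0[OF subspace_Rn] linear_0[OF linear_matvec] by (auto simp: invariant_kernel_def mker_def)

lemma uminus_invariant_kernel:
  "k \<in> invariant_kernel invoked d d' A \<Longrightarrow> - k \<in> invariant_kernel invoked d d' A"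
  using subspace_neg[OF subspace_Rn] linear_neg[OF linear_matvec]
  by (auto simp: invariant_kernel_def mker_def split: if_splits)

lemma mrange_orthogonal_kernel:
  assumes "v \<in> mrange d d' (mtrans A)" "k \<in> Rn d" "matvec d' d A k = 0"
  shows "v \<bullet> k = 0"
proof -
  obtain w where w: "w \<in> Rn d'" "v = matvec d d' (mtrans A) w" using assms(1) by (auto simp: mrange_def)
  then show ?thesis using matvec_adjoint[OF assms(2) w(1), of A] assms(3) by simp
qed

lemma coupling_shift:
  assumes "coupling_bound invoked d d' X f A \<mu>" "x \<in> X" "k \<in> invariant_kernel invoked d d' A"
  shows "x + k \<in> X"
proof (cases invoked)
  case True
  then have "x + k \<in> {x + v |x v. x \<in> X \<and> v \<in> mker d' d A}"
    using assms(2,3) by (auto simp: invariant_kernel_def)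
  also have "{x + v |x v. x \<in> X \<and> v \<in> mker d' d A} = X" using assms(1) True unfolding coupling_bound_def by simp
  finally show ?thesis .
qed (use assms in \<open>simp add: invariant_kernel_def\<close>)

text \<open>
  When the range condition is invoked, subgradients lie in the range of the transpose, which is
  orthogonal to the kernel.
\<close>

lemma coupling_subgradient:
  assumes "coupling_bound invoked d d' X f A \<mu>" "x \<in> X" "s \<in> subdiff d f x"
    "k \<in> invariant_kernel invoked d d' A"
  shows "s \<bullet> k = 0"
proof (cases invoked)
  case True
  then have "s \<in> mrange d d' (mtrans A)" using assms(1-3) by (auto simp: coupling_bound_def)
  then show ?thesis using mrange_orthogonal_kernel invariant_kernel_iff[OF assms(4)] by blast
qed (use assms in \<open>simp add: invariant_kernel_def\<close>)

lemma bregman_ge_quadratic: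
  assumes "holder_class d X f \<mu> \<nu> H" "x0 \<in> X" "x \<in> X" "s \<in> subdiff d f x0"
  shows "\<mu> / 2 * (norm (x - x0))\<^sup>2 \<le> bregman f s x x0"
  using assms unfolding holder_class_def bregman_def by fastforce

lemma bregman_nonneg:
  assumes "holder_class d X f \<mu> \<nu> H" "x0 \<in> X" "x \<in> X" "s \<in> subdiff d f x0"
  shows "0 \<le> bregman f s x x0"
proof -
  have "0 \<le> \<mu> / 2 * (norm (x - x0))\<^sup>2" using assms(1) by (simp add: holder_class_def)
  then show ?thesis using bregman_ge_quadratic[OF assms] by linarith
qed

text \<open>
  The difference of the two sides is half of \<open>\<parallel>a + 2 b\<parallel>\<^sup>2\<close>.
\<close>

lemma norm_shift_lower:
  fixes a b :: "'a::real_inner"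
  shows "(norm a)\<^sup>2 / 2 - 2 * (norm b)\<^sup>2 \<le> (norm (a + b))\<^sup>2 - (norm b)\<^sup>2"
proof -
  have "(norm (a + b))\<^sup>2 - (norm b)\<^sup>2 - ((norm a)\<^sup>2 / 2 - 2 * (norm b)\<^sup>2) = (norm (a + 2 *\<^sub>R b))\<^sup>2 / 2"
    unfolding power2_norm_eq_inner by (simp add: inner_simps inner_commute algebra_simps)
  moreover have "0 \<le> (norm (a + 2 *\<^sub>R b))\<^sup>2 / 2" by simp
  ultimately show ?thesis by linarith
qed

text \<open>
  In use, \<open>a = B (x - x*)\<close>, and \<open>gs\<close> equals \<open>B x*\<close>, so the right-hand side is the increment of
  one of the two terms of \<open>p\<^sub>3\<close> between the saddle point and the current point; the other term is the same up to
  a sign. The regularisation weight \<open>1/(4 H)\<close>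
  is such that cocoercivity bounds the loss by half of the initial Bregman divergence.
\<close>

lemma regularizer_lower_bound:
  fixes a r :: fvec
  assumes hg: "holder_class d Y g \<mu> \<nu> H" and Y: "Y \<subseteq> Rn d" "yin \<in> Y" "ys \<in> Y"
    and s: "r \<in> subdiff d g yin" "gs \<in> subdiff d g ys"
    and smooth: "\<nu> = 1 \<Longrightarrow> ambient_smooth d g H"
  shows "reg_coeff \<nu> H / 4 * (norm a)\<^sup>2 - bregman g gs yin ys / 2 \<le>
    reg_coeff \<nu> H / 2 * ((norm (a + (gs - r)))\<^sup>2 - (norm (gs - r))\<^sup>2)"
proof (cases "\<nu> = 1")
  case True
  have H: "0 < H" and conv: "convex_on (Rn d) g" using hg by (auto simp: holder_class_def)
  have "(norm (r - gs))\<^sup>2 \<le> 2 * H * bregman g gs yin ys"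
    using Y s smooth[OF True] by (intro gradient_cocoercive[OF conv _ H]) auto
  then have "(norm (gs - r))\<^sup>2 / (4 * H) \<le> bregman g gs yin ys / 2"
    using H by (simp add: field_simps norm_minus_commute)
  then have \<beta>: "reg_coeff \<nu> H * (norm (gs - r))\<^sup>2 \<le> bregman g gs yin ys / 2"
    using True by (simp add: reg_coeff_def)
  have "reg_coeff \<nu> H / 2 * ((norm a)\<^sup>2 / 2 - 2 * (norm (gs - r))\<^sup>2) \<le>
      reg_coeff \<nu> H / 2 * ((norm (a + (gs - r)))\<^sup>2 - (norm (gs - r))\<^sup>2)"
    using H by (intro mult_left_mono norm_shift_lower) (auto simp: reg_coeff_def)
  then show ?thesis using \<beta> by (simp only: right_diff_distrib)
next
  case False
  then show ?thesis using bregman_nonneg[OF hg Y(3,2) s(2)] by (simp add: reg_coeff_def)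
qed

lemma reg_coeff_nonneg: "0 < H \<Longrightarrow> 0 \<le> reg_coeff \<nu> H"
  by (simp add: reg_coeff_def)

section \<open>The bilinear saddle-point problem\<close>

text \<open>
  The derived constants are parameters that are tied to their values by equations, so that they stay opaque
  in proofs.
\<close>

locale bilinear_saddle =
  fixes dx dy :: nat and X Y :: "fvec set" and f g :: "fvec \<Rightarrow> real" and f' g' :: "fvec \<Rightarrow> fvec"
    and B :: mat_fun and \<mu>x \<mu>y \<nu>x \<nu>y Hx Hy Lxy \<mu>xy \<mu>yx :: real and invx invy :: bool
    and xs ys fs gs \<xi> \<zeta> xin yin :: fvec and \<beta>x \<beta>y \<delta>x \<delta>y \<kappa>xy :: real
  assumes \<beta>x: "\<beta>x = reg_coeff \<nu>y Hy" and \<beta>y: "\<beta>y = reg_coeff \<nu>x Hx"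
    and \<delta>x: "\<delta>x = \<mu>x + 4 * \<beta>x * \<mu>xy\<^sup>2" and \<delta>y: "\<delta>y = \<mu>y + 4 * \<beta>y * \<mu>yx\<^sup>2"
    and \<kappa>xy: "\<kappa>xy = Lxy\<^sup>2 / (\<delta>x * \<delta>y)"
    and X: "X \<subseteq> Rn dx" "closed X" "convex X" and Y: "Y \<subseteq> Rn dy" "closed Y" "convex Y"
    and hf: "holder_class dx X f \<mu>x \<nu>x Hx" and hg: "holder_class dy Y g \<mu>y \<nu>y Hy"
    and f': "\<And>x. x \<in> X \<Longrightarrow> f' x \<in> subdiff dx f x" and g': "\<And>y. y \<in> Y \<Longrightarrow> g' y \<in> subdiff dy g y"
    and Lxy: "0 < Lxy" "lam_max dx (mmul dy (mtrans B) B) \<le> Lxy\<^sup>2"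
    and coup_x: "coupling_bound invx dx dy X f B \<mu>xy" and coup_y: "coupling_bound invy dy dx Y g (mtrans B) \<mu>yx"
    and smooth_f: "\<nu>x = 1 \<Longrightarrow> ambient_smooth dx f Hx" and smooth_g: "\<nu>y = 1 \<Longrightarrow> ambient_smooth dy g Hy"
    and xin: "xin \<in> X" and yin: "yin \<in> Y" and saddle: "xs \<in> X" "ys \<in> Y"
    and range_x: "invx \<Longrightarrow> xin - xs \<in> mrange dx dy (mtrans B)"
    and range_y: "invy \<Longrightarrow> yin - ys \<in> mrange dy dx B"
    and fs: "fs \<in> subdiff dx f xs" and gs: "gs \<in> subdiff dy g ys"
    and \<xi>: "\<xi> \<in> normal_cone dx X xs" and \<zeta>: "\<zeta> \<in> normal_cone dy Y ys"
    and opt_x: "fs + matvec dx dy (mtrans B) ys + \<xi> = 0" and opt_y: "gs - matvec dy dx B xs + \<zeta> = 0"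
    and \<delta>_pos: "0 < \<delta>x" "0 < \<delta>y" and \<beta>\<delta>: "\<beta>x * \<delta>y \<le> 1 / 4" "\<beta>y * \<delta>x \<le> 1 / 4"
    and \<zeta>0: "0 < \<beta>x \<Longrightarrow> \<zeta> = 0" and \<xi>0: "0 < \<beta>y \<Longrightarrow> \<xi> = 0"
begin

abbreviation "Bm \<equiv> matvec dy dx B"
abbreviation "Bt \<equiv> matvec dx dy (mtrans B)"
abbreviation "Df x \<equiv> bregman f fs x xs"
abbreviation "Dg y \<equiv> bregman g gs y ys"
abbreviation "Kx \<equiv> invariant_kernel invx dx dy B"
abbreviation "Ky \<equiv> invariant_kernel invy dy dx (mtrans B)"

definition "potential z = pnorm2 \<delta>x \<delta>y (z - (xs, ys)) + 12 * Df (fst z) + 12 * Dg (snd z)"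

text \<open>
  The functions \<open>p\<^sub>i\<close> of the decomposition, before they are permuted.
\<close>

definition "summand i = (if i = 1 then \<lambda>z. f (fst z) else if i = 2 then \<lambda>z. g (snd z)
  else p3 dx dy B \<beta>x \<beta>y (f' xin) (g' yin))" for i :: nat

abbreviation "part_grad \<equiv> oracle_grad dx dy B f' g' \<beta>x \<beta>y (f' xin) (g' yin)"
abbreviation "part_Q \<equiv> oracle_Q dx dy B"
abbreviation "N \<equiv> pnorm2 \<delta>x \<delta>y"

definition "prox_map z = (\<delta>x *\<^sub>R fst z, \<delta>y *\<^sub>R snd z)" for z :: "fvec \<times> fvec"

lemma H_pos: "0 < Hx" "0 < Hy" and \<nu>_bounds: "0 \<le> \<nu>x" "\<nu>x \<le> 1" "0 \<le> \<nu>y" "\<nu>y \<le> 1"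
  and \<mu>_nonneg: "0 \<le> \<mu>x" "0 \<le> \<mu>y"
  using hf hg by (auto simp: holder_class_def)

lemma \<beta>_nonneg: "0 \<le> \<beta>x" "0 \<le> \<beta>y"
  using H_pos by (simp_all add: \<beta>x \<beta>y reg_coeff_nonneg)

lemma \<kappa>xy_pos: "0 < \<kappa>xy"
  using Lxy \<delta>_pos by (simp add: \<kappa>xy)

lemma norm_Bm_le: "x \<in> Rn dx \<Longrightarrow> norm (Bm x) \<le> Lxy * norm x"
  using norm_matvec_le[OF Lxy(2)] Lxy(1) by simp

lemma norm_Bt_le: "y \<in> Rn dy \<Longrightarrow> norm (Bt y) \<le> Lxy * norm y"
  using norm_matvec_trans_le[OF Lxy(2)] Lxy(1) by simp

lemma adjoint: "x \<in> Rn dx \<Longrightarrow> y \<in> Rn dy \<Longrightarrow> y \<bullet> Bm x = Bt y \<bullet> x"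
  by (rule matvec_adjoint)

lemma Kx: "k \<in> Kx \<Longrightarrow> k \<in> Rn dx \<and> Bm k = 0"
  by (rule invariant_kernel_iff)

lemma Ky: "k \<in> Ky \<Longrightarrow> k \<in> Rn dy \<and> Bt k = 0"
  by (rule invariant_kernel_iff)

lemma prox_geometry: "prox_geometry prox_map N (X \<times> Y)"
proof
  show "prox_map (a + b) = prox_map a + prox_map b" for a b
    by (simp add: prox_map_def scaleR_add_right)
  show "prox_map (r *\<^sub>R a) = r *\<^sub>R prox_map a" for r a
    by (simp add: prox_map_def)
  show "prox_map a \<bullet> b = a \<bullet> prox_map b" for a b
    by (cases a; cases b) (simp add: prox_map_def)
  show "N a = prox_map a \<bullet> a" for a by (simp add: pnorm2_def prox_map_def)
  show "0 \<le> N a" for a using \<delta>_pos by (simp add: pnorm2_eq)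
  show "convex (X \<times> Y)" using X Y by (intro convex_Times)
  fix h :: real and c
  assume h: "0 < h"
  show "\<exists>z\<in>X \<times> Y. \<forall>z'\<in>X \<times> Y. c \<bullet> z + h / 2 * N z \<le> c \<bullet> z' + h / 2 * N z'"
  proof (rule quadratic_attains_min[where a = dx and b = dy and m = "min \<delta>x \<delta>y"])
    show "closed (X \<times> Y)" using X Y by (intro closed_Times)
    show "X \<times> Y \<noteq> {}" "X \<times> Y \<subseteq> Rn dx \<times> Rn dy" using xin yin X Y by auto
    show "continuous_on (X \<times> Y) N" unfolding pnorm2_eq by (intro continuous_intros)
    show "min \<delta>x \<delta>y * (norm z)\<^sup>2 \<le> N z" for z :: "fvec \<times> fvec"
    proof -
      have "min \<delta>x \<delta>y * (norm z)\<^sup>2 = min \<delta>x \<delta>y * (norm (fst z))\<^sup>2 + min \<delta>x \<delta>y * (norm (snd z))\<^sup>2"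
        by (cases z) (simp add: norm_Pair distrib_left)
      also have "\<dots> \<le> N z" unfolding pnorm2_eq by (intro add_mono mult_right_mono) auto
      finally show ?thesis .
    qed
  qed (use h \<delta>_pos in auto)
qed

lemmas oracle_defs = oracle_grad_def oracle_Q_def grad_p1_def grad_p2_def grad_p3_def
  bilin_Q3_def eval_f_def eval_g_def eval_mv_def

lemma part_grad_simps:
  "fst (part_grad (Suc 0) z) = (f' (fst z), 0)"
  "fst (part_grad 2 z) = (0, g' (snd z))"
  "fst (part_grad 3 z) = (\<beta>x *\<^sub>R Bt (Bm (fst z) - g' yin), \<beta>y *\<^sub>R Bm (Bt (snd z) + f' xin))"
  by (simp_all add: oracle_defs)

lemma part_Q_simps:
  "fst (part_Q (Suc 0) z) = 0" "fst (part_Q 2 z) = 0"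
  "fst (part_Q 3 z) = (Bt (snd z), - Bm (fst z))"
  by (simp_all add: oracle_defs)

lemma part_cases:
  assumes "i \<in> {1, 2, 3::nat}"
  obtains "i = Suc 0" | "i = 2" | "i = 3"
  using assms by auto

lemma subgrad_Rn: "f' xin \<in> Rn dx" "g' yin \<in> Rn dy"
  using f'[OF xin] g'[OF yin] by (auto simp: subdiff_def)

lemma part_grad_kernel:
  assumes i: "i \<in> {1, 2, 3}" and z: "z \<in> X \<times> Y" and v: "v \<in> Kx \<times> Ky"
  shows "fst (part_grad i z) \<bullet> v = 0"
  using i
proof (cases rule: part_cases)
  case 1
  have "fst z \<in> X" "fst v \<in> Kx" using z v by auto
  then have "f' (fst z) \<bullet> fst v = 0" using coupling_subgradient[OF coup_x] f' by blast
  then show ?thesis unfolding 1 part_grad_simps by (cases v) simp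
next
  case 2
  have "snd z \<in> Y" "snd v \<in> Ky" using z v by auto
  then have "g' (snd z) \<bullet> snd v = 0" using coupling_subgradient[OF coup_y] g' by blast
  then show ?thesis unfolding 2 part_grad_simps by (cases v) simp
next
  case 3
  have k: "fst v \<in> Rn dx" "Bm (fst v) = 0" "snd v \<in> Rn dy" "Bt (snd v) = 0" using v Kx Ky by auto
  have "Bm (fst z) - g' yin \<in> Rn dy" "Bt (snd z) + f' xin \<in> Rn dx"
    by (intro subspace_diff subspace_add subspace_Rn matvec_in_Rn subgrad_Rn)+
  then have "Bt (Bm (fst z) - g' yin) \<bullet> fst v = 0" "Bm (Bt (snd z) + f' xin) \<bullet> snd v = 0"
    using adjoint[OF k(1), of "Bm (fst z) - g' yin"] adjoint[OF _ k(3), of "Bt (snd z) + f' xin"] k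
    by (simp_all add: inner_commute)
  then show ?thesis unfolding 3 part_grad_simps by (cases v) simp
qed

lemma part_Q_kernel:
  assumes i: "i \<in> {1, 2, 3}" and z: "z \<in> X \<times> Y" and v: "v \<in> Kx \<times> Ky"
  shows "fst (part_Q i z) \<bullet> v = 0"
  using i
proof (cases rule: part_cases)
  case 3
  have k: "fst v \<in> Rn dx" "Bm (fst v) = 0" "snd v \<in> Rn dy" "Bt (snd v) = 0" using v Kx Ky by auto
  have "fst z \<in> Rn dx" "snd z \<in> Rn dy" using z X Y by auto
  then have "Bt (snd z) \<bullet> fst v = 0" "Bm (fst z) \<bullet> snd v = 0"
    using adjoint[OF k(1), of "snd z"] adjoint[OF _ k(3), of "fst z"] k by (simp_all add: inner_commute)
  then show ?thesis unfolding 3 part_Q_simps by (cases v) simp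
qed (simp_all add: part_Q_simps)

lemma p3_expansion:
  assumes "w \<in> X \<times> Y" "z \<in> X \<times> Y"
  shows "summand 3 z = summand 3 w + fst (part_grad 3 w) \<bullet> (z - w) +
    \<beta>x / 2 * (norm (Bm (fst z - fst w)))\<^sup>2 + \<beta>y / 2 * (norm (Bt (snd z - snd w)))\<^sup>2"
proof -
  have R: "fst w \<in> Rn dx" "snd w \<in> Rn dy" "fst z \<in> Rn dx" "snd z \<in> Rn dy" using assms X Y by auto
  then have w: "w \<in> Rn dx \<times> Rn dy" by (simp add: mem_Times_iff)
  have h: "z - w \<in> Rn dx \<times> Rn dy" using R by (auto simp: mem_Times_iff intro: subspace_diff[OF subspace_Rn])
  show ?thesis
    using grad_p3_expansion[OF w h subgrad_Rn, of B \<beta>x \<beta>y] by (simp add: summand_def oracle_grad_def)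
qed

lemma part_lower:
  assumes i: "i \<in> {1, 2, 3}" and z: "w \<in> X \<times> Y" "z \<in> X \<times> Y"
  shows "summand i w + fst (part_grad i w) \<bullet> (z - w) \<le> summand i z"
  using i
proof (cases rule: part_cases)
  case 1
  have "f (fst z) \<ge> f (fst w) + f' (fst w) \<bullet> (fst z - fst w)"
    using f'[of "fst w"] z X unfolding subdiff_def by auto
  then show ?thesis unfolding 1 part_grad_simps by (cases z; cases w) (simp add: summand_def)
next
  case 2
  have "g (snd z) \<ge> g (snd w) + g' (snd w) \<bullet> (snd z - snd w)"
    using g'[of "snd w"] z Y unfolding subdiff_def by auto
  then show ?thesis unfolding 2 part_grad_simps by (cases z; cases w) (simp add: summand_def)
next
  case 3
  show ?thesis unfolding 3 p3_expansion[OF z] using \<beta>_nonneg by simp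
qed

lemma curvature_in_weighted_norm:
  fixes L \<delta> :: real
  assumes "0 \<le> L" "0 < \<delta>" "\<delta> * r \<le> w"
  shows "L / 2 * r \<le> L / \<delta> / 2 * w"
proof -
  have "L / 2 * r = L / \<delta> / 2 * (\<delta> * r)" using assms by simp
  also have "\<dots> \<le> L / \<delta> / 2 * w" using assms by (intro mult_left_mono) auto
  finally show ?thesis .
qed

text \<open>
  Used for both terms of \<open>p\<^sub>3\<close>, where \<open>a\<close> is the norm of an image under \<open>B\<close> or its transpose: the condition on the product of
  \<open>b\<close> with the opposite weight keeps the curvature below \<open>\<kappa>\<^sub>x\<^sub>y\<close> in the weighted norm.
\<close>

lemma regulariser_curvature:
  assumes a: "a \<le> Lxy * r" "0 \<le> a" and b: "0 \<le> b" "b * \<delta>' \<le> 1 / 4"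
    and pos: "0 < \<delta>" "0 < \<delta>'" "\<kappa>xy = Lxy\<^sup>2 / (\<delta> * \<delta>')"
  shows "b * a\<^sup>2 \<le> \<kappa>xy * (\<delta> * r\<^sup>2)"
proof -
  have "a\<^sup>2 \<le> Lxy\<^sup>2 * r\<^sup>2" using power_mono[OF a, of 2] by (simp add: power_mult_distrib)
  then have "b * a\<^sup>2 \<le> b * (Lxy\<^sup>2 * r\<^sup>2)" using b by (intro mult_left_mono)
  also have "\<dots> = (b * \<delta>') * (\<kappa>xy * (\<delta> * r\<^sup>2))" using pos by simp
  also have "\<dots> \<le> 1 * (\<kappa>xy * (\<delta> * r\<^sup>2))" using b pos \<kappa>xy_pos by (intro mult_right_mono) auto
  finally show ?thesis by simp
qed

lemma part_upper:
  assumes i: "i \<in> {1, 2, 3}" and z: "w \<in> X \<times> Y" "z \<in> X \<times> Y"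
    and tol: "\<nu>x < 1 \<Longrightarrow> 0 < \<delta>f" "0 \<le> \<delta>f" "\<nu>y < 1 \<Longrightarrow> 0 < \<delta>g" "0 \<le> \<delta>g"
  shows "summand i z \<le> summand i w + fst (part_grad i w) \<bullet> (z - w) +
    (if i = 1 then inexact_L \<nu>x Hx \<delta>f / \<delta>x else if i = 2 then inexact_L \<nu>y Hy \<delta>g / \<delta>y else \<kappa>xy) / 2 * N (z - w) +
    (if i = 1 then \<delta>f else if i = 2 then \<delta>g else 0)"
  using i
proof (cases rule: part_cases)
  case 1
  have Lf: "0 < inexact_L \<nu>x Hx \<delta>f" using \<nu>_bounds H_pos tol by (intro inexact_L_pos) auto
  have "f (fst z) \<le> f (fst w) + f' (fst w) \<bullet> (fst z - fst w) +
      inexact_L \<nu>x Hx \<delta>f / 2 * (norm (fst z - fst w))\<^sup>2 + \<delta>f"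
    using z tol f' by (intro holder_class_upper_model[OF hf X(3,1)]) auto
  moreover have "inexact_L \<nu>x Hx \<delta>f / 2 * (norm (fst z - fst w))\<^sup>2 \<le> inexact_L \<nu>x Hx \<delta>f / \<delta>x / 2 * N (z - w)"
    using Lf \<delta>_pos by (intro curvature_in_weighted_norm) (auto simp: pnorm2_eq)
  ultimately show ?thesis unfolding 1 part_grad_simps by (cases z; cases w) (simp add: summand_def)
next
  case 2
  have Lg: "0 < inexact_L \<nu>y Hy \<delta>g" using \<nu>_bounds H_pos tol by (intro inexact_L_pos) auto
  have "g (snd z) \<le> g (snd w) + g' (snd w) \<bullet> (snd z - snd w) +
      inexact_L \<nu>y Hy \<delta>g / 2 * (norm (snd z - snd w))\<^sup>2 + \<delta>g"
    using z tol g' by (intro holder_class_upper_model[OF hg Y(3,1)]) auto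
  moreover have "inexact_L \<nu>y Hy \<delta>g / 2 * (norm (snd z - snd w))\<^sup>2 \<le> inexact_L \<nu>y Hy \<delta>g / \<delta>y / 2 * N (z - w)"
    using Lg \<delta>_pos by (intro curvature_in_weighted_norm) (auto simp: pnorm2_eq)
  ultimately show ?thesis unfolding 2 part_grad_simps by (cases z; cases w) (simp add: summand_def)
next
  case 3
  have h: "fst z - fst w \<in> Rn dx" "snd z - snd w \<in> Rn dy"
    using z X Y by (auto intro!: subspace_diff subspace_Rn)
  have "\<beta>x * (norm (Bm (fst z - fst w)))\<^sup>2 \<le> \<kappa>xy * (\<delta>x * (norm (fst z - fst w))\<^sup>2)"
    using \<beta>_nonneg \<beta>\<delta> \<delta>_pos h by (intro regulariser_curvature[where \<delta>' = \<delta>y] norm_Bm_le \<kappa>xy) auto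
  moreover have "\<beta>y * (norm (Bt (snd z - snd w)))\<^sup>2 \<le> \<kappa>xy * (\<delta>y * (norm (snd z - snd w))\<^sup>2)"
    using \<beta>_nonneg \<beta>\<delta> \<delta>_pos h \<kappa>xy
    by (intro regulariser_curvature[where \<delta>' = \<delta>x] norm_Bt_le) (auto simp: mult.commute)
  ultimately show ?thesis unfolding 3 p3_expansion[OF z] by (simp add: pnorm2_eq distrib_left)
qed

lemma part_Q_skew:
  assumes i: "i \<in> {1, 2, 3}" and z: "z \<in> X \<times> Y" "u \<in> X \<times> Y"
  shows "fst (part_Q i z) \<bullet> (z - u) = fst (part_Q i u) \<bullet> (z - u)"
  using i
proof (cases rule: part_cases)
  case 3
  have R: "fst z \<in> Rn dx" "snd z \<in> Rn dy" "fst u \<in> Rn dx" "snd u \<in> Rn dy" using z X Y by auto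
  show ?thesis
    unfolding 3 part_Q_simps using adjoint[OF R(1,2)] adjoint[OF R(3,4)] adjoint[OF R(1,4)] adjoint[OF R(3,2)]
    by (cases z; cases u) (simp add: inner_diff_right inner_diff_left inner_commute)
qed (simp_all add: part_Q_simps)

text \<open>
  The coupling is scaled by \<open>L\<^sub>x\<^sub>y = sqrt \<kappa>\<^sub>x\<^sub>y sqrt (\<delta>\<^sub>x \<delta>\<^sub>y)\<close>; the second factor is absorbed by the arithmetic-geometric mean
  inequality in the weighted norm.
\<close>

lemma part_Q_lipschitz:
  assumes i: "i \<in> {1, 2, 3}" and z: "z \<in> X \<times> Y" "z' \<in> X \<times> Y" "y \<in> X \<times> Y" "y' \<in> X \<times> Y"
  shows "(fst (part_Q i z) - fst (part_Q i z')) \<bullet> (y - y') \<le>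
    (if i = 1 \<or> i = 2 then 0 else sqrt \<kappa>xy) / 2 * (N (z - z') + N (y - y'))"
  using i
proof (cases rule: part_cases)
  case 3
  define a b c d where "a = fst z - fst z'" and "b = snd z - snd z'" and "c = fst y - fst y'" and "d = snd y - snd y'"
  have R: "a \<in> Rn dx" "b \<in> Rn dy"
    using z X Y unfolding a_def b_def by (auto intro!: subspace_diff subspace_Rn)
  have lin: "Bt (snd z) - Bt (snd z') = Bt b" "Bm (fst z) - Bm (fst z') = Bm a"
    by (simp_all add: a_def b_def linear_diff[OF linear_matvec])
  have "(fst (part_Q 3 z) - fst (part_Q 3 z')) \<bullet> (y - y') = Bt b \<bullet> c - Bm a \<bullet> d"
    unfolding part_Q_simps lin[symmetric] by (cases y; cases y') (simp add: c_def d_def inner_diff_left)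
  also have "\<dots> \<le> norm (Bt b) * norm c + norm (Bm a) * norm d"
    using norm_cauchy_schwarz[of "Bt b" c] Cauchy_Schwarz_ineq2[of "Bm a" d] by linarith
  also have "\<dots> \<le> (Lxy * norm b) * norm c + (Lxy * norm a) * norm d"
    by (intro add_mono mult_right_mono norm_Bt_le norm_Bm_le R) auto
  also have "\<dots> = sqrt \<kappa>xy * (sqrt (\<delta>x * \<delta>y) * (norm b * norm c + norm a * norm d))"
  proof -
    have "sqrt \<kappa>xy * sqrt (\<delta>x * \<delta>y) = Lxy"
      using \<delta>_pos Lxy(1) by (simp add: \<kappa>xy real_sqrt_mult[symmetric])
    then show ?thesis by (metis distrib_left mult.assoc)
  qed
  also have "\<dots> \<le> sqrt \<kappa>xy * ((\<delta>x * (norm a)\<^sup>2 + \<delta>y * (norm b)\<^sup>2 + \<delta>x * (norm c)\<^sup>2 + \<delta>y * (norm d)\<^sup>2) / 2)"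
  proof (intro mult_left_mono)
    have am: "sqrt (\<delta>x * \<delta>y) * (r * s) \<le> (\<delta>x * s\<^sup>2 + \<delta>y * r\<^sup>2) / 2" for r s
    proof -
      have "0 \<le> (sqrt \<delta>x * s - sqrt \<delta>y * r)\<^sup>2" by simp
      also have "\<dots> = \<delta>x * s\<^sup>2 + \<delta>y * r\<^sup>2 - 2 * (sqrt (\<delta>x * \<delta>y) * (r * s))"
        using \<delta>_pos by (simp add: power2_diff power_mult_distrib real_sqrt_mult)
      finally show ?thesis by simp
    qed
    show "sqrt (\<delta>x * \<delta>y) * (norm b * norm c + norm a * norm d) \<le>
        (\<delta>x * (norm a)\<^sup>2 + \<delta>y * (norm b)\<^sup>2 + \<delta>x * (norm c)\<^sup>2 + \<delta>y * (norm d)\<^sup>2) / 2"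
      using am[of "norm b" "norm c"] am[of "norm d" "norm a"] by (simp add: distrib_left mult.commute[of "norm a"])
  qed (use \<kappa>xy_pos in simp)
  also have "\<dots> = sqrt \<kappa>xy / 2 * (N (z - z') + N (y - y'))"
    by (simp add: pnorm2_eq a_def b_def c_def d_def)
  finally show ?thesis unfolding 3 by simp
qed (simp_all add: part_Q_simps)

lemma strong_convexity_split:
  fixes \<delta> \<mu> \<beta> c n b D :: real
  assumes "\<delta> = \<mu> + 4 * \<beta> * c" "0 \<le> \<beta>" "0 \<le> \<mu>" "c * n\<^sup>2 \<le> b" "\<mu> / 2 * n\<^sup>2 \<le> D"
  shows "\<delta> * n\<^sup>2 + 12 * D \<le> 16 * D + 4 * \<beta> * b"
proof -
  have "4 * \<beta> * (c * n\<^sup>2) \<le> 4 * \<beta> * b" using assms by (intro mult_left_mono) auto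
  moreover have "0 \<le> \<mu> * n\<^sup>2" "\<mu> * n\<^sup>2 \<le> 2 * D" using assms by simp_all
  moreover have "\<delta> * n\<^sup>2 = \<mu> * n\<^sup>2 + 4 * \<beta> * (c * n\<^sup>2)" by (simp add: assms(1) algebra_simps)
  ultimately show ?thesis by linarith
qed

text \<open>
  Of the \<open>16\<close> copies of \<open>D\<^sub>f\<close>, \<open>12\<close> go into the potential and the other \<open>4\<close> supply the part \<open>\<mu>\<^sub>x\<close> of \<open>\<delta>\<^sub>x\<close>; the
  remaining part \<open>4 \<beta>\<^sub>x \<mu>\<^sub>x\<^sub>y\<^sup>2\<close> comes from the regulariser through the spectral bound. In the gap
  the normal vectors occur with a favourable sign. Where a regulariser is present the corresponding one vanishes, so
  that the vector it is centred at, a subgradient at the starting point, can be compared with \<open>B x*\<close> or \<open>-B\<^sup>T y*\<close>.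
\<close>

lemma potential_lower_bound:
  assumes z: "z \<in> X \<times> Y"
    and orth: "\<And>k. k \<in> Kx \<Longrightarrow> (fst z - xs) \<bullet> k = 0" "\<And>k. k \<in> Ky \<Longrightarrow> (snd z - ys) \<bullet> k = 0"
  shows "potential z \<le> 8 * (Df xin + Dg yin) +
    16 * (\<Sum>i\<in>{1, 2, 3}. summand i z - summand i (xs, ys) + fst (part_Q i (xs, ys)) \<bullet> (z - (xs, ys)))"
proof -
  obtain x y where zxy: "z = (x, y)" by (cases z)
  have x: "x \<in> X" and y: "y \<in> Y" using z by (auto simp: zxy)
  have R: "x - xs \<in> Rn dx" "y - ys \<in> Rn dy"
    using x y saddle X Y by (auto intro!: subspace_diff subspace_Rn)
  let ?Bx = "(norm (Bm (x - xs)))\<^sup>2" and ?By = "(norm (Bt (y - ys)))\<^sup>2"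
  have nc: "\<xi> \<bullet> (x - xs) \<le> 0" "\<zeta> \<bullet> (y - ys) \<le> 0" using \<xi> \<zeta> x y by (auto simp: normal_cone_def)
  have Bt_ys: "Bt ys = - fs - \<xi>" using opt_x by (simp add: eq_neg_iff_add_eq_0 add_ac algebra_simps)
  have Bm_xs: "Bm xs = gs + \<zeta>" using opt_y by (simp add: algebra_simps)
  have linear_part: "fst (part_Q 3 (xs, ys)) \<bullet> (z - (xs, ys)) =
      - (fs \<bullet> (x - xs)) - \<xi> \<bullet> (x - xs) - gs \<bullet> (y - ys) - \<zeta> \<bullet> (y - ys)"
    unfolding part_Q_simps zxy by (simp add: Bt_ys Bm_xs inner_diff_left inner_add_left)
  have reg_x: "\<beta>x / 4 * ?Bx - Dg yin / 2 \<le> \<beta>x / 2 * ((norm (Bm x - g' yin))\<^sup>2 - (norm (Bm xs - g' yin))\<^sup>2)"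
  proof (cases "0 < \<beta>x")
    case True
    have "Bm xs = gs" using \<zeta>0[OF True] Bm_xs by simp
    then have e: "Bm (x - xs) + (gs - g' yin) = Bm x - g' yin" by (simp add: linear_diff[OF linear_matvec])
    show ?thesis
      using regularizer_lower_bound[OF hg Y(1) yin saddle(2) g'[OF yin] gs smooth_g, of "Bm (x - xs)"]
      unfolding e \<open>Bm xs = gs\<close> \<beta>x .
  next
    case False
    then have "\<beta>x = 0" using \<beta>_nonneg by simp
    then show ?thesis using bregman_nonneg[OF hg saddle(2) yin gs] by simp
  qed
  have reg_y: "\<beta>y / 4 * ?By - Df xin / 2 \<le> \<beta>y / 2 * ((norm (Bt y + f' xin))\<^sup>2 - (norm (Bt ys + f' xin))\<^sup>2)"
  proof (cases "0 < \<beta>y")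
    case True
    have "Bt ys = - fs" using \<xi>0[OF True] Bt_ys by simp
    have "- Bt (y - ys) + (fs - f' xin) = - (Bt y + f' xin)" "fs - f' xin = - (Bt ys + f' xin)"
      by (simp_all add: linear_diff[OF linear_matvec] \<open>Bt ys = - fs\<close>)
    then show ?thesis
      using regularizer_lower_bound[OF hf X(1) xin saddle(1) f'[OF xin] fs smooth_f, of "- Bt (y - ys)"]
      by (simp only: \<beta>y norm_minus_cancel)
  next
    case False
    then have "\<beta>y = 0" using \<beta>_nonneg by simp
    then show ?thesis using bregman_nonneg[OF hf saddle(1) xin fs] by simp
  qed
  have total: "(\<Sum>i\<in>{1, 2, 3}. summand i z - summand i (xs, ys) + fst (part_Q i (xs, ys)) \<bullet> (z - (xs, ys))) =
      Df x - \<xi> \<bullet> (x - xs) + (Dg y - \<zeta> \<bullet> (y - ys)) +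
      \<beta>x / 2 * ((norm (Bm x - g' yin))\<^sup>2 - (norm (Bm xs - g' yin))\<^sup>2) +
      \<beta>y / 2 * ((norm (Bt y + f' xin))\<^sup>2 - (norm (Bt ys + f' xin))\<^sup>2)"
    using linear_part by (simp add: part_Q_simps zxy summand_def p3_def bregman_def algebra_simps)
  have sx: "\<delta>x * (norm (x - xs))\<^sup>2 + 12 * Df x \<le> 16 * Df x + 4 * \<beta>x * ?Bx"
    using orth(1) zxy by (intro strong_convexity_split[OF \<delta>x \<beta>_nonneg(1) \<mu>_nonneg(1)]
        coupling_lower_bound[OF coup_x R(1)] bregman_ge_quadratic[OF hf saddle(1) x fs]) auto
  have sy: "\<delta>y * (norm (y - ys))\<^sup>2 + 12 * Dg y \<le> 16 * Dg y + 4 * \<beta>y * ?By"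
    using orth(2) zxy by (intro strong_convexity_split[OF \<delta>y \<beta>_nonneg(2) \<mu>_nonneg(2)]
        coupling_lower_bound[OF coup_y R(2)] bregman_ge_quadratic[OF hg saddle(2) y gs]) auto
  show ?thesis
    unfolding total potential_def using sx sy reg_x reg_y nc by (simp add: zxy pnorm2_eq)
qed

lemma initial_offset_orthogonal:
  "k \<in> Kx \<Longrightarrow> (xin - xs) \<bullet> k = 0" "k \<in> Ky \<Longrightarrow> (yin - ys) \<bullet> k = 0"
proof -
  show "(xin - xs) \<bullet> k = 0" if k: "k \<in> Kx"
  proof (cases invx)
    case True
    then show ?thesis using mrange_orthogonal_kernel[OF range_x] Kx[OF k] by blast
  qed (use k in \<open>simp add: invariant_kernel_def\<close>)
  show "(yin - ys) \<bullet> k = 0" if k: "k \<in> Ky"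
  proof (cases invy)
    case True
    then have "yin - ys \<in> mrange dy dx (mtrans (mtrans B))" using range_y by (simp add: mtrans_def)
    then show ?thesis using mrange_orthogonal_kernel Ky[OF k] by blast
  qed (use k in \<open>simp add: invariant_kernel_def\<close>)
qed

section \<open>Contraction of the potential\<close>

text \<open>
  An absolute constant \<open>K\<close> for which \<open>P \<ge> K R\<close> at every level makes all coefficients at most \<open>1/72\<close>. The
  tightest case is a Hoelder level at depth three, where \<open>4\<^sup>3 \<cdot> 192 / (2 K)\<close> is the leading term.
\<close>

definition "loop_const = (450000 :: real)"

definition "rate i \<Omega> = (if i = 1 then rate_holder \<nu>x Hx \<delta>x \<Omega>
  else if i = 2 then rate_holder \<nu>y Hy \<delta>y \<Omega> else max (sqrt \<kappa>xy) 1)" for i :: nat and \<Omega> :: real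

lemma rate_ge_1: "1 \<le> rate i \<Omega>"
  by (simp add: rate_def rate_holder_def Let_def)

end

locale bilinear_sliding_run = bilinear_saddle +
  fixes \<Omega> :: real and \<pi> T :: "nat \<Rightarrow> nat"
  assumes \<Omega>: "0 < \<Omega>" "potential (xin, yin) \<le> \<Omega>"
    and \<pi>: "\<pi> permutes {1, 2, 3}"
    and loops_pos: "0 < T i"
    and T_lower: "i \<in> {1, 2, 3} \<Longrightarrow> loop_const * rate (\<pi> i) \<Omega> \<le> real (\<Prod>l\<in>{0<..i}. T l)"
begin

text \<open>
  The number of multi-indices at the level at which the function with number \<open>i\<close> sits, hence the number of evaluations of its
  gradient.
\<close>

definition "passes i = (\<Prod>l\<in>{0<..inv \<pi> i}. T l)" for i :: nat
definition "\<delta>f = (if \<nu>x < 1 then \<Omega> / (384 * real (passes 1)) else 0)"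
definition "\<delta>g = (if \<nu>y < 1 then \<Omega> / (384 * real (passes 2)) else 0)"
definition "Lc i = (if i = 1 then inexact_L \<nu>x Hx \<delta>f / \<delta>x
  else if i = 2 then inexact_L \<nu>y Hy \<delta>g / \<delta>y else \<kappa>xy)" for i :: nat
definition "Mc i = (if i = 1 \<or> i = 2 then 0 else sqrt \<kappa>xy)" for i :: nat
definition "tol i = (if i = 1 then \<delta>f else if i = 2 then \<delta>g else 0)" for i :: nat

definition "alg = \<lparr>sl_n = 3, sl_T = T, sl_L = Lc \<circ> \<pi>, sl_M = Mc \<circ> \<pi>, sl_pnorm2 = pnorm2 \<delta>x \<delta>y,
  sl_dom = X \<times> Y, sl_grad = part_grad \<circ> \<pi>, sl_Q = part_Q \<circ> \<pi>\<rparr>"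

lemma passes_pos: "0 < passes i"
  unfolding passes_def by (intro prod_pos) (simp add: loops_pos)

lemma \<pi>_in: "1 \<le> i \<Longrightarrow> i \<le> 3 \<Longrightarrow> \<pi> i \<in> {1, 2, 3}"
  using permutes_in_image[OF \<pi>, of i] by auto

lemma inv_\<pi>: "\<pi> (inv \<pi> i) = i" "inv \<pi> (\<pi> i) = i"
  using permutes_inverses[OF \<pi>] by auto

lemma passes_\<pi>: "passes (\<pi> i) = (\<Prod>l\<in>{0<..i}. T l)"
  by (simp add: passes_def inv_\<pi>)

lemma levels: "{0<..3} = {1, 2, 3::nat}"
  by auto

text \<open>
  Sums over levels and sums over the three functions agree by reindexing with the permutation.
\<close>

lemma sum_levels:
  fixes h :: "nat \<Rightarrow> 'a::comm_monoid_add"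
  shows "(\<Sum>i\<in>{0<..3}. h (\<pi> i)) = (\<Sum>i\<in>{1, 2, 3}. h i)"
  unfolding levels using sum.permute[OF \<pi>, of h] by (simp add: o_def)

lemma passes_lower:
  assumes "i \<in> {1, 2, 3}" shows "loop_const * rate i \<Omega> \<le> real (passes i)"
proof -
  have "inv \<pi> i \<in> {1, 2, 3}" using permutes_in_image[OF permutes_inv[OF \<pi>]] assms by blast
  from T_lower[OF this] show ?thesis by (simp add: passes_def inv_\<pi>)
qed

lemma tol_pos: "\<nu>x < 1 \<Longrightarrow> 0 < \<delta>f" "0 \<le> \<delta>f" "\<nu>y < 1 \<Longrightarrow> 0 < \<delta>g" "0 \<le> \<delta>g"
  using passes_pos \<Omega>(1) by (auto simp: \<delta>f_def \<delta>g_def)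

lemma Lc_pos: "0 < Lc i"
  using \<delta>_pos \<kappa>xy_pos inexact_L_pos[of \<nu>x Hx \<delta>f] inexact_L_pos[of \<nu>y Hy \<delta>g] tol_pos \<nu>_bounds H_pos
  by (auto simp: Lc_def)

lemma sliding_alg:
  "sliding prox_map N (X \<times> Y) alg (summand \<circ> \<pi>) (tol \<circ> \<pi>) (Kx \<times> Ky) (xin, yin)"
proof (rule sliding.intro[OF prox_geometry], unfold_locales)
  show "sl_pnorm2 alg = N" "sl_dom alg = X \<times> Y" "0 < sl_n alg" by (simp_all add: alg_def)
  show "0 < sl_T alg i" for i by (simp add: alg_def loops_pos)
  show "0 < sl_L alg i" for i by (simp add: alg_def Lc_pos)
  show "0 \<le> sl_M alg i" for i using \<kappa>xy_pos by (simp add: alg_def Mc_def)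
  show "0 \<le> (tol \<circ> \<pi>) i" for i using tol_pos by (simp add: tol_def)
  show "(xin, yin) \<in> X \<times> Y" using xin yin by simp
  show "- v \<in> Kx \<times> Ky" if "v \<in> Kx \<times> Ky" for v
    using that by (auto intro: uminus_invariant_kernel)
  show "z + v \<in> X \<times> Y" if "z \<in> X \<times> Y" "v \<in> Kx \<times> Ky" for z v
    using that coupling_shift[OF coup_x] coupling_shift[OF coup_y] by auto
  fix i :: nat
  assume "1 \<le> i" "i \<le> sl_n alg"
  then have i: "\<pi> i \<in> {1, 2, 3}" using \<pi>_in by (simp add: alg_def)
  show "fst (sl_grad alg i z) \<bullet> v = 0" if "z \<in> X \<times> Y" "v \<in> Kx \<times> Ky" for z v
    using part_grad_kernel[OF i that] by (simp add: alg_def)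
  show "fst (sl_Q alg i z) \<bullet> v = 0" if "z \<in> X \<times> Y" "v \<in> Kx \<times> Ky" for z v
    using part_Q_kernel[OF i that] by (simp add: alg_def)
  show "(summand \<circ> \<pi>) i w + fst (sl_grad alg i w) \<bullet> (z - w) \<le> (summand \<circ> \<pi>) i z"
    if "w \<in> X \<times> Y" "z \<in> X \<times> Y" for w z
    using part_lower[OF i that] by (simp add: alg_def)
  show "(summand \<circ> \<pi>) i z \<le> (summand \<circ> \<pi>) i w + fst (sl_grad alg i w) \<bullet> (z - w) +
      sl_L alg i / 2 * N (z - w) + (tol \<circ> \<pi>) i"
    if "w \<in> X \<times> Y" "z \<in> X \<times> Y" for w z
    using part_upper[OF i that tol_pos] by (simp add: alg_def Lc_def tol_def)
  show "fst (sl_Q alg i z) \<bullet> (z - u) = fst (sl_Q alg i u) \<bullet> (z - u)"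
    if "z \<in> X \<times> Y" "u \<in> X \<times> Y" for z u
    using part_Q_skew[OF i that] by (simp add: alg_def)
  show "(fst (sl_Q alg i z) - fst (sl_Q alg i z')) \<bullet> (y - y') \<le> sl_M alg i / 2 * (N (z - z') + N (y - y'))"
    if "z \<in> X \<times> Y" "z' \<in> X \<times> Y" "y \<in> X \<times> Y" "y' \<in> X \<times> Y" for z z' y y'
    using part_Q_lipschitz[OF i that] by (simp add: alg_def Mc_def)
qed

sublocale sliding prox_map N "X \<times> Y" alg "summand \<circ> \<pi>" "tol \<circ> \<pi>" "Kx \<times> Ky" "(xin, yin)"
  by (rule sliding_alg)

lemma smoothness_over_passes:
  assumes i: "i \<in> {1, 2, 3}"
  shows "Lc i / (real (passes i))\<^sup>2 \<le> 192 / loop_const" "Mc i / real (passes i) \<le> 1 / loop_const"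
proof -
  have c: "1 \<le> loop_const" by (simp add: loop_const_def)
  have P: "0 < real (passes i)" using passes_pos by simp
  have "Lc i \<le> 192 / loop_const * (real (passes i))\<^sup>2 \<and> Mc i \<le> 1 / loop_const * real (passes i)"
    using i
  proof (cases rule: part_cases)
    case 1
    have r: "loop_const * rate_holder \<nu>x Hx \<delta>x \<Omega> \<le> real (passes 1)"
      using passes_lower[OF i] by (simp add: 1 rate_def)
    show ?thesis
      using holder_rate_suffices[OF \<nu>_bounds(1,2) H_pos(1) \<delta>_pos(1) \<Omega>(1) c r, folded \<delta>f_def] P c
      by (simp add: 1 Lc_def Mc_def)
  next
    case 2
    have r: "loop_const * rate_holder \<nu>y Hy \<delta>y \<Omega> \<le> real (passes 2)"
      using passes_lower[OF i] by (simp add: 2 rate_def)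
    show ?thesis
      using holder_rate_suffices[OF \<nu>_bounds(3,4) H_pos(2) \<delta>_pos(2) \<Omega>(1) c r, folded \<delta>g_def] P c
      by (simp add: 2 Lc_def Mc_def)
  next
    case 3
    have "loop_const * sqrt \<kappa>xy \<le> loop_const * max (sqrt \<kappa>xy) 1" using c by (intro mult_left_mono) auto
    also have "\<dots> \<le> real (passes i)" using passes_lower[OF i] by (simp add: 3 rate_def)
    finally have s: "loop_const * sqrt \<kappa>xy \<le> real (passes i)" .
    then have "(loop_const * sqrt \<kappa>xy)\<^sup>2 \<le> (real (passes i))\<^sup>2"
      using c \<kappa>xy_pos by (intro power_mono) auto
    then have "\<kappa>xy * loop_const\<^sup>2 \<le> (real (passes i))\<^sup>2"
      using \<kappa>xy_pos by (simp add: power_mult_distrib mult.commute)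
    moreover have "\<kappa>xy * loop_const * 1 \<le> \<kappa>xy * loop_const * loop_const"
      using c \<kappa>xy_pos by (intro mult_left_mono) auto
    ultimately have "\<kappa>xy * loop_const \<le> (real (passes i))\<^sup>2" by (simp add: power2_eq_square mult_ac)
    moreover have "0 \<le> (real (passes i))\<^sup>2" by simp
    ultimately have "\<kappa>xy * loop_const \<le> 192 * (real (passes i))\<^sup>2" by linarith
    then show ?thesis using s c by (simp add: 3 Lc_def Mc_def field_simps)
  qed
  then show "Lc i / (real (passes i))\<^sup>2 \<le> 192 / loop_const" "Mc i / real (passes i) \<le> 1 / loop_const"
    using P by (simp_all add: pos_divide_le_eq)
qed

text \<open>
  Since \<open>\<alpha>\<^sub>T\<^sub>-\<^sub>1 \<le> 2 / T\<close>, the product of the last step sizes of the first \<open>i \<le> 3\<close> loops is at most \<open>8 / P\<close>.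
\<close>

lemma coeff_small:
  assumes i: "i \<in> {0<..3}"
  shows "coeff i [] \<le> 1 / 72"
proof -
  let ?a = "\<Prod>l\<in>{0<..i}. alpha (T l - 1)"
  let ?P = "real (passes (\<pi> i))"
  have P: "0 < ?P" using passes_pos by simp
  have i3: "i \<le> 3" and \<pi>i: "\<pi> i \<in> {1, 2, 3}" using i \<pi>_in by auto
  have a0: "0 \<le> ?a" by (intro prod_nonneg) (auto simp: less_imp_le alpha_pos)
  have "?a \<le> (\<Prod>l\<in>{0<..i}. 2 / real (T l))"
    by (intro prod_mono conjI alpha_last_le loops_pos less_imp_le[OF alpha_pos])
  also have "\<dots> = 2 ^ i / ?P" by (simp add: prod_dividef passes_\<pi>)
  also have "\<dots> \<le> 2 ^ 3 / ?P" using P i3 by (intro divide_right_mono power_increasing) auto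
  finally have a: "?a \<le> 8 / ?P" by simp
  have "?a\<^sup>2 \<le> (8 / ?P)\<^sup>2" using a a0 by (rule power_mono)
  then have "Lc (\<pi> i) * ?a\<^sup>2 \<le> Lc (\<pi> i) * (8 / ?P)\<^sup>2"
    using Lc_pos by (intro mult_left_mono) (auto simp: less_imp_le)
  also have "\<dots> = 64 * (Lc (\<pi> i) / ?P\<^sup>2)" by (simp add: power_divide)
  also have "\<dots> \<le> 64 * (192 / loop_const)" using smoothness_over_passes(1)[OF \<pi>i] by simp
  finally have l: "Lc (\<pi> i) * ?a\<^sup>2 \<le> 64 * (192 / loop_const)" .
  have "Mc (\<pi> i) * ?a \<le> Mc (\<pi> i) * (8 / ?P)"
    using a \<kappa>xy_pos by (intro mult_left_mono) (auto simp: Mc_def)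
  also have "\<dots> = 8 * (Mc (\<pi> i) / ?P)" by simp
  also have "\<dots> \<le> 8 * (1 / loop_const)" using smoothness_over_passes(2)[OF \<pi>i] by simp
  finally have m: "Mc (\<pi> i) * ?a \<le> 8 * (1 / loop_const)" .
  have "coeff i [] = (Lc (\<pi> i) * ?a\<^sup>2 + Mc (\<pi> i) * ?a) / 2"
    unfolding coeff_def index_scale_Nil index_ratio_Nil by (simp add: alg_def prod_power_distrib)
  then show ?thesis using l m by (simp add: loop_const_def)
qed

text \<open>
  The tolerances are defined as \<open>\<Omega> / 384\<close> divided by the factor with which they accumulate.
\<close>

lemma err_total: "(\<Sum>i\<in>{0<..3}. err i []) \<le> \<Omega> / 192"
proof -
  have "(\<Sum>i\<in>{0<..3}. err i []) = (\<Sum>i\<in>{0<..3}. tol (\<pi> i) * real (passes (\<pi> i)))"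
    unfolding err_def by (simp add: alg_def passes_\<pi>)
  also have "\<dots> = (\<Sum>i\<in>{1, 2, 3}. tol i * real (passes i))" by (rule sum_levels)
  also have "\<dots> = \<delta>f * real (passes 1) + \<delta>g * real (passes 2)" by (simp add: tol_def)
  also have "\<delta>f * real (passes 1) \<le> \<Omega> / 384" using passes_pos[of 1] \<Omega> by (simp add: \<delta>f_def)
  also have "\<delta>g * real (passes 2) \<le> \<Omega> / 384" using passes_pos[of 2] \<Omega> by (simp add: \<delta>g_def)
  finally show ?thesis by simp
qed

text \<open>
  With \<open>r\<close> the initial squared distance and \<open>D\<close> the initial divergences, the bounds combine to
  \<open>8 D + 16 (r / 24 + \<Omega> / 192) = 2/3 (r + 12 D) + \<Omega> / 12\<close>.
\<close>

lemma potential_contracts: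
  fixes c0 :: cost
  shows "potential (fst (run_sliding alg c0 (xin, yin))) \<le> 3 / 4 * \<Omega>"
proof -
  define z where "z = fst (run_sliding alg c0 (xin, yin))"
  let ?s = "(xs, ys)"
  note gap_bound = run_sliding_gap[where c = c0, folded z_def]
  have sZ: "?s \<in> X \<times> Y" using saddle by simp
  have slice: "z \<in> slice" by (rule gap_bound(1))
  then have zZ: "z \<in> X \<times> Y" by (rule slice_subset)
  have offset: "prox_map (z - (xin, yin)) \<bullet> v = 0" if "v \<in> Kx \<times> Ky" for v
    using slice that unfolding slice_def by blast
  have "(fst z - xs) \<bullet> k = 0" if k: "k \<in> Kx" for k
  proof -
    have "(fst z - xin) \<bullet> k = 0"
      using offset[of "(k, 0)"] k zero_in_invariant_kernel \<delta>_pos by (cases z) (simp add: prox_map_def)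
    then show ?thesis using initial_offset_orthogonal(1)[OF k] by (simp add: inner_diff_left)
  qed
  moreover have "(snd z - ys) \<bullet> k = 0" if k: "k \<in> Ky" for k
  proof -
    have "(snd z - yin) \<bullet> k = 0"
      using offset[of "(0, k)"] k zero_in_invariant_kernel \<delta>_pos by (cases z) (simp add: prox_map_def)
    then show ?thesis using initial_offset_orthogonal(2)[OF k] by (simp add: inner_diff_left)
  qed
  ultimately have low: "potential z \<le> 8 * (Df xin + Dg yin) +
      16 * (\<Sum>i\<in>{1, 2, 3}. summand i z - summand i ?s + fst (part_Q i ?s) \<bullet> (z - ?s))"
    using zZ by (intro potential_lower_bound)
  define r where "r = N ((xin, yin) - ?s)"
  have r: "0 \<le> r" "N (?s - (xin, yin)) = r" unfolding r_def by (rule N_nonneg, rule N_minus_commute)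
  have "(\<Sum>i\<in>{1, 2, 3}. summand i z - summand i ?s + fst (part_Q i ?s) \<bullet> (z - ?s)) =
      (\<Sum>i\<in>{0<..3}. summand (\<pi> i) z - summand (\<pi> i) ?s + fst (part_Q (\<pi> i) ?s) \<bullet> (z - ?s))"
    by (rule sum_levels[symmetric])
  also have "\<dots> \<le> (\<Sum>i\<in>{0<..3}. coeff i [] * r + err i [])"
    using gap_bound(2)[OF sZ] unfolding r(2) by (simp add: alg_def)
  also have "\<dots> \<le> (\<Sum>i\<in>{0<..3::nat}. 1 / 72 * r) + \<Omega> / 192"
    unfolding sum.distrib using r(1) by (intro add_mono sum_mono mult_right_mono coeff_small err_total)
  also have "\<dots> = r / 24 + \<Omega> / 192" by simp
  finally have gap: "(\<Sum>i\<in>{1, 2, 3}. summand i z - summand i ?s + fst (part_Q i ?s) \<bullet> (z - ?s)) \<le> r / 24 + \<Omega> / 192" .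
  have "r + 12 * (Df xin + Dg yin) \<le> \<Omega>" using \<Omega>(2) by (simp add: potential_def r_def)
  then show ?thesis using low gap unfolding z_def[symmetric] by linarith
qed

lemma run_count:
  fixes \<phi> :: "cost \<Rightarrow> nat"
  assumes "\<And>c c'. \<phi> (c + c') = \<phi> c + \<phi> c'"
    and "\<And>i z. \<phi> (snd (part_grad i z)) = a i" and "\<And>i z. \<phi> (snd (part_Q i z)) = b i"
  shows "\<phi> (snd (run_sliding alg c (xin, yin))) = \<phi> c + (\<Sum>i\<in>{1, 2, 3}. passes i * (a i + 2 * b i))"
proof -
  have "\<phi> (snd (run_sliding alg c (xin, yin))) = \<phi> c +
      (\<Sum>i\<in>{0<..sl_n alg}. (\<Prod>l\<in>{0<..i}. sl_T alg l) * (a (\<pi> i) + 2 * b (\<pi> i)))"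
    by (rule run_sliding_cost) (simp_all add: assms alg_def)
  also have "\<dots> = \<phi> c + (\<Sum>i\<in>{0<..3}. passes (\<pi> i) * (a (\<pi> i) + 2 * b (\<pi> i)))"
    by (simp add: alg_def passes_\<pi>)
  also have "(\<Sum>i\<in>{0<..3}. passes (\<pi> i) * (a (\<pi> i) + 2 * b (\<pi> i))) = (\<Sum>i\<in>{1, 2, 3}. passes i * (a i + 2 * b i))"
    by (rule sum_levels)
  finally show ?thesis .
qed

text \<open>
  The two additional evaluations are those at the starting point that enter \<open>p\<^sub>3\<close>. At its level the third
  function takes four products for the gradient and two for each of the two evaluations of \<open>Q\<^sub>3\<close>.
\<close>

lemma oracle_counts:
  defines "c \<equiv> snd (run_sliding alg ((1, 0, 0) + (0, 1, 0)) (xin, yin))"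
  shows "fst c = Suc (passes 1)" "fst (snd c) = Suc (passes 2)" "snd (snd c) = 8 * passes 3"
  using run_count[of fst "\<lambda>i. if i = 1 then 1 else 0" "\<lambda>_. 0" "(1, 0, 0) + (0, 1, 0)"]
    run_count[of "\<lambda>c. fst (snd c)" "\<lambda>i. if i = 2 then 1 else 0" "\<lambda>_. 0" "(1, 0, 0) + (0, 1, 0)"]
    run_count[of "\<lambda>c. snd (snd c)" "\<lambda>i. if i = 1 \<or> i = 2 then 0 else 4" "\<lambda>i. if i = 3 then 2 else 0"
      "(1, 0, 0) + (0, 1, 0)"]
  by (auto simp: c_def oracle_defs)

lemma bilinear_sliding_alg:
  "bilinear_sliding dx dy B X Y f' g' \<beta>x \<beta>y \<delta>x \<delta>y Lc Mc \<pi> T (xin, yin) =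
    run_sliding alg ((1, 0, 0) + (0, 1, 0)) (xin, yin)"
  by (simp add: bilinear_sliding_def eval_f_def eval_g_def alg_def)

end

context bilinear_saddle
begin

text \<open>
  The constant is \<open>8 (3 K + 1)\<close> with \<open>K = 450000\<close>: the products of the loop lengths exceed the rates
  at most by the factor \<open>3 K + 1\<close>, and a pass costs at most eight matrix-vector products.
\<close>

lemma contraction_with_counts:
  assumes \<Omega>: "0 < \<Omega>" "potential (xin, yin) \<le> \<Omega>" and \<pi>: "\<pi> permutes {1, 2, 3}"
    and sorted: "rate (\<pi> 1) \<Omega> \<le> rate (\<pi> 2) \<Omega>" "rate (\<pi> 2) \<Omega> \<le> rate (\<pi> 3) \<Omega>"
  shows "\<exists>T. 0 < T 1 \<and> 0 < T 2 \<and> 0 < T 3 \<and>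
    (let barNf = real (\<Prod>j=1..inv \<pi> 1. T j); barNg = real (\<Prod>j=1..inv \<pi> 2. T j);
         \<delta>f = (if \<nu>x < 1 then \<Omega> / (384 * barNf) else 0);
         \<delta>g = (if \<nu>y < 1 then \<Omega> / (384 * barNg) else 0);
         \<kappa>x = inexact_L \<nu>x Hx \<delta>f / \<delta>x; \<kappa>y = inexact_L \<nu>y Hy \<delta>g / \<delta>y;
         L = (\<lambda>i::nat. if i = 1 then \<kappa>x else if i = 2 then \<kappa>y else \<kappa>xy);
         M = (\<lambda>i::nat. if i = 1 \<or> i = 2 then 0 else sqrt \<kappa>xy);
         (zout, Nf, Ng, NB) = bilinear_sliding dx dy B X Y f' g' \<beta>x \<beta>y \<delta>x \<delta>y L M \<pi> T (xin, yin)
     in potential zout \<le> 3 / 4 * \<Omega> \<and> real Nf \<le> 10800008 * rate 1 \<Omega> \<and>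
       real Ng \<le> 10800008 * rate 2 \<Omega> \<and> real NB \<le> 10800008 * rate 3 \<Omega>)"
proof -
  obtain T :: "nat \<Rightarrow> nat" where T: "\<And>i. 0 < T i"
    "\<And>i. i \<in> {1, 2, 3} \<Longrightarrow> loop_const * rate (\<pi> i) \<Omega> \<le> real (\<Prod>l\<in>{0<..i}. T l)"
    "\<And>i. i \<in> {1, 2, 3} \<Longrightarrow> real (\<Prod>l\<in>{0<..i}. T l) \<le> (3 * loop_const + 1) * rate (\<pi> i) \<Omega>"
    using nested_loop_lengths[of loop_const "\<lambda>i. rate (\<pi> i) \<Omega>"] rate_ge_1 sorted
    by (auto simp: loop_const_def)
  interpret run: bilinear_sliding_run dx dy X Y f g f' g' B \<mu>x \<mu>y \<nu>x \<nu>y Hx Hy Lxy \<mu>xy \<mu>yx invx invy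
    xs ys fs gs \<xi> \<zeta> xin yin \<beta>x \<beta>y \<delta>x \<delta>y \<kappa>xy \<Omega> \<pi> T
    by unfold_locales (use \<Omega> \<pi> T in auto)
  have passes: "(\<Prod>j=1..inv \<pi> i. T j) = run.passes i" for i
    by (simp add: run.passes_def atLeastSucAtMost_greaterThanAtMost)
  have upper: "real (run.passes i) \<le> 1350001 * rate i \<Omega>" if "i \<in> {1, 2, 3}" for i
  proof -
    have "inv \<pi> i \<in> {1, 2, 3}" using permutes_in_image[OF permutes_inv[OF \<pi>]] that by blast
    from T(3)[OF this] show ?thesis by (simp add: run.passes_def run.inv_\<pi> loop_const_def)
  qed
  have L: "(\<lambda>i::nat. if i = 1 then inexact_L \<nu>x Hx run.\<delta>f / \<delta>x else if i = 2 then inexact_L \<nu>y Hy run.\<delta>g / \<delta>y else \<kappa>xy) = run.Lc"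
    and M: "(\<lambda>i::nat. if i = 1 \<or> i = 2 then 0 else sqrt \<kappa>xy) = run.Mc"
    by (simp_all add: fun_eq_iff run.Lc_def run.Mc_def)
  have "real (Suc (run.passes 1)) \<le> 10800008 * rate 1 \<Omega>" "real (Suc (run.passes 2)) \<le> 10800008 * rate 2 \<Omega>"
    "real (8 * run.passes 3) \<le> 10800008 * rate 3 \<Omega>"
    using upper[of 1] upper[of 2] upper[of 3] rate_ge_1[of 1 \<Omega>] rate_ge_1[of 2 \<Omega>] rate_ge_1[of 3 \<Omega>] by simp_all
  then show ?thesis
    using run.potential_contracts run.oracle_counts T(1)
    by (intro exI[of _ T])
      (simp only: Let_def passes run.\<delta>f_def[symmetric] run.\<delta>g_def[symmetric] L M run.bilinear_sliding_alg case_prod_beta simp_thms)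
qed

end

theorem theorem4p4:
  "\<exists>C::real. C > 0 \<and>
    (\<forall>(dx::nat) (dy::nat) (X::fvec set) (Y::fvec set) (f::fvec \<Rightarrow> real) (g::fvec \<Rightarrow> real)
      (f'::fvec \<Rightarrow> fvec) (g'::fvec \<Rightarrow> fvec) (B::mat_fun)
      (\<mu>x::real) (\<mu>y::real) (\<nu>x::real) (\<nu>y::real) (Hx::real) (Hy::real)
      (Lxy::real) (\<mu>xy::real) (\<mu>yx::real) (invx::bool) (invy::bool)
      (xs::fvec) (ys::fvec) (fs::fvec) (gs::fvec) (\<xi>::fvec) (\<zeta>::fvec)
      (xin::fvec) (yin::fvec) (\<Omega>::real) (\<pi>::nat \<Rightarrow> nat).
     let Bm = matvec dy dx B; Bt = matvec dx dy (mtrans B);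
         \<beta>x = reg_coeff \<nu>y Hy; \<beta>y = reg_coeff \<nu>x Hx;
         \<delta>x = \<mu>x + 4 * \<beta>x * \<mu>xy\<^sup>2; \<delta>y = \<mu>y + 4 * \<beta>y * \<mu>yx\<^sup>2;
         \<kappa>xy = Lxy\<^sup>2 / (\<delta>x * \<delta>y);
         \<Psi> = (\<lambda>(x, y). pnorm2 \<delta>x \<delta>y ((x, y) - (xs, ys)) + 12 * bregman f fs x xs + 12 * bregman g gs y ys);
         R = (\<lambda>i::nat. if i = 1 then rate_holder \<nu>x Hx \<delta>x \<Omega>
               else if i = 2 then rate_holder \<nu>y Hy \<delta>y \<Omega>
               else max (sqrt \<kappa>xy) 1)
     in
       0 < dx \<and> 0 < dy \<and>
       X \<subseteq> Rn dx \<and> X \<noteq> {} \<and> closed X \<and> convex X \<and>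
       Y \<subseteq> Rn dy \<and> Y \<noteq> {} \<and> closed Y \<and> convex Y \<and>
       holder_class dx X f \<mu>x \<nu>x Hx \<and> holder_class dy Y g \<mu>y \<nu>y Hy \<and>
       (\<forall>x\<in>X. f' x \<in> subdiff dx f x) \<and> (\<forall>y\<in>Y. g' y \<in> subdiff dy g y) \<and>
       0 < Lxy \<and> 0 \<le> \<mu>xy \<and> 0 \<le> \<mu>yx \<and> max \<mu>xy \<mu>yx < Lxy \<and>
       lam_max dx (mmul dy (mtrans B) B) \<le> Lxy\<^sup>2 \<and>
       coupling_bound invx dx dy X f B \<mu>xy \<and> coupling_bound invy dy dx Y g (mtrans B) \<mu>yx \<and>
       (0 < \<mu>xy \<and> 0 < \<mu>yx \<longrightarrow> \<mu>xy = \<mu>yx) \<and>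
       (\<nu>x = 1 \<longrightarrow> ambient_smooth dx f Hx) \<and> (\<nu>y = 1 \<longrightarrow> ambient_smooth dy g Hy) \<and>
       xin \<in> X \<and> yin \<in> Y \<and>
       (xs, ys) \<in> saddle_points dx dy X Y f g B \<and>
       (invx \<longrightarrow> xin - xs \<in> mrange dx dy (mtrans B)) \<and> (invy \<longrightarrow> yin - ys \<in> mrange dy dx B) \<and>
       fs \<in> subdiff dx f xs \<and> gs \<in> subdiff dy g ys \<and>
       \<xi> \<in> normal_cone dx X xs \<and> \<zeta> \<in> normal_cone dy Y ys \<and>
       fs + Bt ys + \<xi> = 0 \<and> gs - Bm xs + \<zeta> = 0 \<and>
       0 < min \<delta>x \<delta>y \<and> \<beta>x * \<delta>y \<le> 1 / 4 \<and> \<beta>y * \<delta>x \<le> 1 / 4 \<and>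
       (0 < \<beta>x \<longrightarrow> \<zeta> = 0) \<and> (0 < \<beta>y \<longrightarrow> \<xi> = 0) \<and>
       0 < \<Omega> \<and> \<Psi> (xin, yin) \<le> \<Omega> \<and>
       \<pi> permutes {1, 2, 3} \<and> R (\<pi> 1) \<le> R (\<pi> 2) \<and> R (\<pi> 2) \<le> R (\<pi> 3)
       \<longrightarrow>
       (\<exists>T::nat \<Rightarrow> nat. 0 < T 1 \<and> 0 < T 2 \<and> 0 < T 3 \<and>
         (let barNf = real (\<Prod>j=1..inv \<pi> 1. T j); barNg = real (\<Prod>j=1..inv \<pi> 2. T j);
              \<delta>f = (if \<nu>x < 1 then \<Omega> / (384 * barNf) else 0);
              \<delta>g = (if \<nu>y < 1 then \<Omega> / (384 * barNg) else 0);
              \<kappa>x = inexact_L \<nu>x Hx \<delta>f / \<delta>x; \<kappa>y = inexact_L \<nu>y Hy \<delta>g / \<delta>y;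
              L = (\<lambda>i::nat. if i = 1 then \<kappa>x else if i = 2 then \<kappa>y else \<kappa>xy);
              M = (\<lambda>i::nat. if i = 1 \<or> i = 2 then 0 else sqrt \<kappa>xy);
              (zout, Nf, Ng, NB) =
                bilinear_sliding dx dy B X Y f' g' \<beta>x \<beta>y \<delta>x \<delta>y L M \<pi> T (xin, yin)
          in \<Psi> zout \<le> 3 / 4 * \<Omega> \<and> real Nf \<le> C * R 1 \<and> real Ng \<le> C * R 2 \<and> real NB \<le> C * R 3)))"
  unfolding Let_def
proof (intro exI[of _ 10800008] conjI allI impI, goal_cases)
  case 1
  show ?case by simp
next
  case (2 dx dy X Y f g f' g' B \<mu>x \<mu>y \<nu>x \<nu>y Hx Hy Lxy \<mu>xy \<mu>yx invx invy xs ys fs gs \<xi> \<zeta> xin yin \<Omega> \<pi>)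
  note hyp = 2
  have "(xs, ys) \<in> saddle_points dx dy X Y f g B" using hyp by blast
  then have saddle: "xs \<in> X" "ys \<in> Y" by (simp_all add: saddle_points_def Let_def)
  have "0 < min (\<mu>x + 4 * reg_coeff \<nu>y Hy * \<mu>xy\<^sup>2) (\<mu>y + 4 * reg_coeff \<nu>x Hx * \<mu>yx\<^sup>2)" using hyp by blast
  then have \<delta>_pos: "0 < \<mu>x + 4 * reg_coeff \<nu>y Hy * \<mu>xy\<^sup>2" "0 < \<mu>y + 4 * reg_coeff \<nu>x Hx * \<mu>yx\<^sup>2" by simp_all
  interpret bilinear_saddle dx dy X Y f g f' g' B \<mu>x \<mu>y \<nu>x \<nu>y Hx Hy Lxy \<mu>xy \<mu>yx invx invy
    xs ys fs gs \<xi> \<zeta> xin yin "reg_coeff \<nu>y Hy" "reg_coeff \<nu>x Hx"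
    "\<mu>x + 4 * reg_coeff \<nu>y Hy * \<mu>xy\<^sup>2" "\<mu>y + 4 * reg_coeff \<nu>x Hx * \<mu>yx\<^sup>2"
    "Lxy\<^sup>2 / ((\<mu>x + 4 * reg_coeff \<nu>y Hy * \<mu>xy\<^sup>2) * (\<mu>y + 4 * reg_coeff \<nu>x Hx * \<mu>yx\<^sup>2))"
    by unfold_locales (use hyp saddle \<delta>_pos in blast)+
  have potential: "potential = (\<lambda>(x, y). pnorm2 (\<mu>x + 4 * reg_coeff \<nu>y Hy * \<mu>xy\<^sup>2) (\<mu>y + 4 * reg_coeff \<nu>x Hx * \<mu>yx\<^sup>2)
      ((x, y) - (xs, ys)) + 12 * bregman f fs x xs + 12 * bregman g gs y ys)"
    by (auto simp: fun_eq_iff potential_def)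
  show ?case
    using hyp by (intro contraction_with_counts[of \<Omega> \<pi>, unfolded potential rate_def Let_def]) blast+
qed

end
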